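(* Let $\rho_2>1$, $\rho_1\geq 0$, and let $\{V_m\}_{m\in\mathbb{Z}}$ be a $(\rho_1,\rho_2)$-regular MRA of $L^2(\mathbb{R}^d)$, with orthogonal projections $q_m:L^2(\mathbb{R}^d)\to V_m$. Set $\sigma=\rho_1+\rho_2-1$ and let $s\geq\sigma$ and $t\geq\rho_2$. (i) If $\varphi\in\mathcal{S}^{s-\sigma}_{t}(\mathbb{R}^d)$, then $\lim_{m\to\infty} q_m\varphi=\varphi$ in $\mathcal{S}^{s}_{t}(\mathbb{R}^d)$. (ii) If $f\in(\mathcal{S}^{s}_{t}(\mathbb{R}^d))'$, then $\lim_{m\to\infty} q_m f=f$ in $(\mathcal{S}^{s-\sigma}_{t}(\mathbb{R}^d))'$.
   Context: For $\rho_1,\rho_2\geq 0$, the Gelfand-Shilov space $\mathcal{S}^{\rho_1}_{\rho_2}(\mathbb{R}^d)$ is the set of $\varphi\in\mathcal{S}(\mathbb{R}^d)$ for which there is $h>0$ with $p_h^{\rho_1,\rho_2}(\varphi)=\sup_{x\in\mathbb{R}^d,\alpha,\beta\in\mathbb{N}^d}\frac{h^{|\alpha+\beta|}}{\alpha!^{\rho_2}\beta!^{\rho_1}}|x^\alpha\partial^\beta\varphi(x)|<\infty$; it carries the inductive limit topology defined by these norms (as $h\to 0^+$), and $(\mathcal{S}^{\rho_1}_{\rho_2}(\mathbb{R}^d))'$ denotes its dual (ultradistributions). A multiresolution approximation (MRA) is an increasing sequence $\{V_m\}_{m\in\mathbb{Z}}$ of closed subspaces of $L^2(\mathbb{R}^d)$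 such that: $\bigcap_m V_m=\{0\}$ and $\bigcup_m V_m$ is dense in $L^2(\mathbb{R}^d)$; $f(x)\in V_m\iff f(2x)\in V_{m+1}$; $f(x)\in V_0\iff f(x-n)\in V_0$ for all $n\in\mathbb{Z}^d$; and there is $\phi\in L^2(\mathbb{R}^d)$ (a scaling function) such that $\{\phi(x-n)\}_{n\in\mathbb{Z}^d}$ is an orthonormal basis of $V_0$. The MRA is called $(\rho_1,\rho_2)$-regular (with $\rho_1\ge0,\rho_2>1$) if it has a scaling function $\phi\in\mathcal{S}^{\rho_1}_{\rho_2}(\mathbb{R}^d)$; such a $\phi$ is fixed. The projection onto $V_0$ has kernel $q_0(x,y)=\sum_{k\in\mathbb{Z}^d}\phi(x-k)\overline{\phi(y-k)}$, and $q_m(x,y)=2^{md}q_0(2^mx,2^my)$, $(q_mf)(x)=\langle f(y),q_m(x,y)\rangle=\int f(y)q_m(x,y)\,dy$. For each fixed $x$, $q_m(x,\cdot)\in\mathcal{S}^{\rho_1}_{\rho_2}(\mathbb{R}^d)$, and for an ultradistribution $f$ the function $q_mf$ is defined by this same dual pairing formula. *)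

theory Defs
  imports "HOL-Analysis.Analysis"
begin

definition pd :: "'n::finite \<Rightarrow> (real^'n \<Rightarrow> complex) \<Rightarrow> real^'n \<Rightarrow> complex" where
  "pd i f x = vector_derivative (\<lambda>t. f (x + t *\<^sub>R axis i 1)) (at 0)"

fun pdl :: "'n::finite list \<Rightarrow> (real^'n \<Rightarrow> complex) \<Rightarrow> real^'n \<Rightarrow> complex" where
  "pdl [] f = f"
| "pdl (i # is) f = pd i (pdl is f)"

definition smooth_fun :: "(real^'n::finite \<Rightarrow> complex) \<Rightarrow> bool" where
  "smooth_fun f \<longleftrightarrow>
     (\<forall>is. continuous_on UNIV (pdl is f) \<and>
        (\<forall>i x. ((\<lambda>t. pdl is f (x + t *\<^sub>R axis i 1)) has_vector_derivative pdl (i # is) f x) (at 0)))"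

text \<open>The derivative of multi-index beta (for smooth functions the order of
  differentiation is irrelevant).\<close>
definition dmulti :: "('n::finite \<Rightarrow> nat) \<Rightarrow> (real^'n \<Rightarrow> complex) \<Rightarrow> real^'n \<Rightarrow> complex" where
  "dmulti \<beta> f = pdl (SOME is. \<forall>i. count_list is i = \<beta> i) f"

definition mabs :: "('n::finite \<Rightarrow> nat) \<Rightarrow> nat" where
  "mabs \<alpha> = (\<Sum>i\<in>UNIV. \<alpha> i)"

definition mfact :: "('n::finite \<Rightarrow> nat) \<Rightarrow> real" where
  "mfact \<alpha> = (\<Prod>i\<in>UNIV. fact (\<alpha> i))"

definition mpow :: "real^'n::finite \<Rightarrow> ('n \<Rightarrow> nat) \<Rightarrow> real" where
  "mpow x \<alpha> = (\<Prod>i\<in>UNIV. (x $ i) ^ (\<alpha> i))"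

definition schwartz :: "(real^'n::finite \<Rightarrow> complex) \<Rightarrow> bool" where
  "schwartz f \<longleftrightarrow> smooth_fun f \<and>
     (\<forall>\<alpha> \<beta>. \<exists>C. \<forall>x. \<bar>mpow x \<alpha>\<bar> * cmod (dmulti \<beta> f x) \<le> C)"

definition gs_bound :: "real \<Rightarrow> real \<Rightarrow> real \<Rightarrow> (real^'n::finite \<Rightarrow> complex) \<Rightarrow> real \<Rightarrow> bool" where
  "gs_bound r1 r2 h f C \<longleftrightarrow>
     (\<forall>x \<alpha> \<beta>. h ^ (mabs \<alpha> + mabs \<beta>) / (mfact \<alpha> powr r2 * mfact \<beta> powr r1)
                 * (\<bar>mpow x \<alpha>\<bar> * cmod (dmulti \<beta> f x)) \<le> C)"

definition GS :: "real \<Rightarrow> real \<Rightarrow> (real^'n::finite \<Rightarrow> complex) set" where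
  "GS r1 r2 = {f. schwartz f \<and> (\<exists>h>0. \<exists>C. gs_bound r1 r2 h f C)}"

text \<open>Basic neighbourhoods of 0 of the locally convex inductive limit topology:
  absolutely convex subsets U whose trace on each step space
  E_h = {f. p_h(f) < \<infinity>} is a neighbourhood of 0 for the norm p_h.\<close>
definition gs_nbhd0 :: "real \<Rightarrow> real \<Rightarrow> (real^'n::finite \<Rightarrow> complex) set \<Rightarrow> bool" where
  "gs_nbhd0 r1 r2 U \<longleftrightarrow> U \<subseteq> GS r1 r2 \<and>
     (\<forall>f\<in>U. \<forall>g\<in>U. \<forall>a b::complex. cmod a + cmod b \<le> 1 \<longrightarrow> (\<lambda>x. a * f x + b * g x) \<in> U) \<and>
     (\<forall>h>0. \<exists>\<epsilon>>0. \<forall>f. schwartz f \<and> gs_bound r1 r2 h f \<epsilon> \<longrightarrow> f \<in> U)"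

definition gs_tendsto :: "real \<Rightarrow> real \<Rightarrow> (nat \<Rightarrow> real^'n::finite \<Rightarrow> complex) \<Rightarrow> (real^'n \<Rightarrow> complex) \<Rightarrow> bool" where
  "gs_tendsto r1 r2 F f \<longleftrightarrow> f \<in> GS r1 r2 \<and> (\<forall>m. F m \<in> GS r1 r2) \<and>
     (\<forall>U. gs_nbhd0 r1 r2 U \<longrightarrow> (\<forall>\<^sub>F m in sequentially. (\<lambda>x. F m x - f x) \<in> U))"

definition gs_bounded :: "real \<Rightarrow> real \<Rightarrow> (real^'n::finite \<Rightarrow> complex) set \<Rightarrow> bool" where
  "gs_bounded r1 r2 B \<longleftrightarrow> B \<subseteq> GS r1 r2 \<and>
     (\<forall>U. gs_nbhd0 r1 r2 U \<longrightarrow> (\<exists>c>0. \<forall>g\<in>B. (\<lambda>x. g x / complex_of_real c) \<in> U))"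

definition gs_dual :: "real \<Rightarrow> real \<Rightarrow> ((real^'n::finite \<Rightarrow> complex) \<Rightarrow> complex) \<Rightarrow> bool" where
  "gs_dual r1 r2 T \<longleftrightarrow>
     (\<forall>f\<in>GS r1 r2. \<forall>g\<in>GS r1 r2. \<forall>a b::complex. T (\<lambda>x. a * f x + b * g x) = a * T f + b * T g) \<and>
     (\<forall>\<epsilon>>0. \<exists>U. gs_nbhd0 r1 r2 U \<and> (\<forall>f\<in>U. cmod (T f) < \<epsilon>))"

definition gs_dual_tendsto :: "real \<Rightarrow> real \<Rightarrow> (nat \<Rightarrow> (real^'n::finite \<Rightarrow> complex) \<Rightarrow> complex)
     \<Rightarrow> ((real^'n \<Rightarrow> complex) \<Rightarrow> complex) \<Rightarrow> bool" where
  "gs_dual_tendsto r1 r2 S T \<longleftrightarrow> gs_dual r1 r2 T \<and> (\<forall>m. gs_dual r1 r2 (S m)) \<and>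
     (\<forall>B. gs_bounded r1 r2 B \<longrightarrow>
        (\<forall>\<epsilon>>0. \<forall>\<^sub>F m in sequentially. \<forall>g\<in>B. cmod (S m g - T g) < \<epsilon>))"

definition L2 :: "(real^'n::finite \<Rightarrow> complex) set" where
  "L2 = {f. f \<in> borel_measurable lborel \<and> integrable lborel (\<lambda>x. (cmod (f x))\<^sup>2)}"

definition l2_inner :: "(real^'n::finite \<Rightarrow> complex) \<Rightarrow> (real^'n \<Rightarrow> complex) \<Rightarrow> complex" where
  "l2_inner f g = integral\<^sup>L lborel (\<lambda>x. f x * cnj (g x))"

definition l2_norm :: "(real^'n::finite \<Rightarrow> complex) \<Rightarrow> real" where
  "l2_norm f = sqrt (integral\<^sup>L lborel (\<lambda>x. (cmod (f x))\<^sup>2))"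

definition closed_subspace_L2 :: "(real^'n::finite \<Rightarrow> complex) set \<Rightarrow> bool" where
  "closed_subspace_L2 V \<longleftrightarrow> V \<subseteq> L2 \<and> (\<lambda>x. 0) \<in> V \<and>
     (\<forall>f\<in>V. \<forall>g\<in>V. \<forall>a b::complex. (\<lambda>x. a * f x + b * g x) \<in> V) \<and>
     (\<forall>F f. (\<forall>n. F n \<in> V) \<longrightarrow> f \<in> L2 \<longrightarrow> (\<lambda>n. l2_norm (\<lambda>x. F n x - f x)) \<longlonglongrightarrow> 0 \<longrightarrow> f \<in> V)"

definition lattice :: "(real^'n::finite) set" where
  "lattice = {k. \<forall>i. k $ i \<in> \<int>}"

definition MRA :: "(int \<Rightarrow> (real^'n::finite \<Rightarrow> complex) set) \<Rightarrow> bool" where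
  "MRA V \<longleftrightarrow> (\<forall>m. closed_subspace_L2 (V m)) \<and> (\<forall>m. V m \<subseteq> V (m + 1)) \<and>
     (\<forall>f. (\<forall>m. f \<in> V m) \<longrightarrow> l2_norm f = 0) \<and>
     (\<forall>f\<in>L2. \<forall>\<epsilon>>0. \<exists>m. \<exists>g\<in>V m. l2_norm (\<lambda>x. f x - g x) < \<epsilon>) \<and>
     (\<forall>m f. f \<in> V m \<longleftrightarrow> (\<lambda>x. f (2 *\<^sub>R x)) \<in> V (m + 1)) \<and>
     (\<forall>f. f \<in> V 0 \<longleftrightarrow> (\<forall>n\<in>lattice. (\<lambda>x. f (x - n)) \<in> V 0))"

definition scaling_function :: "(int \<Rightarrow> (real^'n::finite \<Rightarrow> complex) set) \<Rightarrow> (real^'n \<Rightarrow> complex) \<Rightarrow> bool" where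
  "scaling_function V \<phi> \<longleftrightarrow> \<phi> \<in> L2 \<and>
     (\<forall>n\<in>lattice. (\<lambda>x. \<phi> (x - n)) \<in> V 0) \<and>
     (\<forall>n\<in>lattice. \<forall>k\<in>lattice. l2_inner (\<lambda>x. \<phi> (x - n)) (\<lambda>x. \<phi> (x - k)) = (if n = k then 1 else 0)) \<and>
     (\<forall>f\<in>V 0. \<forall>\<epsilon>>0. \<exists>N c. finite N \<and> N \<subseteq> lattice \<and>
         l2_norm (\<lambda>x. f x - (\<Sum>n\<in>N. c n * \<phi> (x - n))) < \<epsilon>)"

definition q0 :: "(real^'n::finite \<Rightarrow> complex) \<Rightarrow> real^'n \<Rightarrow> real^'n \<Rightarrow> complex" where
  "q0 \<phi> x y = infsum (\<lambda>k. \<phi> (x - k) * cnj (\<phi> (y - k))) lattice"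

definition qker :: "(real^'n::finite \<Rightarrow> complex) \<Rightarrow> int \<Rightarrow> real^'n \<Rightarrow> real^'n \<Rightarrow> complex" where
  "qker \<phi> m x y = complex_of_real (2 powr (real_of_int m * real CARD('n)))
       * q0 \<phi> ((2 powr real_of_int m) *\<^sub>R x) ((2 powr real_of_int m) *\<^sub>R y)"

definition qfun :: "(real^'n::finite \<Rightarrow> complex) \<Rightarrow> int \<Rightarrow> (real^'n \<Rightarrow> complex) \<Rightarrow> real^'n \<Rightarrow> complex" where
  "qfun \<phi> m g x = integral\<^sup>L lborel (\<lambda>y. g y * qker \<phi> m x y)"

definition qdist :: "(real^'n::finite \<Rightarrow> complex) \<Rightarrow> int \<Rightarrow> ((real^'n \<Rightarrow> complex) \<Rightarrow> complex) \<Rightarrow> real^'n \<Rightarrow> complex" where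
  "qdist \<phi> m T x = T (\<lambda>y. qker \<phi> m x y)"

end

theory Submission
  imports Defs
begin

text \<open>
Writing $q_m g$ as a lattice series of dilated translates of $\phi$, everything rests on two facts:
  the kernel $q_0$ reproduces all polynomials, and $q_0(x,y)$ together with its derivatives in $x$
  has moments in $y - x$ of Gelfand-Shilov size.

  Polynomial reproduction needs neither the Fourier transform nor density of the union of the spaces
  $V_m$.  Since $\phi(2^{-m}\cdot)$ lies in $V_0$, it is fixed by the projection; inserting the
  Taylor expansion of $\phi$, evaluating at points $u + k$ of a shifted lattice, where the moments
  are periodic, and letting $m \to \infty$ shows inductively that
  $\int q_0(u,y) (D_{y-u}^n \phi)(x)\,dy = 0$ for all $x$ and $n \ge 1$.  Integrating this identity
  by parts against monomials of degree $n$ isolates the individual moments, because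
  $\int \phi \ne 0$.

  For the error, subtract from $g$ its Taylor polynomial of degree $|\beta|$ at $x$ before applying
  $\partial^\beta q_m$: the remainder contributes $2^{-m}$ and the factor
  $(|\beta|+1)!^{(s-\sigma)-1+\rho_1+\rho_2} = (|\beta|+1)!^{s}$.  This gives
  $p(q_m g - g) \le C\,2^{-m} p'(g)$ between step norms, hence (i).  For (ii),
  $\langle q_m f, g\rangle = \langle f, \overline{q_m \overline{g}}\rangle$, and the polar of the
  functionals $g \mapsto 2^m \langle f, \overline{q_m \overline{g}} - g\rangle$ is a
  neighbourhood of zero, so it absorbs every bounded set.
\<close>

section \<open>Smooth functions and Taylor polynomials\<close>

text \<open>The projection has to act on polynomials, which are not square integrable, so
  \<open>Q\<close> is defined as an absolutely convergent integral on all measurable functions of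
  polynomial growth. The Hilbert space side enters only through the dilates of \<phi>, for which
  this integral is shown to return the function pointwise.

  The loss \<sigma> = \<rho>1 + \<rho>2 - 1 is a count of factorials. With n = |\<beta>| and up to
  geometric factors, the n + 1 derivatives of g in the Taylor remainder cost n!^(s - \<sigma>), the
  remainder formula gains 1/n!, the kernel moment of order n + 1 costs n!^\<rho>2, and the n
  derivatives of \<phi> cost n!^\<rho>1. Geometric factors only change the step h of the inductive
  limit. Taylor degree n makes the remainder scale as 2^(-m(n+1)), against 2^(mn) lost by
  differentiating at scale m.

  In (ii) the delicate point is to move f under the integral. Both sides of the duality formula are
  expanded in the values of f on dilated translates of the conjugate of \<phi>; summability comes
  from the decay of the lattice coefficients.\<close>

lemma pdl_step:
  assumes "smooth_fun f"
  shows "((\<lambda>t. pdl is f (x + t *\<^sub>R axis i 1)) has_vector_derivative pdl (i # is) f x) (at 0)"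
  using assms unfolding smooth_fun_def by blast

lemma pdl_continuous: "smooth_fun f \<Longrightarrow> continuous_on S (pdl is f)"
  unfolding smooth_fun_def by (meson continuous_on_subset subset_UNIV)

lemma pd_step:
  assumes "smooth_fun f"
  shows "((\<lambda>t. f (x + t *\<^sub>R axis i 1)) has_vector_derivative pd i f x) (at 0)"
  using pdl_step[OF assms, of "[]"] by simp

lemma smooth_continuous: "smooth_fun f \<Longrightarrow> continuous_on S f"
  using pdl_continuous[of f S "[]"] by simp

lemma pdl_append: "pdl (is @ js) f = pdl is (pdl js f)"
  by (induction "is") auto

lemma smooth_pdl: "smooth_fun f \<Longrightarrow> smooth_fun (pdl js f)"
  unfolding smooth_fun_def pdl_append[symmetric] by (metis append_Cons)

lemma smooth_pd: "smooth_fun f \<Longrightarrow> smooth_fun (pd i f)"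
  using smooth_pdl[of f "[i]"] by simp

text \<open>Derivatives along a coordinate line are unique, so a continuous family \<open>G\<close>
  with the right start that differentiates from \<open>is\<close> to \<open>i # is\<close> must be
  the family of iterated partial derivatives. Linear combinations, conjugates, affine substitutions,
  Taylor polynomials and series are all treated by guessing \<open>G\<close>.\<close>

lemma smooth_funI:
  assumes "G [] = f"
    and "\<And>is. continuous_on UNIV (G is)"
    and "\<And>is i x. ((\<lambda>t. G is (x + t *\<^sub>R axis i 1)) has_vector_derivative G (i # is) x) (at 0)"
  shows "smooth_fun f" and "pdl is f = G is"
proof -
  have eq: "pdl is f = G is" for "is"
  proof (induction "is")
    case (Cons i "is")
    show ?case
      using assms(3)[of "is" _ i] by (auto simp: Cons pd_def fun_eq_iff intro!: vector_derivative_at)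
  qed (simp add: assms)
  then show "pdl is f = G is" .
  show "smooth_fun f"
    unfolding smooth_fun_def eq using assms by auto
qed

section \<open>Closure of smooth functions under linear combinations, conjugation and affine
  maps\<close>

lemma smooth_lincomb:
  assumes "smooth_fun f" "smooth_fun g"
  shows "smooth_fun (\<lambda>x. a * f x + b * g x)"
    and "pdl is (\<lambda>x. a * f x + b * g x) = (\<lambda>x. a * pdl is f x + b * pdl is g x)"
proof -
  note * = smooth_funI[where G = "\<lambda>is x. a * pdl is f x + b * pdl is g x" and f = "\<lambda>x. a * f x + b * g x"]
  have 2: "continuous_on UNIV (\<lambda>x. a * pdl is f x + b * pdl is g x)" for "is"
    by (intro continuous_intros pdl_continuous assms)
  have 3: "((\<lambda>t. a * pdl is f (x + t *\<^sub>R axis i 1) + b * pdl is g (x + t *\<^sub>R axis i 1)) has_vector_derivative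
     a * pdl (i # is) f x + b * pdl (i # is) g x) (at 0)" for "is" i x
    by (intro has_vector_derivative_add has_vector_derivative_mult_right pdl_step assms)
  show "smooth_fun (\<lambda>x. a * f x + b * g x)"
    by (rule *(1)) (use 2 3 in simp_all)
  show "pdl is (\<lambda>x. a * f x + b * g x) = (\<lambda>x. a * pdl is f x + b * pdl is g x)"
    by (rule *(2)) (use 2 3 in simp_all)
qed

lemma smooth_mult_left:
  assumes "smooth_fun f"
  shows "smooth_fun (\<lambda>x. a * f x)"
    and "pdl is (\<lambda>x. a * f x) = (\<lambda>x. a * pdl is f x)"
  using smooth_lincomb[OF assms assms, where a = a and b = 0] by simp_all

lemma smooth_diff:
  assumes "smooth_fun f" "smooth_fun g"
  shows "smooth_fun (\<lambda>x. f x - g x)"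
    and "pdl is (\<lambda>x. f x - g x) = (\<lambda>x. pdl is f x - pdl is g x)"
  using smooth_lincomb[OF assms, where a = 1 and b = "-1"] by simp_all

lemma smooth_cnj:
  assumes "smooth_fun f"
  shows "smooth_fun (\<lambda>x. cnj (f x))"
    and "pdl is (\<lambda>x. cnj (f x)) = (\<lambda>x. cnj (pdl is f x))"
proof -
  note * = smooth_funI[where G = "\<lambda>is x. cnj (pdl is f x)" and f = "\<lambda>x. cnj (f x)"]
  have 2: "continuous_on UNIV (\<lambda>x. cnj (pdl is f x))" for "is"
    by (intro continuous_intros pdl_continuous assms)
  have 3: "((\<lambda>t. cnj (pdl is f (x + t *\<^sub>R axis i 1))) has_vector_derivative cnj (pdl (i # is) f x)) (at 0)" for "is" i x
    by (rule bounded_linear.has_vector_derivative[OF bounded_linear_cnj pdl_step[OF assms]])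
  show "smooth_fun (\<lambda>x. cnj (f x))"
    by (rule *(1)) (use 2 3 in simp_all)
  show "pdl is (\<lambda>x. cnj (f x)) = (\<lambda>x. cnj (pdl is f x))"
    by (rule *(2)) (use 2 3 in simp_all)
qed

lemma smooth_affine:
  fixes f :: "real^'n::finite \<Rightarrow> complex"
  assumes "smooth_fun f"
  shows "smooth_fun (\<lambda>x. f (c *\<^sub>R x + b))"
    and "pdl is (\<lambda>x. f (c *\<^sub>R x + b)) = (\<lambda>x. of_real c ^ length is * pdl is f (c *\<^sub>R x + b))"
proof -
  note * = smooth_funI[where G = "\<lambda>is x. of_real c ^ length is * pdl is f (c *\<^sub>R x + b)" and f = "\<lambda>x. f (c *\<^sub>R x + b)"]
  have 2: "continuous_on UNIV (\<lambda>x. of_real c ^ length is * pdl is f (c *\<^sub>R x + b))" for "is"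
    by (intro continuous_intros continuous_on_compose2[OF pdl_continuous[OF assms, of UNIV]]) auto
  have 3: "((\<lambda>t. of_real c ^ length is * pdl is f (c *\<^sub>R (x + t *\<^sub>R axis i 1) + b)) has_vector_derivative
      of_real c ^ length (i # is) * pdl (i # is) f (c *\<^sub>R x + b)) (at 0)" for "is" i x
  proof -
    let ?g = "\<lambda>t. pdl is f ((c *\<^sub>R x + b) + t *\<^sub>R axis i 1)"
    have g: "(?g has_vector_derivative pdl (i # is) f (c *\<^sub>R x + b)) (at (c * 0))"
      using pdl_step[OF assms] by simp
    have "((\<lambda>t. c * t) has_vector_derivative c) (at 0)"
      by (auto intro!: derivative_eq_intros simp: has_real_derivative_iff_has_vector_derivative[symmetric])
    then have "((?g \<circ> (\<lambda>t. c * t)) has_vector_derivative c *\<^sub>R pdl (i # is) f (c *\<^sub>R x + b)) (at 0)"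
      using g by (rule vector_diff_chain_at)
    then have "((\<lambda>t. of_real c ^ length is * (?g \<circ> (\<lambda>t. c * t)) t) has_vector_derivative
       of_real c ^ length is * (c *\<^sub>R pdl (i # is) f (c *\<^sub>R x + b))) (at 0)"
      by (rule has_vector_derivative_mult_right)
    then show ?thesis
      by (simp add: o_def algebra_simps scaleR_conv_of_real)
  qed
  show "smooth_fun (\<lambda>x. f (c *\<^sub>R x + b))"
    by (rule *(1)) (use 2 3 in simp_all)
  show "pdl is (\<lambda>x. f (c *\<^sub>R x + b)) = (\<lambda>x. of_real c ^ length is * pdl is f (c *\<^sub>R x + b))"
    by (rule *(2)) (use 2 3 in simp_all)
qed

text \<open>Smoothness only provides derivatives at parameter 0, but at every base point; moving the
  base point along the line gives the derivative at every parameter.\<close>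

lemma line_derivative_shift:
  fixes v :: "'a::real_vector"
  assumes der: "\<And>x. ((\<lambda>t. f (x + t *\<^sub>R v)) has_vector_derivative f' x) (at 0)"
  shows "((\<lambda>t. f (x + t *\<^sub>R v)) has_vector_derivative f' (x + s *\<^sub>R v)) (at s within S)"
proof -
  have 1: "((\<lambda>t. f ((x + s *\<^sub>R v) + t *\<^sub>R v)) has_vector_derivative f' (x + s *\<^sub>R v)) (at (s - s))"
    using der by simp
  have 2: "((\<lambda>t. t - s) has_vector_derivative 1) (at s)"
    by (auto intro!: derivative_eq_intros)
  have "((\<lambda>t. f ((x + s *\<^sub>R v) + t *\<^sub>R v)) \<circ> (\<lambda>t. t - s) has_vector_derivative 1 *\<^sub>R f' (x + s *\<^sub>R v)) (at s)"
    by (rule vector_diff_chain_at[OF 2 1])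
  moreover have "x + s *\<^sub>R v + (t - s) *\<^sub>R v = x + t *\<^sub>R v" for t
    by (simp add: scaleR_left_diff_distrib)
  ultimately have "((\<lambda>t. f (x + t *\<^sub>R v)) has_vector_derivative f' (x + s *\<^sub>R v)) (at s)"
    by (simp add: o_def)
  then show ?thesis
    by (rule has_vector_derivative_at_within)
qed

lemma pd_step_at:
  assumes "smooth_fun f"
  shows "((\<lambda>t. f (x + t *\<^sub>R axis i 1)) has_vector_derivative pd i f (x + s *\<^sub>R axis i 1)) (at s within S)"
  by (rule line_derivative_shift[OF pd_step[OF assms]])

text \<open>The hypotheses are posed on the symmetric interval so that increments \<open>h\<close>
  of either sign are covered.\<close>

lemma real_MVT_bound:
  fixes F :: "real \<Rightarrow> 'a::real_normed_vector"
  assumes "\<And>s. \<bar>s\<bar> \<le> \<bar>h\<bar> \<Longrightarrow> (F has_vector_derivative F' s) (at s)"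
    and "\<And>s. \<bar>s\<bar> \<le> \<bar>h\<bar> \<Longrightarrow> norm (F' s) \<le> B"
  shows "norm (F h - F 0) \<le> B * \<bar>h\<bar>"
proof -
  have "norm (F h - F 0) \<le> B * norm (h - 0)"
  proof (rule differentiable_bound[where f' = "\<lambda>s v. v *\<^sub>R F' s" and S = "{-\<bar>h\<bar>..\<bar>h\<bar>}"])
    show "(F has_derivative (\<lambda>v. v *\<^sub>R F' s)) (at s within {-\<bar>h\<bar>..\<bar>h\<bar>})" if "s \<in> {-\<bar>h\<bar>..\<bar>h\<bar>}" for s
      using assms(1)[of s] that unfolding has_vector_derivative_def
      by (rule_tac has_derivative_at_withinI) auto
    show "onorm (\<lambda>v. v *\<^sub>R F' s) \<le> B" if "s \<in> {-\<bar>h\<bar>..\<bar>h\<bar>}" for s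
    proof (rule onorm_le)
      have "norm (F' s) \<le> B"
        using assms(2)[of s] that by auto
      then show "norm (v *\<^sub>R F' s) \<le> B * norm v" for v
        by (metis abs_ge_zero mult.commute mult_left_mono norm_scaleR real_norm_def)
    qed
  qed auto
  then show ?thesis by simp
qed

text \<open>Schwarz's theorem: the second difference divided by h^2 tends to the mixed derivative in
  one order, and the second difference is symmetric in i and j.\<close>

lemma pd_commute:
  fixes f :: "real^'n::finite \<Rightarrow> complex"
  assumes f: "smooth_fun f"
  shows "pd i (pd j f) x = pd j (pd i f) x"
proof -
  define \<Delta> where "\<Delta> h = f (x + h *\<^sub>R axis i 1 + h *\<^sub>R axis j 1) - f (x + h *\<^sub>R axis i 1) - f (x + h *\<^sub>R axis j 1) + f x" for h
  \<comment> \<open>Proved for all i and j, from the continuity of \<open>pd j (pd i f)\<close> and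
    two applications of the mean value bound; exchanging i and j then gives the limit in the other
    order.\<close>
  have key: "((\<lambda>h. (f (x + h *\<^sub>R axis i 1 + h *\<^sub>R axis j 1) - f (x + h *\<^sub>R axis i 1) - f (x + h *\<^sub>R axis j 1) + f x) /\<^sub>R h^2)
       \<longlongrightarrow> pd j (pd i f) x) (at 0)" for i j
  proof (rule tendstoI)
    fix e :: real assume e: "e > 0"
    define c where "c = pd j (pd i f) x"
    have "isCont (pd j (pd i f)) x"
      using pdl_continuous[OF f, of UNIV "[j,i]"] by (simp add: continuous_on_eq_continuous_at)
    then obtain d where d: "d > 0" "\<And>y. dist y x < d \<Longrightarrow> dist (pd j (pd i f) y) c < e / 2"
      unfolding continuous_at_eps_delta c_def using e half_gt_zero[OF e] by blast
    have "norm ((f (x + h *\<^sub>R axis i 1 + h *\<^sub>R axis j 1) - f (x + h *\<^sub>R axis i 1) - f (x + h *\<^sub>R axis j 1) + f x) /\<^sub>R h^2 - c) < e"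
      if h: "h \<noteq> 0" "\<bar>h\<bar> < d / 2" for h
    proof -
      have in_ball: "dist (x + a *\<^sub>R axis i 1 + b *\<^sub>R axis j 1) x < d" if "\<bar>a\<bar> \<le> \<bar>h\<bar>" "\<bar>b\<bar> \<le> \<bar>h\<bar>" for a b
      proof -
        have "dist (x + a *\<^sub>R axis i 1 + b *\<^sub>R axis j 1) x = norm (a *\<^sub>R axis i (1::real) + b *\<^sub>R axis j 1 :: real^'n)"
          by (simp add: dist_norm algebra_simps)
        also have "\<dots> \<le> \<bar>a\<bar> + \<bar>b\<bar>"
          by (rule order_trans[OF norm_triangle_ineq]) simp
        finally show ?thesis using h that by linarith
      qed
      \<comment> \<open>The mean value bound in direction j, at every admissible offset
        \<open>a\<close> in direction i, so that it can serve as the derivative bound of the outer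
        application.\<close>
      have 1: "norm (pd i f (x + a *\<^sub>R axis i 1 + h *\<^sub>R axis j 1) - pd i f (x + a *\<^sub>R axis i 1) - h *\<^sub>R c) \<le> (e/2) * \<bar>h\<bar>"
        if a: "\<bar>a\<bar> \<le> \<bar>h\<bar>" for a
      proof -
        have "norm ((\<lambda>b. pd i f (x + a *\<^sub>R axis i 1 + b *\<^sub>R axis j 1) - b *\<^sub>R c) h
            - (\<lambda>b. pd i f (x + a *\<^sub>R axis i 1 + b *\<^sub>R axis j 1) - b *\<^sub>R c) 0) \<le> (e/2) * \<bar>h\<bar>"
        proof (rule real_MVT_bound[where F' = "\<lambda>b. pd j (pd i f) (x + a *\<^sub>R axis i 1 + b *\<^sub>R axis j 1) - c"])
          fix b :: real assume b: "\<bar>b\<bar> \<le> \<bar>h\<bar>"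
          show "((\<lambda>b. pd i f (x + a *\<^sub>R axis i 1 + b *\<^sub>R axis j 1) - b *\<^sub>R c) has_vector_derivative
              pd j (pd i f) (x + a *\<^sub>R axis i 1 + b *\<^sub>R axis j 1) - c) (at b)"
            by (intro has_vector_derivative_diff pd_step_at smooth_pd f) (auto intro!: derivative_eq_intros)
          show "norm (pd j (pd i f) (x + a *\<^sub>R axis i 1 + b *\<^sub>R axis j 1) - c) \<le> e / 2"
            using d(2)[OF in_ball[OF a b]] by (simp add: dist_norm)
        qed
        then show ?thesis by (simp add: algebra_simps)
      qed
      have "norm ((\<lambda>a. f (x + a *\<^sub>R axis i 1 + h *\<^sub>R axis j 1) - f (x + a *\<^sub>R axis i 1) - a *\<^sub>R (h *\<^sub>R c)) h
          - (\<lambda>a. f (x + a *\<^sub>R axis i 1 + h *\<^sub>R axis j 1) - f (x + a *\<^sub>R axis i 1) - a *\<^sub>R (h *\<^sub>R c)) 0) \<le> ((e/2) * \<bar>h\<bar>) * \<bar>h\<bar>"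
      proof (rule real_MVT_bound[where F' = "\<lambda>a. pd i f (x + a *\<^sub>R axis i 1 + h *\<^sub>R axis j 1) - pd i f (x + a *\<^sub>R axis i 1) - h *\<^sub>R c"])
        fix a :: real assume a: "\<bar>a\<bar> \<le> \<bar>h\<bar>"
        have "((\<lambda>a. f ((x + h *\<^sub>R axis j 1) + a *\<^sub>R axis i 1)) has_vector_derivative
               pd i f ((x + h *\<^sub>R axis j 1) + a *\<^sub>R axis i 1)) (at a)"
          by (rule pd_step_at[OF f])
        then have "((\<lambda>a. f (x + a *\<^sub>R axis i 1 + h *\<^sub>R axis j 1)) has_vector_derivative
               pd i f (x + a *\<^sub>R axis i 1 + h *\<^sub>R axis j 1)) (at a)"
          by (simp add: add_ac)
        then show "((\<lambda>a. f (x + a *\<^sub>R axis i 1 + h *\<^sub>R axis j 1) - f (x + a *\<^sub>R axis i 1) - a *\<^sub>R (h *\<^sub>R c)) has_vector_derivative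
            pd i f (x + a *\<^sub>R axis i 1 + h *\<^sub>R axis j 1) - pd i f (x + a *\<^sub>R axis i 1) - h *\<^sub>R c) (at a)"
          by (intro has_vector_derivative_diff pd_step_at f) (auto intro!: derivative_eq_intros)
        show "norm (pd i f (x + a *\<^sub>R axis i 1 + h *\<^sub>R axis j 1) - pd i f (x + a *\<^sub>R axis i 1) - h *\<^sub>R c) \<le> e / 2 * \<bar>h\<bar>"
          by (rule 1[OF a])
      qed
      then have *: "norm (f (x + h *\<^sub>R axis i 1 + h *\<^sub>R axis j 1) - f (x + h *\<^sub>R axis i 1) - f (x + h *\<^sub>R axis j 1) + f x - (h^2) *\<^sub>R c)
          \<le> (e/2) * h^2"
        by (simp add: algebra_simps power2_eq_square abs_mult_self_eq)
      let ?D = "f (x + h *\<^sub>R axis i 1 + h *\<^sub>R axis j 1) - f (x + h *\<^sub>R axis i 1) - f (x + h *\<^sub>R axis j 1) + f x"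
      have "?D /\<^sub>R h^2 - c = (?D - (h^2) *\<^sub>R c) /\<^sub>R h^2"
        using h(1) by (simp add: scaleR_diff_right)
      then have "norm (?D /\<^sub>R h^2 - c) = norm (?D - (h^2) *\<^sub>R c) / h^2"
        by (simp add: divide_inverse mult.commute)
      also have "\<dots> \<le> e/2"
        using * h(1) by (simp add: divide_le_eq)
      finally show ?thesis using e by simp
    qed
    then show "\<forall>\<^sub>F h in at 0. dist ((f (x + h *\<^sub>R axis i 1 + h *\<^sub>R axis j 1) - f (x + h *\<^sub>R axis i 1) - f (x + h *\<^sub>R axis j 1) + f x) /\<^sub>R h^2) (pd j (pd i f) x) < e"
      unfolding eventually_at using d(1)
      by (intro exI[of _ "d/2"]) (auto simp: dist_norm c_def)
  qed
  have "((\<lambda>h. \<Delta> h /\<^sub>R h^2) \<longlongrightarrow> pd j (pd i f) x) (at 0)"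
    using key[of i j] unfolding \<Delta>_def .
  moreover have "((\<lambda>h. \<Delta> h /\<^sub>R h^2) \<longlongrightarrow> pd i (pd j f) x) (at 0)"
    using key[of j i] unfolding \<Delta>_def by (simp add: algebra_simps)
  ultimately show ?thesis
    using tendsto_unique by (metis trivial_limit_at)
qed

lemma pdl_pd_commute: "smooth_fun f \<Longrightarrow> pdl is (pd i f) = pd i (pdl is f)"
proof (induction "is")
  case (Cons j "is")
  have "pd j (pd i (pdl is f)) = pd i (pd j (pdl is f))"
    using pd_commute[OF smooth_pdl[OF Cons.prems]] by blast
  with Cons show ?case by simp
qed simp

lemma pdl_cong_mset:
  assumes f: "smooth_fun f" and eq: "mset is = mset js"
  shows "pdl is f = pdl js f"
  using eq
proof (induction "is" arbitrary: js)
  case (Cons i "is")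
  then obtain ys zs where js: "js = ys @ i # zs"
    by (metis list.set_intros(1) mset_eq_setD split_list)
  have "mset is = mset (ys @ zs)"
    using Cons.prems js by simp
  then have "pdl is f = pdl (ys @ zs) f"
    by (rule Cons.IH)
  then show ?case
    by (simp add: js pdl_append pdl_pd_commute smooth_pdl f)
qed simp

text \<open>The list picked by \<open>SOME\<close> in \<open>dmulti\<close> is a permutation of
  \<open>is\<close>, and by \<open>pdl_cong_mset\<close> the order does not matter. This is the
  bridge from multi-indices to lists, which index the derivatives in all later estimates.\<close>

lemma dmulti_count_list:
  assumes "smooth_fun f"
  shows "dmulti (count_list is) f = pdl is f"
proof -
  have "\<forall>i. count_list (SOME js. \<forall>i. count_list js i = count_list is i) i = count_list is i"
    by (rule someI) auto
  then show ?thesis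
    unfolding dmulti_def
    by (intro pdl_cong_mset[OF assms]) (simp add: multiset_eq_iff count_mset)
qed

lemma ex_count_list:
  fixes \<beta> :: "'n::finite \<Rightarrow> nat"
  shows "\<exists>is. count_list is = \<beta>"
proof -
  obtain xs where "mset xs = Abs_multiset \<beta>"
    using ex_mset by blast
  moreover have "count (Abs_multiset \<beta>) = \<beta>"
    by (rule Abs_multiset_inverse) simp
  ultimately show ?thesis
    by (intro exI[of _ xs]) (auto simp: fun_eq_iff count_mset[symmetric])
qed

lemma mabs_count_list: "mabs (count_list (is :: 'n::finite list)) = length is"
  unfolding mabs_def by (metis sum_count_set finite_class.finite_UNIV subset_UNIV)


section \<open>Monomials and directional derivatives indexed by coordinate lists\<close>

definition monomial :: "'n::finite list \<Rightarrow> real^'n \<Rightarrow> real" where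
  "monomial js v = prod_list (map (\<lambda>i. v $ i) js)"

lemma monomial_simps [simp]: "monomial [] v = 1" "monomial (i # js) v = v $ i * monomial js v"
  by (simp_all add: monomial_def)

lemma monomial_le: "\<bar>monomial js v\<bar> \<le> norm v ^ length js"
  by (induction js) (auto simp: abs_mult intro!: mult_mono component_le_norm_cart)

lemma continuous_on_monomial [continuous_intros]:
  "continuous_on S f \<Longrightarrow> continuous_on S (\<lambda>x. monomial js (f x))"
  by (induction js) (auto intro!: continuous_intros)

lemma finite_length_eq [simp]: "finite {js :: 'n::finite list. length js = n}"
  using finite_lists_length_eq[of "UNIV :: 'n set" n] by simp

lemma card_length_eq: "card {js :: 'n::finite list. length js = n} = CARD('n) ^ n"
  using card_lists_length_eq[of "UNIV :: 'n set" n] by simp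

lemma sum_length_Suc:
  "(\<Sum>js | length (js :: 'n::finite list) = Suc n. F js) = (\<Sum>i\<in>UNIV. \<Sum>js | length js = n. F (i # js))"
proof -
  have eq: "{js :: 'n list. length js = Suc n} = (\<lambda>(i, js). i # js) ` (UNIV \<times> {js. length js = n})"
    by (auto simp: length_Suc_conv image_iff)
  have inj: "inj_on (\<lambda>(i, js :: 'n list). i # js) (UNIV \<times> {js. length js = n})"
    by (auto simp: inj_on_def)
  show ?thesis
    unfolding eq by (subst sum.reindex[OF inj]) (simp add: sum.cartesian_product case_prod_unfold)
qed

text \<open>The n-th derivative of f at x along v, as an n-linear form on the diagonal. Summing over
  all lists of length n instead of multi-indices makes the multinomial coefficients
  disappear.\<close>

definition dirderiv :: "nat \<Rightarrow> (real^'n::finite \<Rightarrow> complex) \<Rightarrow> real^'n \<Rightarrow> real^'n \<Rightarrow> complex" where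
  "dirderiv n f x v = (\<Sum>js | length js = n. of_real (monomial js v) * pdl js f x)"

lemma dirderiv_0 [simp]: "dirderiv 0 f x v = f x"
  by (simp add: dirderiv_def)

lemma dirderiv_Suc: "smooth_fun f \<Longrightarrow> dirderiv (Suc n) f x v = (\<Sum>i\<in>UNIV. of_real (v $ i) * dirderiv n (pd i f) x v)"
  by (simp add: dirderiv_def sum_length_Suc sum_distrib_left mult.assoc pdl_pd_commute)

lemma dirderiv_zero_right: "n > 0 \<Longrightarrow> dirderiv n f x 0 = 0"
  by (cases n) (simp_all add: dirderiv_def sum_length_Suc)

lemma dirderiv_bound:
  fixes f :: "real^'n::finite \<Rightarrow> complex"
  assumes "\<And>js. length js = n \<Longrightarrow> cmod (pdl js f x) \<le> B"
  shows "cmod (dirderiv n f x v) \<le> real CARD('n) ^ n * norm v ^ n * B"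
proof -
  have "cmod (dirderiv n f x v) \<le> (\<Sum>js | length (js :: 'n list) = n. norm v ^ n * B)"
    unfolding dirderiv_def
  proof (rule order_trans[OF norm_sum sum_mono])
    fix js :: "'n list" assume js: "js \<in> {js. length js = n}"
    show "cmod (of_real (monomial js v) * pdl js f x) \<le> norm v ^ n * B"
      using monomial_le[of js v] assms[of js] js
      by (auto simp: norm_mult intro!: mult_mono)
  qed
  then show ?thesis by (simp add: card_length_eq mult.assoc)
qed

text \<open>Continuous partial derivatives give a total derivative. Taylor expansion needs
  derivatives along arbitrary vectors, whereas \<open>smooth_fun\<close> speaks of the coordinate
  directions.\<close>

lemma smooth_has_derivative:
  fixes f :: "real^'n::finite \<Rightarrow> complex"
  assumes f: "smooth_fun f"
  shows "(f has_derivative (\<lambda>v. \<Sum>i\<in>UNIV. v $ i *\<^sub>R pd i f x)) (at x)"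
  unfolding has_derivative_at_alt
proof (intro conjI allI impI)
  show "bounded_linear (\<lambda>v. \<Sum>i\<in>UNIV. v $ i *\<^sub>R pd i f x)"
    by (intro bounded_linear_sum bounded_linear_compose[OF bounded_linear_scaleR_left] bounded_linear_vec_nth)
  fix e :: real assume e: "e > 0"
  define \<epsilon> where "\<epsilon> = e / CARD('n)"
  have \<epsilon>: "\<epsilon> > 0" using e by (simp add: \<epsilon>_def)
  have "\<forall>i. \<exists>d>0. \<forall>y. dist y x < d \<longrightarrow> dist (pd i f y) (pd i f x) < \<epsilon>"
  proof
    fix i
    have "isCont (pd i f) x"
      using pdl_continuous[OF f, of UNIV "[i]"] by (simp add: continuous_on_eq_continuous_at)
    then show "\<exists>d>0. \<forall>y. dist y x < d \<longrightarrow> dist (pd i f y) (pd i f x) < \<epsilon>"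
      unfolding continuous_at_eps_delta using \<epsilon> by blast
  qed
  then obtain d where d: "\<And>i. d i > 0" "\<And>i y. dist y x < d i \<Longrightarrow> dist (pd i f y) (pd i f x) < \<epsilon>"
    by metis
  define D where "D = Min (range d)"
  have D: "D > 0" "\<And>i y. dist y x < D \<Longrightarrow> dist (pd i f y) (pd i f x) < \<epsilon>"
    using d unfolding D_def by auto
  have "norm (f y - f x - (\<Sum>i\<in>UNIV. (y - x) $ i *\<^sub>R pd i f x)) \<le> e * norm (y - x)" if y: "norm (y - x) < D" for y
  proof -
    define v where "v = y - x"
    \<comment> \<open>\<open>w S\<close> keeps the coordinates of v in S. Inserting one coordinate
      at a time joins x to y by axis-parallel segments that stay within distance
      \<open>norm v\<close> of x.\<close>
    define w where "w S = (\<Sum>i\<in>S. v $ i *\<^sub>R axis i (1::real))" for S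
    have w_nth: "w S $ i = (if i \<in> S then v $ i else 0)" for S i
    proof -
      have "w S $ i = (\<Sum>j\<in>S. if j = i then v $ j else 0)"
        unfolding w_def sum_component by (rule sum.cong) (auto simp: axis_def)
      then show ?thesis by simp
    qed
    have "norm (f (x + w S) - f x - (\<Sum>i\<in>S. v $ i *\<^sub>R pd i f x)) \<le> card S * (\<epsilon> * norm v)" for S :: "'n set"
    proof (induction S rule: finite_induct[OF finite])
      case 1
      then show ?case by (simp add: w_def)
    next
      case (2 i S)
      have close: "dist (x + w S + s *\<^sub>R axis i 1) x < D" if s: "\<bar>s\<bar> \<le> \<bar>v $ i\<bar>" for s
      proof -
        have "norm (w S + s *\<^sub>R axis i 1) \<le> norm v"
          using s 2 by (intro norm_le_componentwise_cart) (auto simp: w_nth axis_def)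
        then show ?thesis
          using y by (simp add: dist_norm v_def add.assoc)
      qed
      have "norm ((\<lambda>s. f (x + w S + s *\<^sub>R axis i 1) - s *\<^sub>R pd i f x) (v $ i) - (\<lambda>s. f (x + w S + s *\<^sub>R axis i 1) - s *\<^sub>R pd i f x) 0)
           \<le> \<epsilon> * \<bar>v $ i\<bar>"
      proof (rule real_MVT_bound[where F' = "\<lambda>s. pd i f (x + w S + s *\<^sub>R axis i 1) - pd i f x"])
        fix s assume s: "\<bar>s\<bar> \<le> \<bar>v $ i\<bar>"
        show "((\<lambda>s. f (x + w S + s *\<^sub>R axis i 1) - s *\<^sub>R pd i f x) has_vector_derivative
            pd i f (x + w S + s *\<^sub>R axis i 1) - pd i f x) (at s)"
          by (intro has_vector_derivative_diff pd_step_at f) (auto intro!: derivative_eq_intros)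
        show "cmod (pd i f (x + w S + s *\<^sub>R axis i 1) - pd i f x) \<le> \<epsilon>"
          using D(2)[OF close[OF s], of i] by (simp add: dist_norm)
      qed
      also have "\<dots> \<le> \<epsilon> * norm v"
        using \<epsilon> component_le_norm_cart[of v i] by (intro mult_left_mono) auto
      finally have 1: "norm (f (x + w (insert i S)) - v $ i *\<^sub>R pd i f x - f (x + w S)) \<le> \<epsilon> * norm v"
        using 2 by (simp add: w_def add_ac)
      have "f (x + w (insert i S)) - f x - (\<Sum>i\<in>insert i S. v $ i *\<^sub>R pd i f x)
          = (f (x + w (insert i S)) - v $ i *\<^sub>R pd i f x - f (x + w S)) + (f (x + w S) - f x - (\<Sum>i\<in>S. v $ i *\<^sub>R pd i f x))"
        using 2 by simp
      then have "norm (f (x + w (insert i S)) - f x - (\<Sum>i\<in>insert i S. v $ i *\<^sub>R pd i f x)) \<le> \<epsilon> * norm v + card S * (\<epsilon> * norm v)"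
        using norm_triangle_mono[OF 1 2(3)] by (simp only:)
      then show ?case using 2 by (simp add: algebra_simps)
    qed
    from this[of UNIV] have "norm (f (x + w UNIV) - f x - (\<Sum>i\<in>UNIV. v $ i *\<^sub>R pd i f x)) \<le> e * norm v"
      by (simp add: \<epsilon>_def)
    moreover have "w UNIV = v" by (simp add: vec_eq_iff w_nth)
    ultimately show ?thesis by (simp add: v_def)
  qed
  then show "\<exists>d>0. \<forall>y. norm (y - x) < d \<longrightarrow> norm (f y - f x - (\<Sum>i\<in>UNIV. (y - x) $ i *\<^sub>R pd i f x)) \<le> e * norm (y - x)"
    using D(1) by blast
qed

lemma smooth_line_derivative:
  fixes f :: "real^'n::finite \<Rightarrow> complex"
  assumes f: "smooth_fun f"
  shows "((\<lambda>\<tau>. f (x + \<tau> *\<^sub>R v)) has_vector_derivative (\<Sum>i\<in>UNIV. of_real (v $ i) * pd i f (x + s *\<^sub>R v))) (at s within S)"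
proof -
  have 1: "((\<lambda>\<tau>. x + \<tau> *\<^sub>R v) has_derivative (\<lambda>t. t *\<^sub>R v)) (at s)"
    by (auto intro!: derivative_eq_intros)
  have "((\<lambda>\<tau>. f (x + \<tau> *\<^sub>R v)) has_derivative (\<lambda>t. \<Sum>i\<in>UNIV. (t *\<^sub>R v) $ i *\<^sub>R pd i f (x + s *\<^sub>R v))) (at s)"
    by (rule has_derivative_compose[OF 1 smooth_has_derivative[OF f]])
  moreover have "(\<lambda>t. \<Sum>i\<in>UNIV. (t *\<^sub>R v) $ i *\<^sub>R pd i f (x + s *\<^sub>R v))
     = (\<lambda>t. t *\<^sub>R (\<Sum>i\<in>UNIV. of_real (v $ i) * pd i f (x + s *\<^sub>R v)))"
    by (simp add: scaleR_sum_right scaleR_conv_of_real[symmetric])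
  ultimately have "((\<lambda>\<tau>. f (x + \<tau> *\<^sub>R v)) has_vector_derivative (\<Sum>i\<in>UNIV. of_real (v $ i) * pd i f (x + s *\<^sub>R v))) (at s)"
    by (simp add: has_vector_derivative_def)
  then show ?thesis by (rule has_vector_derivative_at_within)
qed

lemma dirderiv_line_derivative:
  assumes f: "smooth_fun f"
  shows "((\<lambda>\<tau>. dirderiv n f (x + \<tau> *\<^sub>R v) v) has_vector_derivative dirderiv (Suc n) f (x + s *\<^sub>R v) v) (at s within S)"
proof -
  have "((\<lambda>\<tau>. dirderiv n f (x + \<tau> *\<^sub>R v) v) has_vector_derivative
     (\<Sum>js | length js = n. of_real (monomial js v) * (\<Sum>i\<in>UNIV. of_real (v $ i) * pd i (pdl js f) (x + s *\<^sub>R v)))) (at s within S)"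
    unfolding dirderiv_def
    by (intro has_vector_derivative_sum has_vector_derivative_mult_right smooth_line_derivative smooth_pdl f)
  also have "(\<Sum>js | length js = n. of_real (monomial js v) * (\<Sum>i\<in>UNIV. of_real (v $ i) * pd i (pdl js f) (x + s *\<^sub>R v)))
      = dirderiv (Suc n) f (x + s *\<^sub>R v) v"
    unfolding dirderiv_def sum_length_Suc by (subst sum.swap) (simp add: sum_distrib_left mult_ac)
  finally show ?thesis .
qed

section \<open>Taylor polynomials and their remainder\<close>

definition taylor_poly :: "nat \<Rightarrow> (real^'n::finite \<Rightarrow> complex) \<Rightarrow> real^'n \<Rightarrow> real^'n \<Rightarrow> complex" where
  "taylor_poly n f x y = (\<Sum>j\<le>n. dirderiv j f x (y - x) / fact j)"

lemma taylor_poly_self: "taylor_poly n f x x = f x"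
  unfolding taylor_poly_def by (subst sum.atMost_shift) (simp add: dirderiv_zero_right)

text \<open>The integral form of the remainder, with (1 - \<tau>)^n bounded by 1. Having 1/n! in
  place of 1/(n+1)! loses a factor n + 1, which later disappears in a geometric factor.\<close>

lemma taylor_poly_remainder_bound:
  fixes f :: "real^'n::finite \<Rightarrow> complex"
  assumes f: "smooth_fun f"
    and B: "\<And>\<tau>. 0 \<le> \<tau> \<Longrightarrow> \<tau> \<le> 1 \<Longrightarrow> cmod (dirderiv (Suc n) f (x + \<tau> *\<^sub>R (y - x)) (y - x)) \<le> B"
  shows "cmod (f y - taylor_poly n f x y) \<le> B / fact n"
proof -
  define v where "v = y - x"
  define I where "I = (\<lambda>\<tau>. ((1 - \<tau>) ^ n / fact n) *\<^sub>R dirderiv (Suc n) f (x + \<tau> *\<^sub>R v) v)"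
  have "((\<lambda>\<tau>. ((1 - \<tau>) ^ (Suc n - 1) / fact (Suc n - 1)) *\<^sub>R dirderiv (Suc n) f (x + \<tau> *\<^sub>R v) v) has_integral
     f (x + 1 *\<^sub>R v) - (\<Sum>i<Suc n. ((1 - 0) ^ i / fact i) *\<^sub>R dirderiv i f (x + 0 *\<^sub>R v) v)) {0..1}"
    by (rule Taylor_has_integral[where f = "\<lambda>\<tau>. f (x + \<tau> *\<^sub>R v)" and Df = "\<lambda>i \<tau>. dirderiv i f (x + \<tau> *\<^sub>R v) v"])
       (auto intro!: dirderiv_line_derivative f)
  then have int: "(I has_integral (f y - taylor_poly n f x y)) {0..1}"
    by (simp add: I_def v_def taylor_poly_def lessThan_Suc_atMost scaleR_conv_of_real divide_inverse mult.commute)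
  have "norm (f y - taylor_poly n f x y) \<le> (B / fact n) * measure lborel {0..1::real}"
  proof (rule has_integral_bound_real[where S = "{}", OF _ finite.emptyI int])
    have "B \<ge> 0" using B[of 0] norm_ge_zero by (metis order_trans order_refl zero_le_one)
    then show "0 \<le> B / fact n" by simp
    fix \<tau> :: real assume \<tau>: "\<tau> \<in> {0..1} - {}"
    have "norm (I \<tau>) = (1 - \<tau>) ^ n / fact n * cmod (dirderiv (Suc n) f (x + \<tau> *\<^sub>R v) v)"
      using \<tau> by (simp add: I_def)
    also have "\<dots> \<le> 1 / fact n * B"
      using \<tau> B[of \<tau>] by (intro mult_mono divide_right_mono power_le_one) (auto simp: v_def)
    finally show "norm (I \<tau>) \<le> B / fact n" by simp
  qed
  then show ?thesis by simp
qed

text \<open>Differentiation in the direction argument, not in the base point: each of the j slots of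
  the form contributes the same term, because partial derivatives commute.\<close>

lemma dirderiv_derivative_direction:
  fixes f :: "real^'n::finite \<Rightarrow> complex"
  assumes "smooth_fun f"
  shows "((\<lambda>t. dirderiv j f x (v + t *\<^sub>R axis l 1)) has_vector_derivative of_nat j * dirderiv (j - 1) (pd l f) x v) (at 0)"
  using assms
proof (induction j arbitrary: f)
  case (Suc j)
  have d: "((\<lambda>t. of_real ((v + t *\<^sub>R axis l 1) $ i)) has_vector_derivative (if i = l then 1 else 0 :: complex)) (at 0)" for i
  proof -
    have "((\<lambda>t. of_real (v $ i) + t *\<^sub>R (if i = l then 1 else 0 :: complex)) has_vector_derivative (if i = l then 1 else 0 :: complex)) (at 0)"
      by (auto intro!: derivative_eq_intros)
    moreover have "of_real ((v + t *\<^sub>R axis l 1) $ i) = of_real (v $ i) + t *\<^sub>R (if i = l then 1 else 0 :: complex)" for t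
      by (simp add: axis_def scaleR_conv_of_real[where 'a = complex])
    ultimately show ?thesis by simp
  qed
  have "((\<lambda>t. \<Sum>i\<in>UNIV. of_real ((v + t *\<^sub>R axis l 1) $ i) * dirderiv j (pd i f) x (v + t *\<^sub>R axis l 1)) has_vector_derivative
     (\<Sum>i\<in>UNIV. of_real ((v + 0 *\<^sub>R axis l 1) $ i) * (of_nat j * dirderiv (j - 1) (pd l (pd i f)) x v)
        + (if i = l then 1 else 0) * dirderiv j (pd i f) x (v + 0 *\<^sub>R axis l 1))) (at 0)"
    by (intro has_vector_derivative_sum has_vector_derivative_mult d Suc.IH smooth_pd Suc.prems)
  also have "(\<Sum>i\<in>UNIV. of_real ((v + 0 *\<^sub>R axis l 1) $ i) * (of_nat j * dirderiv (j - 1) (pd l (pd i f)) x v)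
        + (if i = l then 1 else 0) * dirderiv j (pd i f) x (v + 0 *\<^sub>R axis l 1))
     = of_nat j * (\<Sum>i\<in>UNIV. of_real (v $ i) * dirderiv (j - 1) (pd i (pd l f)) x v) + dirderiv j (pd l f) x v"
  proof -
    have "pd l (pd i f) = pd i (pd l f)" for i
      using pd_commute[OF Suc.prems] by blast
    moreover have "(\<Sum>i\<in>UNIV. (if i = l then 1 else 0) * dirderiv j (pd i f) x v) = (\<Sum>i\<in>UNIV. if i = l then dirderiv j (pd i f) x v else 0)"
      by (rule sum.cong) auto
    ultimately show ?thesis
      by (simp add: sum.distrib sum_distrib_left mult_ac)
  qed
  also have "\<dots> = of_nat (Suc j) * dirderiv (Suc j - 1) (pd l f) x v"
    using dirderiv_Suc[OF smooth_pd[OF Suc.prems], of "j - 1" l x v] by (cases j) (simp_all add: algebra_simps)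
  finally show ?case
    using dirderiv_Suc[OF Suc.prems] by simp
qed simp

lemma continuous_on_dirderiv [continuous_intros]:
  "continuous_on S g \<Longrightarrow> continuous_on S (\<lambda>y. dirderiv n f x (g y))"
  unfolding dirderiv_def by (intro continuous_intros)

lemma continuous_on_taylor_poly [continuous_intros]: "continuous_on S (taylor_poly n f x)"
  unfolding taylor_poly_def by (intro continuous_intros) auto

text \<open>The base point x stays fixed while y moves: the degree drops by one and f is replaced by
  its partial derivative. Iterating this shows that the Taylor polynomial of degree n shares with f
  all derivatives at x up to order n.\<close>

lemma taylor_poly_derivative:
  assumes f: "smooth_fun f"
  shows "((\<lambda>t. taylor_poly (Suc n) f x (y + t *\<^sub>R axis l 1)) has_vector_derivative taylor_poly n (pd l f) x y) (at 0)"
proof -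
  have *: "((\<lambda>t. dirderiv j f x (y + t *\<^sub>R axis l 1 - x) / fact j) has_vector_derivative
     (of_nat j * dirderiv (j - 1) (pd l f) x (y - x)) / fact j) (at 0)" for j
    using has_vector_derivative_mult_right[OF dirderiv_derivative_direction[OF f, of j x "y - x" l], of "1 / fact j"]
    by (simp add: algebra_simps)
  have "((\<lambda>t. taylor_poly (Suc n) f x (y + t *\<^sub>R axis l 1)) has_vector_derivative
     (\<Sum>j\<le>Suc n. (of_nat j * dirderiv (j - 1) (pd l f) x (y - x)) / fact j)) (at 0)"
    unfolding taylor_poly_def by (intro has_vector_derivative_sum *)
  also have "(\<Sum>j\<le>Suc n. (of_nat j * dirderiv (j - 1) (pd l f) x (y - x)) / fact j) = taylor_poly n (pd l f) x y"
    unfolding taylor_poly_def by (subst sum.atMost_Suc_shift) (simp add: divide_simps del: of_nat_Suc)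
  finally show ?thesis .
qed

lemma taylor_poly_smooth:
  assumes f: "smooth_fun f"
  shows "smooth_fun (taylor_poly n f x)"
    and "length is \<le> n \<Longrightarrow> pdl is (taylor_poly n f x) y = taylor_poly (n - length is) (pdl is f) x y"
proof -
  \<comment> \<open>At length n the polynomial has degree 0 and is constant in y, so the family
    continues with 0.\<close>
  let ?G = "\<lambda>is. if length is \<le> n then taylor_poly (n - length is) (pdl is f) x else (\<lambda>_. 0)"
  have 2: "continuous_on UNIV (?G is)" for "is"
    by (auto intro: continuous_intros)
  have 3: "((\<lambda>t. ?G is (z + t *\<^sub>R axis i 1)) has_vector_derivative ?G (i # is) z) (at 0)" for "is" i z
  proof -
    consider "length is < n" | "length is = n" | "length is > n" by linarith
    then show ?thesis
    proof cases
      case 1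
      then have "n - length is = Suc (n - length (i # is))" by simp
      then show ?thesis
        using 1 taylor_poly_derivative[OF smooth_pdl[OF f], of "n - length (i # is)"] by simp
    qed (simp_all add: taylor_poly_def)
  qed
  show "smooth_fun (taylor_poly n f x)"
    by (rule smooth_funI(1)[where G = ?G]) (use 2 3 in simp_all)
  show "pdl is (taylor_poly n f x) y = taylor_poly (n - length is) (pdl is f) x y" if "length is \<le> n"
  proof -
    have "pdl is (taylor_poly n f x) = ?G is"
      by (rule smooth_funI(2)[where G = ?G]) (use 2 3 in simp_all)
    then show ?thesis using that by simp
  qed
qed

lemma pdl_taylor_poly_self:
  "smooth_fun f \<Longrightarrow> length is \<le> n \<Longrightarrow> pdl is (taylor_poly n f x) x = pdl is f x"
  by (simp add: taylor_poly_smooth(2) taylor_poly_self)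

section \<open>Isotropic form of the Gelfand-Shilov bounds\<close>

text \<open>The isotropic substitute for the multi-index factorials: \<open>a\<close> is a power of
  the Euclidean norm, \<open>l\<close> an order of differentiation, and \<open>A\<close> plays the
  role of 1/h.\<close>

definition gs_weight :: "real \<Rightarrow> real \<Rightarrow> real \<Rightarrow> nat \<Rightarrow> nat \<Rightarrow> real" where
  "gs_weight r1 r2 A a l = A ^ (a + l) * fact a powr r2 * fact l powr r1"

definition gs_decay :: "real \<Rightarrow> real \<Rightarrow> real \<Rightarrow> real \<Rightarrow> (real^'n::finite \<Rightarrow> complex) \<Rightarrow> bool" where
  "gs_decay r1 r2 A C f \<longleftrightarrow> (\<forall>is a x. norm x ^ a * cmod (pdl is f x) \<le> C * gs_weight r1 r2 A a (length is))"

lemma gs_decayD: "gs_decay r1 r2 A C f \<Longrightarrow> norm x ^ a * cmod (pdl is f x) \<le> C * gs_weight r1 r2 A a (length is)"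
  unfolding gs_decay_def by blast

lemma gs_weight_pos: "A > 0 \<Longrightarrow> gs_weight r1 r2 A a l > 0"
  by (simp add: gs_weight_def)

lemma gs_weight_0 [simp]: "gs_weight r1 r2 A 0 0 = 1"
  by (simp add: gs_weight_def)

lemma gs_decay_nonneg: "gs_decay r1 r2 A C f \<Longrightarrow> C \<ge> 0"
  using gs_decayD[of r1 r2 A C f 0 0 "[]"] by (simp add: order_trans[OF norm_ge_zero])

lemma powr_le_mono_exp_fact: "a \<le> b \<Longrightarrow> (fact n :: real) powr a \<le> fact n powr b"
  by (intro powr_mono) (auto simp: fact_ge_1)

lemma gs_weight_mono:
  assumes "0 \<le> A" "A \<le> A'" "r1 \<le> r1'" "r2 \<le> r2'"
  shows "gs_weight r1 r2 A a l \<le> gs_weight r1' r2' A' a l"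
  unfolding gs_weight_def using assms by (intro mult_mono power_mono powr_le_mono_exp_fact) auto

lemma gs_decay_mono:
  assumes "gs_decay r1 r2 A C f" "0 \<le> A" "A \<le> A'" "C \<le> C'" "r1 \<le> r1'" "r2 \<le> r2'"
  shows "gs_decay r1' r2' A' C' f"
  unfolding gs_decay_def
proof (intro allI)
  fix "is" a x
  have "norm x ^ a * cmod (pdl is f x) \<le> C * gs_weight r1 r2 A a (length is)"
    by (rule gs_decayD[OF assms(1)])
  also have "\<dots> \<le> C' * gs_weight r1' r2' A' a (length is)"
    using assms gs_decay_nonneg[OF assms(1)] by (intro mult_mono gs_weight_mono) (auto simp: gs_weight_def)
  finally show "norm x ^ a * cmod (pdl is f x) \<le> C' * gs_weight r1' r2' A' a (length is)" .
qed

lemma power_powr_swap: "x > 0 \<Longrightarrow> ((x::real) ^ n) powr r = (x powr r) ^ n"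
  by (induction n) (auto simp: powr_mult)

lemma fact_add_le: "(fact (a + b) :: real) \<le> 2 ^ (a + b) * (fact a * fact b)"
proof -
  have "(fact (a + b) :: real) = real (a + b choose a) * (fact a * fact b)"
    by (simp add: binomial_fact)
  also have "\<dots> \<le> 2 ^ (a + b) * (fact a * fact b)"
  proof (rule mult_right_mono)
    show "real (a + b choose a) \<le> 2 ^ (a + b)"
      using binomial_le_pow2[of "a + b" a] by (metis of_nat_le_iff of_nat_numeral of_nat_power)
  qed simp
  finally show ?thesis .
qed

lemma fact_mult_le_fact_add: "(fact a * fact b :: real) \<le> fact (a + b)"
proof -
  have "fact a * fact b \<le> (fact (a + b) :: nat)"
    by (intro dvd_imp_le fact_fact_dvd_fact) simp
  then show ?thesis
    by (metis of_nat_fact of_nat_le_iff of_nat_mult)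
qed

lemma mfact_le_fact_mabs: "mfact \<alpha> \<le> fact (mabs \<alpha>)"
proof -
  have "(\<Prod>i\<in>S. fact (\<alpha> i)) \<le> (fact (\<Sum>i\<in>S. \<alpha> i) :: real)" if "finite S" for S
    using that
  proof induction
    case (insert i S)
    then have "(\<Prod>i\<in>insert i S. fact (\<alpha> i)) \<le> fact (\<alpha> i) * (fact (\<Sum>i\<in>S. \<alpha> i) :: real)"
      by (simp add: mult_left_mono)
    also have "\<dots> \<le> fact (\<Sum>i\<in>insert i S. \<alpha> i)"
      using insert fact_mult_le_fact_add by simp
    finally show ?case .
  qed simp
  then show ?thesis by (simp add: mfact_def mabs_def)
qed

text \<open>Together with \<open>mfact_le_fact_mabs\<close> this says that \<alpha>! and |\<alpha>|!
  agree up to a geometric factor, so the isotropic bounds describe the same space. Each inserted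
  coordinate costs one binomial coefficient, hence a power of 2.\<close>

lemma fact_mabs_le: "fact (mabs (\<alpha> :: 'n::finite \<Rightarrow> nat)) \<le> (2 ^ CARD('n)) ^ mabs \<alpha> * mfact \<alpha>"
proof -
  have "(fact (\<Sum>i\<in>S. \<alpha> i) :: real) \<le> (2 ^ card S) ^ (\<Sum>i\<in>S. \<alpha> i) * (\<Prod>i\<in>S. fact (\<alpha> i))" if "finite S" for S
    using that
  proof induction
    case (insert i S)
    let ?s = "\<Sum>i\<in>S. \<alpha> i"
    have "(fact (\<alpha> i + ?s) :: real) \<le> 2 ^ (\<alpha> i + ?s) * (fact (\<alpha> i) * fact ?s)"
      by (rule fact_add_le)
    also have "\<dots> \<le> 2 ^ (\<alpha> i + ?s) * (fact (\<alpha> i) * ((2 ^ card S) ^ (\<alpha> i + ?s) * (\<Prod>i\<in>S. fact (\<alpha> i))))"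
    proof -
      have "(fact ?s :: real) \<le> (2 ^ card S) ^ (\<alpha> i + ?s) * (\<Prod>i\<in>S. fact (\<alpha> i))"
        by (rule order_trans[OF insert.IH]) (intro mult_right_mono power_increasing prod_nonneg, auto)
      then show ?thesis by (intro mult_left_mono) auto
    qed
    also have "\<dots> = (2 ^ card (insert i S)) ^ (\<Sum>i\<in>insert i S. \<alpha> i) * (\<Prod>i\<in>insert i S. fact (\<alpha> i))"
      using insert.hyps by (simp add: power_mult_distrib)
    finally show ?case using insert.hyps by simp
  qed simp
  from this[of UNIV] show ?thesis by (simp add: mfact_def mabs_def)
qed

lemma mfact_ge_1: "mfact \<alpha> \<ge> 1"
  unfolding mfact_def by (intro prod_ge_1) (auto simp: fact_ge_1)

lemma mpow_le: "\<bar>mpow x \<alpha>\<bar> \<le> norm x ^ mabs \<alpha>"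
  unfolding mpow_def mabs_def abs_prod power_sum
  by (intro prod_mono) (auto simp: power_abs intro!: power_mono component_le_norm_cart)

text \<open>The h that corresponds to the rate \<open>A\<close>; the factors 2^d raised to r1 and r2
  are the price of passing from |\<alpha>|! to \<alpha>!.\<close>

definition step_scale :: "real \<Rightarrow> real \<Rightarrow> real \<Rightarrow> nat \<Rightarrow> real" where
  "step_scale r1 r2 A d = 1 / (A * (2 ^ d) powr r1 * (2 ^ d) powr r2)"

lemma gs_decay_imp_gs_bound:
  fixes f :: "real^'n::finite \<Rightarrow> complex"
  assumes f: "smooth_fun f" and gs_decay: "gs_decay r1 r2 A C f" and A: "A > 0" and r: "r1 \<ge> 0" "r2 \<ge> 0"
  shows "gs_bound r1 r2 (step_scale r1 r2 A CARD('n)) f C"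
  unfolding gs_bound_def
proof (intro allI)
  fix x and \<alpha> \<beta> :: "'n \<Rightarrow> nat"
  obtain js where js: "count_list js = \<beta>" using ex_count_list by blast
  have len: "length js = mabs \<beta>" using js mabs_count_list by metis
  define D :: real where "D = 2 ^ CARD('n)"
  have D: "D \<ge> 1" by (simp add: D_def)
  have C: "C \<ge> 0" by (rule gs_decay_nonneg[OF gs_decay])
  define h where "h = step_scale r1 r2 A CARD('n)"
  have h: "h > 0" using A by (simp add: h_def step_scale_def)
  have p: "fact (mabs \<gamma>) powr r \<le> (D powr r) ^ mabs \<gamma> * mfact \<gamma> powr r" if "r \<ge> 0" for \<gamma> :: "'n \<Rightarrow> nat" and r
  proof -
    have "fact (mabs \<gamma>) powr r \<le> (D ^ mabs \<gamma> * mfact \<gamma>) powr r"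
      using fact_mabs_le[of \<gamma>] that by (intro powr_mono2) (auto simp: D_def)
    also have "\<dots> = (D powr r) ^ mabs \<gamma> * mfact \<gamma> powr r"
      using D mfact_ge_1[of \<gamma>] by (simp add: powr_mult power_powr_swap)
    finally show ?thesis .
  qed
  have "\<bar>mpow x \<alpha>\<bar> * cmod (dmulti \<beta> f x) \<le> norm x ^ mabs \<alpha> * cmod (pdl js f x)"
    using dmulti_count_list[OF f, of js] js by (intro mult_mono mpow_le) auto
  also have "\<dots> \<le> C * gs_weight r1 r2 A (mabs \<alpha>) (mabs \<beta>)"
    using gs_decayD[OF gs_decay] len by metis
  also have "\<dots> \<le> C * (A ^ (mabs \<alpha> + mabs \<beta>) * ((D powr r2) ^ mabs \<alpha> * mfact \<alpha> powr r2) * ((D powr r1) ^ mabs \<beta> * mfact \<beta> powr r1))"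
    unfolding gs_weight_def using p r A C by (intro mult_left_mono mult_mono) auto
  also have "\<dots> \<le> C * (A ^ (mabs \<alpha> + mabs \<beta>) * ((D powr r2) ^ (mabs \<alpha> + mabs \<beta>) * mfact \<alpha> powr r2) * ((D powr r1) ^ (mabs \<alpha> + mabs \<beta>) * mfact \<beta> powr r1))"
    using D r A C by (intro mult_left_mono mult_mono mult_right_mono power_increasing ge_one_powr_ge_zero) auto
  also have "\<dots> = C * (A * D powr r1 * D powr r2) ^ (mabs \<alpha> + mabs \<beta>) * (mfact \<alpha> powr r2 * mfact \<beta> powr r1)"
    by (simp add: power_mult_distrib mult_ac)
  finally have main: "\<bar>mpow x \<alpha>\<bar> * cmod (dmulti \<beta> f x) \<le> C * (A * D powr r1 * D powr r2) ^ (mabs \<alpha> + mabs \<beta>) * (mfact \<alpha> powr r2 * mfact \<beta> powr r1)" .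
  have hh: "A * D powr r1 * D powr r2 = 1 / h"
    by (simp add: h_def step_scale_def D_def)
  have mm: "mfact \<alpha> powr r2 * mfact \<beta> powr r1 > 0"
    using mfact_ge_1[of \<alpha>] mfact_ge_1[of \<beta>] by auto
  have "h ^ (mabs \<alpha> + mabs \<beta>) / (mfact \<alpha> powr r2 * mfact \<beta> powr r1) * (\<bar>mpow x \<alpha>\<bar> * cmod (dmulti \<beta> f x))
     \<le> h ^ (mabs \<alpha> + mabs \<beta>) / (mfact \<alpha> powr r2 * mfact \<beta> powr r1) * (C * (1 / h) ^ (mabs \<alpha> + mabs \<beta>) * (mfact \<alpha> powr r2 * mfact \<beta> powr r1))"
    using main h mm unfolding hh by (intro mult_left_mono) auto
  also have "\<dots> = C"
    using h mfact_ge_1[of \<alpha>] mfact_ge_1[of \<beta>] by (auto simp add: power_divide)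
  finally show "step_scale r1 r2 A CARD('n) ^ (mabs \<alpha> + mabs \<beta>) / (mfact \<alpha> powr r2 * mfact \<beta> powr r1) * (\<bar>mpow x \<alpha>\<bar> * cmod (dmulti \<beta> f x)) \<le> C"
    unfolding h_def .
qed

lemma step_scale_pos: "A > 0 \<Longrightarrow> step_scale r1 r2 A d > 0"
  by (simp add: step_scale_def)

lemma norm_le_card_component:
  fixes x :: "real^'n::finite"
  obtains i where "norm x \<le> real CARD('n) * \<bar>x $ i\<bar>"
proof -
  obtain i where i: "\<And>j. \<bar>x $ j\<bar> \<le> \<bar>x $ i\<bar>"
  proof -
    have "Max (range (\<lambda>j. \<bar>x $ j\<bar>)) \<in> range (\<lambda>j. \<bar>x $ j\<bar>)" by (intro Max_in) auto
    then obtain i where i: "Max (range (\<lambda>j. \<bar>x $ j\<bar>)) = \<bar>x $ i\<bar>" by (rule imageE)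
    show ?thesis using that[of i] unfolding i[symmetric] by simp
  qed
  have "norm x \<le> (\<Sum>j\<in>UNIV. \<bar>x $ j\<bar>)" by (rule norm_le_l1_cart)
  also have "\<dots> \<le> (\<Sum>j\<in>(UNIV::'n set). \<bar>x $ i\<bar>)" by (intro sum_mono i)
  finally show ?thesis using that by simp
qed

text \<open>The largest coordinate of x carries the norm up to the factor d, so a multi-index
  \<alpha> concentrated at that coordinate suffices, and for it \<alpha>! = a!. The coordinate
  depends on x, which is harmless because the hypothesis holds for all \<alpha> at once.\<close>

lemma gs_bound_imp_gs_decay:
  fixes f :: "real^'n::finite \<Rightarrow> complex"
  assumes f: "smooth_fun f" and gs: "gs_bound r1 r2 h f C" and h: "h > 0" and r: "r1 \<ge> 0" "r2 \<ge> 0"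
  shows "gs_decay r1 r2 (CARD('n) / h) C f"
  unfolding gs_decay_def
proof (intro allI)
  fix js :: "'n list" and a :: nat and x :: "real^'n"
  obtain i where i: "norm x \<le> real CARD('n) * \<bar>x $ i\<bar>" by (rule norm_le_card_component)
  define \<alpha> where "\<alpha> = (\<lambda>j. if j = i then a else 0)"
  define d where "d = real CARD('n)"
  have d: "d \<ge> 1" by (simp add: d_def Suc_leI)
  have \<alpha>: "mabs \<alpha> = a" "mfact \<alpha> = fact a" "mpow x \<alpha> = (x $ i) ^ a"
  proof -
    show "mabs \<alpha> = a" by (simp add: mabs_def \<alpha>_def)
    have "mfact \<alpha> = (\<Prod>j\<in>UNIV. if j = i then fact a else 1)"
      unfolding mfact_def \<alpha>_def by (rule prod.cong) auto
    then show "mfact \<alpha> = fact a" by simp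
    have "mpow x \<alpha> = (\<Prod>j\<in>UNIV. if j = i then (x $ i) ^ a else 1)"
      unfolding mpow_def \<alpha>_def by (rule prod.cong) auto
    then show "mpow x \<alpha> = (x $ i) ^ a" by simp
  qed
  define l where "l = length js"
  define F where "F = mfact (count_list js)"
  have F: "1 \<le> F" "F \<le> fact l"
    using mfact_ge_1 mfact_le_fact_mabs[of "count_list js"] by (auto simp: F_def l_def mabs_count_list)
  have "h ^ (a + l) / (fact a powr r2 * F powr r1) * (\<bar>x $ i\<bar> ^ a * cmod (pdl js f x)) \<le> C"
    using gs[unfolded gs_bound_def, rule_format, of \<alpha> "count_list js" x] \<alpha>
    by (simp add: dmulti_count_list[OF f] mabs_count_list l_def F_def power_abs)
  moreover have pos: "h ^ (a + l) / (fact a powr r2 * F powr r1) > 0"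
    using h F by simp
  ultimately have 1: "\<bar>x $ i\<bar> ^ a * cmod (pdl js f x) \<le> C / (h ^ (a + l) / (fact a powr r2 * F powr r1))"
    by (simp only: pos_le_divide_eq mult.commute)
  have "0 \<le> \<bar>x $ i\<bar> ^ a * cmod (pdl js f x)" by simp
  then have "0 \<le> C / (h ^ (a + l) / (fact a powr r2 * F powr r1))"
    using 1 by linarith
  then have C: "C \<ge> 0" using pos by (simp only: zero_le_divide_iff) auto
  have "norm x ^ a * cmod (pdl js f x) \<le> (d * \<bar>x $ i\<bar>) ^ a * cmod (pdl js f x)"
    using i by (intro mult_right_mono power_mono) (auto simp: d_def)
  also have "\<dots> = d ^ a * (\<bar>x $ i\<bar> ^ a * cmod (pdl js f x))"
    by (simp add: power_mult_distrib)
  also have "\<dots> \<le> d ^ (a + l) * (C / (h ^ (a + l) / (fact a powr r2 * F powr r1)))"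
    using 1 d by (intro mult_mono power_increasing) auto
  also have "\<dots> = C * ((d / h) ^ (a + l) * fact a powr r2 * F powr r1)"
    by (simp add: power_divide)
  also have "\<dots> \<le> C * ((d / h) ^ (a + l) * fact a powr r2 * fact l powr r1)"
    using C F r h d by (intro mult_left_mono powr_mono2) auto
  finally show "norm x ^ a * cmod (pdl js f x) \<le> C * gs_weight r1 r2 (CARD('n) / h) a (length js)"
    by (simp add: gs_weight_def d_def l_def)
qed

lemma gs_decay_imp_schwartz:
  fixes f :: "real^'n::finite \<Rightarrow> complex"
  assumes f: "smooth_fun f" and gs_decay: "gs_decay r1 r2 A C f"
  shows "schwartz f"
  unfolding schwartz_def
proof (intro conjI f allI)
  fix \<alpha> \<beta> :: "'n \<Rightarrow> nat"
  obtain js where js: "count_list js = \<beta>" using ex_count_list by blast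
  have "\<bar>mpow x \<alpha>\<bar> * cmod (dmulti \<beta> f x) \<le> C * gs_weight r1 r2 A (mabs \<alpha>) (length js)" for x
  proof -
    have "\<bar>mpow x \<alpha>\<bar> * cmod (dmulti \<beta> f x) \<le> norm x ^ mabs \<alpha> * cmod (pdl js f x)"
      using dmulti_count_list[OF f, of js] js by (intro mult_mono mpow_le) auto
    then show ?thesis using gs_decayD[OF gs_decay] order_trans by blast
  qed
  then show "\<exists>C. \<forall>x. \<bar>mpow x \<alpha>\<bar> * cmod (dmulti \<beta> f x) \<le> C" by blast
qed

lemma GS_I:
  fixes f :: "real^'n::finite \<Rightarrow> complex"
  assumes "smooth_fun f" "gs_decay r1 r2 A C f" "A > 0" "r1 \<ge> 0" "r2 \<ge> 0"
  shows "f \<in> GS r1 r2"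
  using gs_decay_imp_gs_bound[OF assms] gs_decay_imp_schwartz[OF assms(1,2)] step_scale_pos[OF assms(3)]
  unfolding GS_def by blast

text \<open>The rate is normalised to be at least 1, so that exponents of it can be increased freely
  in later estimates.\<close>

lemma GS_D:
  fixes f :: "real^'n::finite \<Rightarrow> complex"
  assumes "f \<in> GS r1 r2" "r1 \<ge> 0" "r2 \<ge> 0"
  obtains A C where "smooth_fun f" "A \<ge> 1" "gs_decay r1 r2 A C f"
proof -
  from assms obtain h C where h: "schwartz f" "h > 0" "gs_bound r1 r2 h f C"
    unfolding GS_def by blast
  then have f: "smooth_fun f" by (simp add: schwartz_def)
  have "gs_decay r1 r2 (CARD('n) / h) C f"
    by (rule gs_bound_imp_gs_decay[OF f h(3,2) assms(2,3)])
  then have "gs_decay r1 r2 (max 1 (CARD('n) / h)) C f"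
    by (rule gs_decay_mono) (use h in auto)
  then show ?thesis using that f by (meson max.cobounded1)
qed

lemma GS_mono:
  fixes r1 r2 :: real
  assumes "r1 \<le> r1'" "r2 \<le> r2'" "r1 \<ge> 0" "r2 \<ge> 0"
  shows "GS r1 r2 \<subseteq> GS r1' r2'"
proof
  fix f :: "real^'n::finite \<Rightarrow> complex" assume "f \<in> GS r1 r2"
  then obtain A C where f: "smooth_fun f" "A \<ge> 1" "gs_decay r1 r2 A C f"
    using assms by (elim GS_D) auto
  then show "f \<in> GS r1' r2'"
    using assms gs_decay_mono[OF f(3), of A C r1' r2'] by (intro GS_I[OF f(1), of r1' r2' A C]) auto
qed

lemma gs_decay_lincomb:
  assumes "smooth_fun f" "smooth_fun g" "gs_decay r1 r2 A C f" "gs_decay r1 r2 A D g" "A > 0"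
  shows "gs_decay r1 r2 A (cmod a * C + cmod b * D) (\<lambda>x. a * f x + b * g x)"
  unfolding gs_decay_def
proof (intro allI)
  fix "is" n x
  have "norm x ^ n * cmod (pdl is (\<lambda>x. a * f x + b * g x) x)
      \<le> norm x ^ n * (cmod a * cmod (pdl is f x) + cmod b * cmod (pdl is g x))"
    unfolding smooth_lincomb(2)[OF assms(1,2)]
    by (intro mult_left_mono order_trans[OF norm_triangle_ineq]) (auto simp: norm_mult)
  also have "\<dots> = cmod a * (norm x ^ n * cmod (pdl is f x)) + cmod b * (norm x ^ n * cmod (pdl is g x))"
    by (simp add: algebra_simps)
  also have "\<dots> \<le> cmod a * (C * gs_weight r1 r2 A n (length is)) + cmod b * (D * gs_weight r1 r2 A n (length is))"
    by (intro add_mono mult_left_mono gs_decayD assms) auto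
  finally show "norm x ^ n * cmod (pdl is (\<lambda>x. a * f x + b * g x) x) \<le> (cmod a * C + cmod b * D) * gs_weight r1 r2 A n (length is)"
    by (simp add: algebra_simps)
qed

lemma gs_decay_mult_left:
  assumes "smooth_fun f" "gs_decay r1 r2 A C f" "A > 0"
  shows "gs_decay r1 r2 A (cmod a * C) (\<lambda>x. a * f x)"
  using gs_decay_lincomb[OF assms(1) assms(1) assms(2) assms(2) assms(3), of a 0] by simp

lemma gs_decay_cnj:
  assumes "smooth_fun f" "gs_decay r1 r2 A C f"
  shows "gs_decay r1 r2 A C (\<lambda>x. cnj (f x))"
  using assms(2) unfolding gs_decay_def smooth_cnj(2)[OF assms(1)] by simp

lemma GS_lincomb:
  fixes f g :: "real^'n::finite \<Rightarrow> complex"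
  assumes "f \<in> GS r1 r2" "g \<in> GS r1 r2" "r1 \<ge> 0" "r2 \<ge> 0"
  shows "(\<lambda>x. a * f x + b * g x) \<in> GS r1 r2"
proof -
  obtain A C where f: "smooth_fun f" "A \<ge> 1" "gs_decay r1 r2 A C f"
    using GS_D[OF assms(1,3,4)] .
  obtain B D where g: "smooth_fun g" "B \<ge> 1" "gs_decay r1 r2 B D g"
    using GS_D[OF assms(2,3,4)] .
  have f': "gs_decay r1 r2 (max A B) C f" by (rule gs_decay_mono[OF f(3)]) (use f in auto)
  have g': "gs_decay r1 r2 (max A B) D g" by (rule gs_decay_mono[OF g(3)]) (use g in auto)
  show ?thesis
    by (rule GS_I[OF smooth_lincomb(1)[OF f(1) g(1)] gs_decay_lincomb[OF f(1) g(1) f' g']]) (use f assms in auto)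
qed

section \<open>Absorbing polynomial factors into the decay\<close>

definition decay_const :: "real \<Rightarrow> real \<Rightarrow> nat \<Rightarrow> real" where
  "decay_const r2 A N = 2 ^ N * (1 + (A * 2 powr r2) ^ N * fact N powr r2)"

lemma decay_const_pos: "A > 0 \<Longrightarrow> decay_const r2 A N > 0"
  unfolding decay_const_def by (intro mult_pos_pos add_pos_nonneg) auto

text \<open>Since (a + N)! is at most 2^(a+N) a! N!, raising the power of the norm by N costs a
  constant depending on N, while the rate grows by the factor 2^r2 whatever N is.\<close>

lemma gs_weight_shift:
  assumes "A > 0" "r2 \<ge> 0"
  shows "gs_weight r1 r2 A (a + N) l \<le> ((A * 2 powr r2) ^ N * fact N powr r2) * gs_weight r1 r2 (A * 2 powr r2) a l"
proof -
  have "fact (a + N) powr r2 \<le> (2 ^ (a + N) * (fact a * fact N)) powr r2"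
    using assms by (intro powr_mono2 fact_add_le) auto
  also have "\<dots> = (2 powr r2) ^ (a + N) * fact a powr r2 * fact N powr r2"
    by (simp add: powr_mult power_powr_swap)
  also have "\<dots> \<le> (2 powr r2) ^ (a + N + l) * fact a powr r2 * fact N powr r2"
    using assms by (intro mult_right_mono power_increasing ge_one_powr_ge_zero) auto
  finally have "gs_weight r1 r2 A (a + N) l \<le> A ^ (a + N + l) * ((2 powr r2) ^ (a + N + l) * fact a powr r2 * fact N powr r2) * fact l powr r1"
    unfolding gs_weight_def using assms by (intro mult_right_mono mult_left_mono) auto
  also have "\<dots> = ((A * 2 powr r2) ^ N * fact N powr r2) * gs_weight r1 r2 (A * 2 powr r2) a l"
    by (simp add: gs_weight_def power_add power_mult_distrib mult_ac)
  finally show ?thesis .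
qed

lemma one_plus_power_le: "0 \<le> (x::real) \<Longrightarrow> (1 + x) ^ N \<le> 2 ^ N * (1 + x ^ N)"
proof -
  assume x: "0 \<le> x"
  have "(1 + x) ^ N \<le> (2 * max 1 x) ^ N"
    using x by (intro power_mono) auto
  also have "\<dots> = 2 ^ N * max 1 x ^ N" by (simp add: power_mult_distrib)
  also have "\<dots> \<le> 2 ^ N * (1 + x ^ N)"
    using x by (intro mult_left_mono) (auto simp: max_def)
  finally show ?thesis .
qed

lemma add_power_le: "0 \<le> (x::real) \<Longrightarrow> 0 \<le> y \<Longrightarrow> (x + y) ^ N \<le> 2 ^ N * (x ^ N + y ^ N)"
proof -
  assume x: "0 \<le> x" "0 \<le> y"
  have "(x + y) ^ N \<le> (2 * max x y) ^ N"
    using x by (intro power_mono) auto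
  also have "\<dots> = 2 ^ N * max x y ^ N" by (simp add: power_mult_distrib)
  also have "\<dots> \<le> 2 ^ N * (x ^ N + y ^ N)"
    using x by (intro mult_left_mono) (auto simp: max_def)
  finally show ?thesis .
qed

lemma gs_decay_times_power:
  assumes gs_decay: "gs_decay r1 r2 A C f" and A: "A > 0" and r2: "r2 \<ge> 0"
  shows "norm x ^ a * (1 + norm x) ^ N * cmod (pdl is f x) \<le> C * decay_const r2 A N * gs_weight r1 r2 (A * 2 powr r2) a (length is)"
proof -
  have C: "C \<ge> 0" by (rule gs_decay_nonneg[OF gs_decay])
  have "norm x ^ a * (1 + norm x) ^ N * cmod (pdl is f x) \<le> norm x ^ a * (2 ^ N * (1 + norm x ^ N)) * cmod (pdl is f x)"
    by (intro mult_right_mono mult_left_mono one_plus_power_le) auto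
  also have "\<dots> = 2 ^ N * (norm x ^ a * cmod (pdl is f x) + norm x ^ (a + N) * cmod (pdl is f x))"
    by (simp add: algebra_simps power_add)
  also have "\<dots> \<le> 2 ^ N * (C * gs_weight r1 r2 A a (length is) + C * gs_weight r1 r2 A (a + N) (length is))"
    by (intro mult_left_mono add_mono gs_decayD[OF gs_decay]) auto
  also have "\<dots> \<le> 2 ^ N * (C * gs_weight r1 r2 (A * 2 powr r2) a (length is)
       + C * (((A * 2 powr r2) ^ N * fact N powr r2) * gs_weight r1 r2 (A * 2 powr r2) a (length is)))"
  proof -
    have "A \<le> A * 2 powr r2"
      using A r2 by (simp add: ge_one_powr_ge_zero)
    then show ?thesis
      using C A r2 by (intro mult_left_mono add_mono gs_weight_shift gs_weight_mono) auto
  qed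
  also have "\<dots> = C * decay_const r2 A N * gs_weight r1 r2 (A * 2 powr r2) a (length is)"
    by (simp add: decay_const_def algebra_simps)
  finally show ?thesis .
qed

section \<open>A summable weight on the lattice\<close>

lemma
  fixes f :: "real^'n::finite \<Rightarrow> 'b::{banach, second_countable_topology}"
  assumes f [measurable]: "f \<in> borel_measurable borel" and c: "c \<noteq> 0"
  shows lborel_integrable_affine: "integrable lborel (\<lambda>x. f (t + c *\<^sub>R x)) \<longleftrightarrow> integrable lborel f"
    and lborel_integral_affine: "integral\<^sup>L lborel f = \<bar>c\<bar> ^ CARD('n) *\<^sub>R (\<integral>x. f (t + c *\<^sub>R x) \<partial>lborel)"
proof -
  note * = lborel_affine[OF c, of t]
  have "integrable lborel f \<longleftrightarrow> integrable (density (distr lborel borel (\<lambda>x. t + c *\<^sub>R x)) (\<lambda>_. ennreal (\<bar>c\<bar> ^ CARD('n)))) f"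
    by (subst *) simp
  also have "\<dots> \<longleftrightarrow> integrable lborel (\<lambda>x. \<bar>c\<bar> ^ CARD('n) *\<^sub>R f (t + c *\<^sub>R x))"
    by (subst integrable_density) (auto simp: integrable_distr_eq)
  also have "\<dots> \<longleftrightarrow> integrable lborel (\<lambda>x. f (t + c *\<^sub>R x))"
    using integrable_scaleR_right[of "inverse (\<bar>c\<bar> ^ CARD('n))" lborel "\<lambda>x. \<bar>c\<bar> ^ CARD('n) *\<^sub>R f (t + c *\<^sub>R x)"] c
    by auto
  finally show "integrable lborel (\<lambda>x. f (t + c *\<^sub>R x)) \<longleftrightarrow> integrable lborel f" ..
  have "integral\<^sup>L lborel f = integral\<^sup>L (density (distr lborel borel (\<lambda>x. t + c *\<^sub>R x)) (\<lambda>_. ennreal (\<bar>c\<bar> ^ CARD('n)))) f"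
    by (subst *) simp
  also have "\<dots> = (\<integral>x. \<bar>c\<bar> ^ CARD('n) *\<^sub>R f (t + c *\<^sub>R x) \<partial>lborel)"
    by (subst integral_density) (auto simp: integral_distr)
  finally show "integral\<^sup>L lborel f = \<bar>c\<bar> ^ CARD('n) *\<^sub>R (\<integral>x. f (t + c *\<^sub>R x) \<partial>lborel)"
    by simp
qed

text \<open>A fixed integrable majorant. The shell j \<le> norm x < j + 1 is bounded by a whole ball
  of volume of order (j + 1)^d, so the exponent d + 2 leaves the convergent sum of 1/(j +
  1)^2.\<close>

definition wt :: "real^'n::finite \<Rightarrow> real" where
  "wt x = 1 / (1 + norm x) ^ (CARD('n) + 2)"

lemma wt_pos: "wt x > 0"
  unfolding wt_def by (intro divide_pos_pos zero_less_power add_pos_nonneg) auto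

lemma wt_le_1: "wt x \<le> 1"
proof -
  have "1 / (1 + norm x) ^ (CARD('a) + 2) \<le> 1 / 1"
    by (intro frac_le one_le_power) auto
  then show ?thesis by (simp only: wt_def div_by_1)
qed

lemma one_plus_norm_pos: "1 + norm x > 0"
  by (rule add_pos_nonneg) auto

lemma continuous_on_wt [continuous_intros]: "continuous_on S f \<Longrightarrow> continuous_on S (\<lambda>x. wt (f x))"
  unfolding wt_def using one_plus_norm_pos by (intro continuous_intros) (auto simp: less_le)

lemma borel_measurable_wt [measurable]: "wt \<in> borel_measurable borel"
  by (intro borel_measurable_continuous_onI continuous_intros)

lemma integrable_wt: "integrable lborel (wt :: real^'n::finite \<Rightarrow> real)"
proof (rule integrableI_bounded)
  define V where "V = unit_ball_vol (real CARD('n))"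
  have V: "V \<ge> 0" by (simp add: V_def)
  have sq: "summable (\<lambda>j. V / real (Suc j) ^ 2)"
    using inverse_power_summable[of 2, where 'a = real] summable_Suc_iff[of "\<lambda>n. inverse (real n ^ 2)"]
    by (simp add: divide_inverse summable_mult)
  have "(\<integral>\<^sup>+ x. ennreal (norm (wt (x::real^'n))) \<partial>lborel)
     \<le> (\<integral>\<^sup>+ x. (\<Sum>j. ennreal (1 / real (Suc j) ^ (CARD('n) + 2)) * indicator (ball 0 (real (Suc j))) (x::real^'n)) \<partial>lborel)"
  proof (rule nn_integral_mono)
    fix x :: "real^'n"
    define j where "j = nat \<lfloor>norm x\<rfloor>"
    have j: "real j \<le> norm x" "norm x < real (Suc j)"
      unfolding j_def using norm_ge_zero[of x] by linarith+
    have "norm (wt x) \<le> 1 / real (Suc j) ^ (CARD('n) + 2)"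
      using j wt_pos[of x] unfolding wt_def
      by (simp del: power_Suc add: divide_simps)
    then have "ennreal (norm (wt x)) \<le> ennreal (1 / real (Suc j) ^ (CARD('n) + 2)) * indicator (ball 0 (real (Suc j))) x"
      using j by (simp add: ennreal_leI)
    also have "\<dots> = (\<Sum>i\<in>{j}. ennreal (1 / real (Suc i) ^ (CARD('n) + 2)) * indicator (ball 0 (real (Suc i))) x)"
      by (simp only: sum.insert[OF finite.emptyI] sum.empty empty_iff not_False_eq_True add_0_right)
    also have "\<dots> \<le> (\<Sum>i. ennreal (1 / real (Suc i) ^ (CARD('n) + 2)) * indicator (ball 0 (real (Suc i))) x)"
      by (intro sum_le_suminf) auto
    finally show "ennreal (norm (wt x)) \<le> (\<Sum>i. ennreal (1 / real (Suc i) ^ (CARD('n) + 2)) * indicator (ball 0 (real (Suc i))) x)" .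
  qed
  also have "\<dots> = (\<Sum>j. ennreal (1 / real (Suc j) ^ (CARD('n) + 2)) * emeasure lborel (ball (0::real^'n) (real (Suc j))))"
  proof (subst nn_integral_suminf)
    show "(\<lambda>x::real^'n. ennreal (1 / real (Suc j) ^ (CARD('n) + 2)) * indicator (ball 0 (real (Suc j))) x) \<in> borel_measurable lborel" for j
      by (intro borel_measurable_times_ennreal borel_measurable_const borel_measurable_indicator) auto
  qed (intro arg_cong[where f = suminf] ext nn_integral_cmult_indicator, simp)
  also have "\<dots> = (\<Sum>j. ennreal (V / real (Suc j) ^ 2))"
  proof (intro arg_cong[where f = suminf] ext)
    fix j
    have "1 / real (Suc j) ^ (CARD('n) + 2) * (V * real (Suc j) ^ CARD('n)) = V / real (Suc j) ^ 2"
      unfolding power_add by (simp del: of_nat_Suc)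
    then show "ennreal (1 / real (Suc j) ^ (CARD('n) + 2)) * emeasure lborel (ball (0::real^'n) (real (Suc j))) = ennreal (V / real (Suc j) ^ 2)"
      using V by (subst emeasure_ball) (simp_all add: V_def flip: ennreal_mult' del: of_nat_Suc power_Suc)
  qed
  also have "\<dots> = ennreal (\<Sum>j. V / real (Suc j) ^ 2)"
    using V sq by (intro suminf_ennreal2) auto
  finally show "(\<integral>\<^sup>+ x. ennreal (norm (wt (x::real^'n))) \<partial>lborel) < \<infinity>"
    by (simp add: le_less_trans)
qed simp

lemma integrable_wt_affine:
  fixes t :: "real^'n::finite"
  shows "c \<noteq> 0 \<Longrightarrow> integrable lborel (\<lambda>x. wt (t + c *\<^sub>R x))"
  by (subst lborel_integrable_affine) (auto intro: integrable_wt)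

definition wt_integral :: "'n::finite itself \<Rightarrow> real" where
  "wt_integral _ = integral\<^sup>L lborel (wt :: real^'n \<Rightarrow> real)"

lemma integral_wt_shift: "(\<integral>x. wt (x - (t::real^'n::finite)) \<partial>lborel) = wt_integral TYPE('n)"
  using lborel_integral_affine[of "wt :: real^'n \<Rightarrow> real" 1 "-t"] by (simp add: wt_integral_def algebra_simps)

lemma integrable_wt_shift: "integrable lborel (\<lambda>x. wt (x - (t::real^'n::finite)))"
  using integrable_wt_affine[of 1 "-t"] by (simp add: algebra_simps)

lemma wt_integral_nonneg: "wt_integral TYPE('n::finite) \<ge> 0"
  unfolding wt_integral_def by (intro integral_nonneg_AE) (simp add: less_imp_le[OF wt_pos])

section \<open>The integer lattice, its enumeration and lattice sums of the weight\<close>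

lemma lattice_add: "k \<in> lattice \<Longrightarrow> l \<in> lattice \<Longrightarrow> k + l \<in> lattice"
  and lattice_diff: "k \<in> lattice \<Longrightarrow> l \<in> lattice \<Longrightarrow> k - l \<in> lattice"
  and lattice_0: "0 \<in> lattice"
  by (auto simp: lattice_def)

lemma countable_lattice: "countable (lattice :: (real^'n::finite) set)"
proof -
  have "(lattice :: (real^'n) set) \<subseteq> range (\<lambda>f :: 'n \<Rightarrow> int. \<chi> i. of_int (f i))"
  proof
    fix k :: "real^'n" assume "k \<in> lattice"
    then have "k = (\<chi> i. of_int \<lfloor>k $ i\<rfloor>)"
      by (auto simp: lattice_def vec_eq_iff Ints_def)
    then show "k \<in> range (\<lambda>f :: 'n \<Rightarrow> int. \<chi> i. of_int (f i))"
      by (rule image_eqI[where x = "\<lambda>i. \<lfloor>k $ i\<rfloor>"]) simp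
  qed
  then show ?thesis
    by (rule countable_subset) (intro countable_image countableI_type)
qed

lemma infinite_lattice: "infinite (lattice :: (real^'n::finite) set)"
proof -
  have "inj (\<lambda>n::nat. (\<chi> i. real n) :: real^'n)"
    by (auto simp: inj_def vec_eq_iff)
  moreover have "range (\<lambda>n::nat. (\<chi> i. real n) :: real^'n) \<subseteq> lattice"
    by (auto simp: lattice_def)
  ultimately show ?thesis
    using infinite_super range_inj_infinite by blast
qed

text \<open>A fixed enumeration, which turns lattice sums into series over \<open>nat\<close>; the
  lattice sums that occur converge absolutely, so the choice of the enumeration is
  immaterial.\<close>

definition lat :: "nat \<Rightarrow> real^'n::finite" where
  "lat = from_nat_into lattice"

lemma bij_lat: "bij_betw lat UNIV (lattice :: (real^'n::finite) set)"
  unfolding lat_def by (intro bij_betw_from_nat_into countable_lattice infinite_lattice)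

lemma lat_in [simp]: "lat n \<in> lattice"
  using bij_lat bij_betwE by blast

lemma inj_lat: "inj lat"
  using bij_lat by (rule bij_betw_imp_inj_on)

definition wt_sum :: "'n::finite itself \<Rightarrow> real" where
  "wt_sum _ = (1 + real CARD('n)) ^ (CARD('n) + 2) * wt_integral TYPE('n)"

lemma wt_sum_nonneg: "wt_sum TYPE('n::finite) \<ge> 0"
  unfolding wt_sum_def using wt_integral_nonneg[where 'n = 'n] by simp

text \<open>An inequality of Peetre type: a shift of bounded length changes the weight by a bounded
  factor. It compares lattice sums with integrals, dominates difference quotients, and gives
  majorants that are uniform on balls.\<close>

lemma wt_shift_bound:
  fixes x y :: "real^'n::finite"
  assumes "norm (x - y) \<le> R"
  shows "wt x \<le> (1 + R) ^ (CARD('n) + 2) * wt y"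
proof -
  have R: "R \<ge> 0" using assms norm_ge_zero order_trans by blast
  have "norm y \<le> norm x + R"
    using assms norm_triangle_ineq2[of y x] by (simp add: norm_minus_commute)
  then have "1 + norm y \<le> (1 + R) * (1 + norm x)"
    using R by (simp add: algebra_simps) (smt (verit) mult_nonneg_nonneg norm_ge_zero)
  then have "(1 + norm y) ^ (CARD('n) + 2) \<le> ((1 + R) * (1 + norm x)) ^ (CARD('n) + 2)"
    by (intro power_mono) auto
  then show ?thesis
    unfolding wt_def using one_plus_norm_pos[of x] one_plus_norm_pos[of y]
    by (simp add: divide_simps power_mult_distrib del: power_Suc)
qed

text \<open>Comparison with an integral: \<open>wt (x - k)\<close> is at most a constant times the
  mean of \<open>wt (x - y)\<close> over a unit cube with corner k, and these cubes are disjoint.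
  The bound is uniform in x and F.\<close>

lemma sum_wt_le:
  fixes x :: "real^'n::finite"
  assumes F: "finite F" "F \<subseteq> lattice"
  shows "(\<Sum>k\<in>F. wt (x - k)) \<le> wt_sum TYPE('n)"
proof -
  \<comment> \<open>Open cubes: distinct lattice points give disjoint sets without any convention
    about the boundary. The local name is unrelated to the operator introduced later.\<close>
  define Q where "Q k = box k (k + 1)" for k :: "real^'n"
  define D where "D = (1 + real CARD('n)) ^ (CARD('n) + 2)"
  have D: "D \<ge> 0" by (simp add: D_def)
  have mQ: "measure lborel (Q k) = 1" for k
  proof -
    have "measure lborel (Q k) = (\<Prod>b\<in>Basis. ((k + 1) - k) \<bullet> b)"
      unfolding Q_def by (subst measure_lborel_box) (auto simp: inner_add_left Basis_vec_def inner_axis)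
    also have "\<dots> = 1"
      by (intro prod.neutral) (auto simp: Basis_vec_def inner_axis)
    finally show ?thesis .
  qed
  have fQ: "emeasure lborel (Q k) < \<infinity>" for k
    unfolding Q_def by (rule emeasure_lborel_box_finite)
  have [measurable]: "Q k \<in> sets borel" for k
    unfolding Q_def by simp
  have nQ: "norm (k - y) \<le> real CARD('n)" if "y \<in> Q k" for y k
  proof -
    have "norm (k - y) \<le> (\<Sum>i\<in>UNIV. \<bar>(k - y) $ i\<bar>)" by (rule norm_le_l1_cart)
    also have "\<dots> \<le> (\<Sum>i\<in>(UNIV::'n set). 1)"
    proof (rule sum_mono)
      fix i
      have "k $ i < y $ i \<and> y $ i < (k + 1) $ i"
        using that unfolding Q_def mem_box_cart by blast
      then show "\<bar>(k - y) $ i\<bar> \<le> 1" by auto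
    qed
    finally show ?thesis by simp
  qed
  have disj: "disjoint_family_on Q F"
    unfolding disjoint_family_on_def
  proof (intro ballI impI)
    fix k l assume kl: "k \<in> F" "l \<in> F" "k \<noteq> l"
    show "Q k \<inter> Q l = {}"
    proof (rule ccontr)
      assume "Q k \<inter> Q l \<noteq> {}"
      then obtain y where y: "y \<in> Q k" "y \<in> Q l" by blast
      have "k $ i = l $ i" for i
      proof -
        have "k $ i \<in> \<int>" "l $ i \<in> \<int>" using kl F by (auto simp: lattice_def)
        then obtain a b where ab: "k $ i = of_int a" "l $ i = of_int b" by (auto elim!: Ints_cases)
        have "k $ i < y $ i" "y $ i < k $ i + 1" "l $ i < y $ i" "y $ i < l $ i + 1"
          using y unfolding Q_def mem_box_cart by auto
        then have "a = b" unfolding ab by linarith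
        then show ?thesis by (simp add: ab)
      qed
      then show False using kl by (simp add: vec_eq_iff)
    qed
  qed
  have int: "integrable lborel (\<lambda>y. wt (x - y))"
    using integrable_wt_affine[of "-1" x] by simp
  have "(\<Sum>k\<in>F. wt (x - k)) = (\<Sum>k\<in>F. \<integral>y. wt (x - k) * indicator (Q k) y \<partial>lborel)"
    by (simp add: mQ)
  also have "\<dots> \<le> (\<Sum>k\<in>F. \<integral>y. D * wt (x - y) * indicator (Q k) y \<partial>lborel)"
  proof (intro sum_mono integral_mono)
    fix k y assume "k \<in> F"
    show "integrable lborel (\<lambda>y. wt (x - k) * indicator (Q k) y)"
      using fQ by (intro integrable_mult_right integrable_real_indicator) auto
    show "integrable lborel (\<lambda>y. D * wt (x - y) * indicator (Q k) y)"
      by (intro integrable_real_mult_indicator integrable_mult_right int) auto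
    show "wt (x - k) * indicator (Q k) y \<le> D * wt (x - y) * indicator (Q k) y"
      using wt_shift_bound[of "x - k" "x - y" "real CARD('n)"] nQ[of y k]
      by (auto simp: indicator_def D_def norm_minus_commute)
  qed
  also have "\<dots> = (\<integral>y. (\<Sum>k\<in>F. D * wt (x - y) * indicator (Q k) y) \<partial>lborel)"
    by (subst Bochner_Integration.integral_sum)
       (auto intro!: integrable_real_mult_indicator integrable_mult_right int)
  also have "\<dots> \<le> (\<integral>y. D * wt (x - y) \<partial>lborel)"
  proof (intro integral_mono Bochner_Integration.integrable_sum integrable_real_mult_indicator integrable_mult_right int)
    fix y
    have "(\<Sum>k\<in>F. D * wt (x - y) * indicator (Q k) y) = D * wt (x - y) * indicator (\<Union>k\<in>F. Q k) y"
      by (simp add: indicator_UN_disjoint[OF F(1) disj] sum_distrib_left)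
    also have "\<dots> \<le> D * wt (x - y)"
      using D wt_pos[of "x - y"] by (auto simp: indicator_def)
    finally show "(\<Sum>k\<in>F. D * wt (x - y) * indicator (Q k) y) \<le> D * wt (x - y)" .
  qed auto
  also have "\<dots> = wt_sum TYPE('n)"
    using lborel_integral_affine[of "wt :: real^'n \<Rightarrow> real" "-1" x]
    by (simp add: wt_sum_def D_def wt_integral_def)
  finally show ?thesis .
qed

lemma
  fixes x :: "real^'n::finite"
  shows summable_wt: "summable (\<lambda>n. wt (x - lat n))"
    and suminf_wt_le: "(\<Sum>n. wt (x - lat n)) \<le> wt_sum TYPE('n)"
proof -
  have *: "(\<Sum>n<N. wt (x - lat n)) \<le> wt_sum TYPE('n)" for N
  proof -
    have "(\<Sum>n<N. wt (x - lat n)) = (\<Sum>k\<in>lat ` {..<N}. wt (x - k))"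
      by (subst sum.reindex) (auto intro: inj_on_subset[OF inj_lat])
    also have "\<dots> \<le> wt_sum TYPE('n)"
      by (rule sum_wt_le) auto
    finally show ?thesis .
  qed
  show s: "summable (\<lambda>n. wt (x - lat n))"
    by (rule summableI_nonneg_bounded[OF _ *]) (simp add: less_imp_le[OF wt_pos])
  show "(\<Sum>n. wt (x - lat n)) \<le> wt_sum TYPE('n)"
    by (rule suminf_le_const[OF s *])
qed

lemma wt_minus [simp]: "wt (- x) = wt x"
  by (simp add: wt_def)

lemma summable_wt_lat: "summable (\<lambda>n. wt (lat n :: real^'n::finite))"
  using summable_wt[of "0 :: real^'n"] by simp

text \<open>\<open>q0\<close> is defined by an unordered sum over the lattice; absolute convergence
  allows the enumeration to replace it.\<close>

lemma infsum_lattice_eq_suminf: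
  fixes f :: "real^'n::finite \<Rightarrow> complex"
  assumes "summable (\<lambda>n. cmod (f (lat n)))"
  shows "infsum f lattice = (\<Sum>n. f (lat n))"
proof -
  have "infsum f lattice = infsum (\<lambda>n. f (lat n)) UNIV"
    by (rule infsum_reindex_bij_betw[OF bij_lat, symmetric])
  also have "\<dots> = (\<Sum>n. f (lat n))"
    by (intro infsumI norm_summable_imp_has_sum[OF assms] summable_sums summable_norm_cancel[OF assms])
  finally show ?thesis .
qed

section \<open>The projection kernel\<close>

text \<open>By the Weierstrass test the series of every derivative converges uniformly on balls,
  which gives continuity of the sums and termwise differentiation along lines.\<close>

lemma smooth_suminf:
  fixes f :: "nat \<Rightarrow> real^'n::finite \<Rightarrow> complex"
  assumes f: "\<And>n. smooth_fun (f n)"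
    and M: "\<And>is R. \<exists>M. summable M \<and> (\<forall>n x. norm x \<le> R \<longrightarrow> cmod (pdl is (f n) x) \<le> M n)"
  shows "smooth_fun (\<lambda>x. \<Sum>n. f n x)"
    and "pdl is (\<lambda>x. \<Sum>n. f n x) = (\<lambda>x. \<Sum>n. pdl is (f n) x)"
proof -
  let ?G = "\<lambda>is x. \<Sum>n. pdl is (f n) x"
  have ul: "uniform_limit (cball 0 R) (\<lambda>N x. \<Sum>n<N. pdl is (f n) x) (?G is) sequentially" for "is" R
  proof -
    obtain M where "summable M" "\<forall>n x. norm x \<le> R \<longrightarrow> cmod (pdl is (f n) x) \<le> M n"
      using M[of R "is"] by (elim exE conjE) (rule that)
    then show ?thesis
      by (intro Weierstrass_m_test[where M = M]) auto
  qed
  have sm: "summable (\<lambda>n. pdl is (f n) x)" for "is" x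
  proof -
    obtain M where "summable M" "\<forall>n y. norm y \<le> norm x \<longrightarrow> cmod (pdl is (f n) y) \<le> M n"
      using M[of "norm x" "is"] by (elim exE conjE) (rule that)
    then show ?thesis
      by (rule_tac summable_comparison_test'[of M 0]) auto
  qed
  have 2: "continuous_on UNIV (?G is)" for "is"
    unfolding continuous_on_eq_continuous_within
  proof
    fix x :: "real^'n"
    have "continuous_on (cball 0 (norm x + 1)) (?G is)"
      by (rule uniform_limit_theorem[OF always_eventually ul])
         (auto intro!: continuous_intros pdl_continuous f)
    then have "continuous_on (ball 0 (norm x + 1)) (?G is)"
      by (rule continuous_on_subset) auto
    then show "isCont (?G is) x"
      by (subst (asm) continuous_on_eq_continuous_at) auto
  qed
  have 3: "((\<lambda>t. ?G is (x + t *\<^sub>R axis i 1)) has_vector_derivative ?G (i # is) x) (at 0)" for "is" i x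
  proof -
    \<comment> \<open>A bounded parameter interval keeps the line inside one ball, where convergence
      is uniform; it is open, so derivatives within it are ordinary derivatives.\<close>
    let ?S = "{-1<..<1::real}"
    have in_ball: "x + t *\<^sub>R axis i 1 \<in> cball 0 (norm x + 1)" if "t \<in> ?S" for t
    proof -
      have "norm (x + t *\<^sub>R axis i 1) \<le> norm x + norm (t *\<^sub>R axis i (1::real))"
        by (rule norm_triangle_ineq)
      also have "\<dots> \<le> norm x + 1" using that by auto
      finally show ?thesis by simp
    qed
    have "\<exists>g. \<forall>t\<in>?S. (\<lambda>n. pdl is (f n) (x + t *\<^sub>R axis i 1)) sums g t \<and>
        (g has_derivative (\<lambda>h. h *\<^sub>R ?G (i # is) (x + t *\<^sub>R axis i 1))) (at t within ?S)"
    proof (rule has_derivative_series[where x = 0])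
      show "((\<lambda>t. pdl is (f n) (x + t *\<^sub>R axis i 1)) has_derivative (\<lambda>h. h *\<^sub>R pdl (i # is) (f n) (x + t *\<^sub>R axis i 1))) (at t within ?S)" for n t
        using pd_step_at[OF smooth_pdl[OF f], where S = ?S] by (simp add: has_vector_derivative_def)
      show "\<forall>\<^sub>F n in sequentially. \<forall>t\<in>?S. \<forall>h. norm ((\<Sum>k<n. h *\<^sub>R pdl (i # is) (f k) (x + t *\<^sub>R axis i 1)) - h *\<^sub>R ?G (i # is) (x + t *\<^sub>R axis i 1)) \<le> e * norm h"
        if e: "e > 0" for e
        using uniform_limitD[OF ul[of "i # is" "norm x + 1"] e]
      proof eventually_elim
        case (elim n)
        show ?case
        proof (intro ballI allI)
          fix t h assume t: "t \<in> ?S"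
          have "norm ((\<Sum>k<n. h *\<^sub>R pdl (i # is) (f k) (x + t *\<^sub>R axis i 1)) - h *\<^sub>R ?G (i # is) (x + t *\<^sub>R axis i 1))
             = \<bar>h\<bar> * dist (\<Sum>k<n. pdl (i # is) (f k) (x + t *\<^sub>R axis i 1)) (?G (i # is) (x + t *\<^sub>R axis i 1))"
            by (simp add: dist_norm flip: scaleR_sum_right scaleR_diff_right)
          also have "\<dots> \<le> \<bar>h\<bar> * e"
            using elim[rule_format, OF in_ball[OF t]] by (intro mult_left_mono) auto
          finally show "norm ((\<Sum>k<n. h *\<^sub>R pdl (i # is) (f k) (x + t *\<^sub>R axis i 1)) - h *\<^sub>R ?G (i # is) (x + t *\<^sub>R axis i 1)) \<le> e * norm h"
            by (simp add: mult.commute)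
        qed
      qed
      show "(\<lambda>n. pdl is (f n) (x + 0 *\<^sub>R axis i 1)) sums ?G is x"
        using sm by (simp add: summable_sums)
    qed auto
    then obtain g where g: "\<And>t. t \<in> ?S \<Longrightarrow> (\<lambda>n. pdl is (f n) (x + t *\<^sub>R axis i 1)) sums g t"
        "\<And>t. t \<in> ?S \<Longrightarrow> (g has_derivative (\<lambda>h. h *\<^sub>R ?G (i # is) (x + t *\<^sub>R axis i 1))) (at t within ?S)"
      by blast
    have "(g has_vector_derivative ?G (i # is) x) (at 0 within ?S)"
      using g(2)[of 0] by (simp add: has_vector_derivative_def)
    then have "(g has_vector_derivative ?G (i # is) x) (at 0)"
      by (subst (asm) has_vector_derivative_within_open) auto
    moreover have "g t = ?G is (x + t *\<^sub>R axis i 1)" if "t \<in> ?S" for t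
      using g(1)[OF that] by (simp add: sums_iff)
    ultimately show ?thesis
      by (auto elim!: has_vector_derivative_transform_within_open[where S = ?S])
  qed
  show "smooth_fun (\<lambda>x. \<Sum>n. f n x)"
    by (rule smooth_funI(1)[where G = ?G]) (use 2 3 in simp_all)
  show "pdl is (\<lambda>x. \<Sum>n. f n x) = ?G is"
    by (rule smooth_funI(2)[where G = ?G]) (use 2 3 in simp_all)
qed

lemma smooth_translate:
  fixes f :: "real^'n::finite \<Rightarrow> complex"
  assumes "smooth_fun f"
  shows "smooth_fun (\<lambda>x. f (x - k))" and "pdl is (\<lambda>x. f (x - k)) = (\<lambda>x. pdl is f (x - k))"
  using smooth_affine[OF assms, where c = 1 and b = "-k"] by simp_all

text \<open>The exponent and the constant are explicit because they reappear in the growth of the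
  lattice coefficients.\<close>

definition poly_bounded_by :: "nat \<Rightarrow> real \<Rightarrow> (real^'n::finite \<Rightarrow> complex) \<Rightarrow> bool" where
  "poly_bounded_by N K f \<longleftrightarrow> f \<in> borel_measurable borel \<and> (\<forall>y. cmod (f y) \<le> K * (1 + norm y) ^ N)"

lemma poly_bounded_by_measurable: "poly_bounded_by N K f \<Longrightarrow> f \<in> borel_measurable borel"
  and poly_bounded_byD: "poly_bounded_by N K f \<Longrightarrow> cmod (f y) \<le> K * (1 + norm y) ^ N"
  by (auto simp: poly_bounded_by_def)

lemma poly_bounded_by_nonneg: "poly_bounded_by N K f \<Longrightarrow> K \<ge> 0"
  using poly_bounded_byD[of N K f 0] by (simp add: order_trans[OF norm_ge_zero])

lemma smooth_measurable: "smooth_fun f \<Longrightarrow> f \<in> borel_measurable borel"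
  by (intro borel_measurable_continuous_onI smooth_continuous)

lemma one_plus_norm_le: "1 + norm y \<le> (1 + norm k) * (1 + norm (y - k))"
proof -
  have "norm y \<le> norm k + norm (y - k)"
    using norm_triangle_ineq[of k "y - k"] by simp
  then show ?thesis
    by (simp add: algebra_simps) (smt (verit) mult_nonneg_nonneg norm_ge_zero)
qed

lemma one_plus_norm_power_le: "(1 + norm y) ^ N \<le> (1 + norm k) ^ N * (1 + norm (y - k)) ^ N"
  unfolding power_mult_distrib[symmetric] by (intro power_mono one_plus_norm_le) auto

lemma borel_measurable_cnj [measurable (raw)]:
  "f \<in> borel_measurable M \<Longrightarrow> (\<lambda>x. cnj (f x)) \<in> borel_measurable M"
  by (erule measurable_compose) (rule borel_measurable_continuous_onI[OF continuous_on_cnj[OF continuous_on_id]])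

text \<open>The locale records size and smoothness of \<phi> alone. The multiresolution structure
  enters through explicit hypotheses of later results, and the locale is also instantiated with the
  conjugate of \<phi>.\<close>

locale gs_kernel =
  fixes \<phi> :: "real^'n::finite \<Rightarrow> complex" and \<rho>1 \<rho>2 A C :: real
  assumes smooth: "smooth_fun \<phi>" and gs_decay: "gs_decay \<rho>1 \<rho>2 A C \<phi>" and A: "A \<ge> 1"
    and \<rho>1: "\<rho>1 \<ge> 0" and \<rho>2: "\<rho>2 \<ge> 0"
begin

text \<open>The rate that remains after a factor (1 + norm x)^(d + 2 + N) has been absorbed; unlike
  the constant \<open>D N\<close> it does not depend on N.\<close>

definition A2 :: real where "A2 = A * 2 powr \<rho>2"
definition D :: "nat \<Rightarrow> real" where "D N = C * decay_const \<rho>2 A (CARD('n) + 2 + N)"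

lemma A2: "A2 \<ge> 1"
proof -
  have "1 * 1 \<le> A2"
    unfolding A2_def using A \<rho>2 by (intro mult_mono ge_one_powr_ge_zero) auto
  then show ?thesis by simp
qed

lemma C_nonneg: "C \<ge> 0"
  by (rule gs_decay_nonneg[OF gs_decay])

lemma D_nonneg: "D N \<ge> 0"
  unfolding D_def using C_nonneg decay_const_pos[of A] A by (simp add: less_imp_le)

lemma decay:
  "norm x ^ a * (1 + norm x) ^ N * cmod (pdl is \<phi> x) \<le> D N * gs_weight \<rho>1 \<rho>2 A2 a (length is) * wt x"
proof -
  have "norm x ^ a * (1 + norm x) ^ (CARD('n) + 2 + N) * cmod (pdl is \<phi> x) \<le> D N * gs_weight \<rho>1 \<rho>2 A2 a (length is)"
    unfolding D_def A2_def using A by (intro gs_decay_times_power[OF gs_decay] \<rho>2) auto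
  moreover have "norm x ^ a * (1 + norm x) ^ (CARD('n) + 2 + N) * cmod (pdl is \<phi> x)
      = (norm x ^ a * (1 + norm x) ^ N * cmod (pdl is \<phi> x)) / wt x"
    by (simp add: wt_def power_add)
  ultimately show ?thesis
    using wt_pos[of x] by (simp add: pos_divide_le_eq)
qed

lemma decay_a: "norm x ^ a * cmod (pdl is \<phi> x) \<le> D 0 * gs_weight \<rho>1 \<rho>2 A2 a (length is) * wt x"
  using decay[of x a 0] by simp

lemma decay_N: "(1 + norm x) ^ N * cmod (pdl is \<phi> x) \<le> D N * gs_weight \<rho>1 \<rho>2 A2 0 (length is) * wt x"
  using decay[of x 0 N] by simp

lemma phi_N: "(1 + norm x) ^ N * cmod (\<phi> x) \<le> D N * wt x"
  using decay[of x 0 N "[]"] by simp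

lemma phi_le: "cmod (\<phi> x) \<le> D 0 * wt x"
  using phi_N[of x 0] by simp

lemma phi_bounded: "cmod (\<phi> x) \<le> D 0"
  by (rule order_trans[OF phi_le]) (simp add: mult_left_le D_nonneg wt_le_1)

lemma phi_measurable [measurable]: "\<phi> \<in> borel_measurable borel"
  by (rule smooth_measurable[OF smooth])

lemma gs_weight_A2_nonneg: "gs_weight r1 r2 A2 a l \<ge> 0"
  using gs_weight_pos[of A2] A2 by (simp add: less_imp_le)

definition coeff :: "(real^'n \<Rightarrow> complex) \<Rightarrow> nat \<Rightarrow> complex" where
  "coeff f n = (\<integral>y. f y * cnj (\<phi> (y - lat n)) \<partial>lborel)"

lemma poly_bounded_by_phi_bound:
  assumes "poly_bounded_by N K f"
  shows "cmod (f y * cnj (\<phi> (y - k))) \<le> K * (1 + norm k) ^ N * D N * wt (y - k)"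
proof -
  have "cmod (f y * cnj (\<phi> (y - k))) \<le> (K * ((1 + norm k) ^ N * (1 + norm (y - k)) ^ N)) * cmod (\<phi> (y - k))"
    using poly_bounded_byD[OF assms, of y] poly_bounded_by_nonneg[OF assms]
    by (auto simp: norm_mult intro!: mult_right_mono order_trans[OF poly_bounded_byD[OF assms, of y] mult_left_mono[OF one_plus_norm_power_le]])
  also have "\<dots> = K * (1 + norm k) ^ N * ((1 + norm (y - k)) ^ N * cmod (\<phi> (y - k)))"
    by (simp add: mult_ac)
  also have "\<dots> \<le> K * (1 + norm k) ^ N * (D N * wt (y - k))"
    using poly_bounded_by_nonneg[OF assms] by (intro mult_left_mono phi_N) auto
  finally show ?thesis by (simp add: mult_ac)
qed

lemma integrable_poly_bounded_by_phi:
  assumes "poly_bounded_by N K f"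
  shows "integrable lborel (\<lambda>y. f y * cnj (\<phi> (y - k)))"
proof (rule Bochner_Integration.integrable_bound)
  show "integrable lborel (\<lambda>y. K * (1 + norm k) ^ N * D N * wt (y - k))"
    by (intro integrable_mult_right integrable_wt_shift)
  have [measurable]: "f \<in> borel_measurable borel" by (rule poly_bounded_by_measurable[OF assms])
  show "(\<lambda>y. f y * cnj (\<phi> (y - k))) \<in> borel_measurable lborel"
    by measurable
  show "AE y in lborel. norm (f y * cnj (\<phi> (y - k))) \<le> norm (K * (1 + norm k) ^ N * D N * wt (y - k))"
    using poly_bounded_by_phi_bound[OF assms, of _ k] by (auto intro: order_trans[OF _ abs_ge_self])
qed

lemma integral_norm_poly_bounded_by_phi:
  assumes "poly_bounded_by N K f"
  shows "(\<integral>y. cmod (f y * cnj (\<phi> (y - k))) \<partial>lborel) \<le> K * D N * wt_integral TYPE('n) * (1 + norm k) ^ N"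
proof -
  have "(\<integral>y. cmod (f y * cnj (\<phi> (y - k))) \<partial>lborel) \<le> (\<integral>y. K * (1 + norm k) ^ N * D N * wt (y - k) \<partial>lborel)"
    by (intro integral_mono integrable_norm integrable_poly_bounded_by_phi[OF assms] integrable_mult_right integrable_wt_shift poly_bounded_by_phi_bound[OF assms])
  then show ?thesis by (simp add: integral_wt_shift mult_ac)
qed

lemma coeff_bound:
  assumes "poly_bounded_by N K f"
  shows "cmod (coeff f n) \<le> K * D N * wt_integral TYPE('n) * (1 + norm (lat n :: real^'n)) ^ N"
  unfolding coeff_def by (rule order_trans[OF integral_norm_bound integral_norm_poly_bounded_by_phi[OF assms]])

text \<open>Polynomial growth in k is traded for polynomial growth in x, because \<phi> (x - k) is
  concentrated near k = x.\<close>

lemma lat_term_bound: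
  "(1 + norm k) ^ N * cmod (pdl is \<phi> (x - k)) \<le> (1 + norm x) ^ N * D N * gs_weight \<rho>1 \<rho>2 A2 0 (length is) * wt (x - k)"
proof -
  have "(1 + norm k) ^ N * cmod (pdl is \<phi> (x - k)) \<le> ((1 + norm x) ^ N * (1 + norm (x - k)) ^ N) * cmod (pdl is \<phi> (x - k))"
    using one_plus_norm_power_le[of k N x] by (intro mult_right_mono) (auto simp: norm_minus_commute)
  also have "\<dots> \<le> (1 + norm x) ^ N * (D N * gs_weight \<rho>1 \<rho>2 A2 0 (length is) * wt (x - k))"
    unfolding mult.assoc[of "(1 + norm x) ^ N"] by (intro mult_left_mono decay_N) auto
  finally show ?thesis by (simp add: mult_ac)
qed

lemma summable_lat_term: "summable (\<lambda>n. (1 + norm (lat n :: real^'n)) ^ N * cmod (pdl is \<phi> (x - lat n)))"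
  by (rule summable_comparison_test'[of "\<lambda>n. (1 + norm x) ^ N * D N * gs_weight \<rho>1 \<rho>2 A2 0 (length is) * wt (x - lat n)" 0])
     (use lat_term_bound in \<open>auto intro!: summable_mult summable_wt\<close>)

definition lattice_series :: "(nat \<Rightarrow> complex) \<Rightarrow> real^'n \<Rightarrow> complex" where
  "lattice_series c x = (\<Sum>n. c n * \<phi> (x - lat n))"

lemma summable_lattice_series:
  assumes c: "\<And>n. cmod (c n) \<le> K * (1 + norm (lat n :: real^'n)) ^ N"
  shows "summable (\<lambda>n. cmod (c n * pdl is \<phi> (x - lat n)))"
proof (rule summable_comparison_test'[of "\<lambda>n. K * ((1 + norm (lat n :: real^'n)) ^ N * cmod (pdl is \<phi> (x - lat n)))" 0])
  show "summable (\<lambda>n. K * ((1 + norm (lat n :: real^'n)) ^ N * cmod (pdl is \<phi> (x - lat n))))"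
    by (intro summable_mult summable_lat_term)
  show "norm (cmod (c n * pdl is \<phi> (x - lat n))) \<le> K * ((1 + norm (lat n :: real^'n)) ^ N * cmod (pdl is \<phi> (x - lat n)))" for n
    using mult_right_mono[OF c[of n] norm_ge_zero[of "pdl is \<phi> (x - lat n)"]] by (simp add: norm_mult mult_ac)
qed

lemma
  assumes c: "\<And>n. cmod (c n) \<le> K * (1 + norm (lat n :: real^'n)) ^ N"
  shows smooth_lattice_series: "smooth_fun (lattice_series c)"
    and pdl_lattice_series: "pdl is (lattice_series c) x = (\<Sum>n. c n * pdl is \<phi> (x - lat n))"
proof -
  let ?f = "\<lambda>n x. c n * \<phi> (x - lat n)"
  have K: "K \<ge> 0"
    using c[of 0] norm_ge_zero[of "c 0"] one_plus_norm_pos[of "lat 0 :: real^'n"]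
    by (meson order_trans zero_le_mult_iff zero_less_power not_le)
  have f: "smooth_fun (?f n)" "pdl is (?f n) = (\<lambda>x. c n * pdl is \<phi> (x - lat n))" for n "is"
    using smooth_mult_left[OF smooth_translate(1)[OF smooth]] by (simp_all add: smooth_translate(2)[OF smooth])
  have M: "\<exists>M. summable M \<and> (\<forall>n x. norm x \<le> R \<longrightarrow> cmod (pdl is (?f n) x) \<le> M n)" for "is" R
  proof (intro exI conjI allI impI)
    \<comment> \<open>The weight is moved from \<open>x - lat n\<close> to \<open>lat n\<close> at
      the cost of (1 + |R|)^(d + 2), which gives one summable majorant for the whole ball.\<close>
    define B where "B = K * ((1 + \<bar>R\<bar>) ^ N * D N * gs_weight \<rho>1 \<rho>2 A2 0 (length is)) * (1 + \<bar>R\<bar>) ^ (CARD('n) + 2)"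
    show "summable (\<lambda>n. B * wt (lat n :: real^'n))"
      by (intro summable_mult summable_wt_lat)
    fix n and x :: "real^'n" assume x: "norm x \<le> R"
    have "cmod (pdl is (?f n) x) \<le> K * ((1 + norm (lat n :: real^'n)) ^ N * cmod (pdl is \<phi> (x - lat n)))"
      using mult_right_mono[OF c[of n] norm_ge_zero[of "pdl is \<phi> (x - lat n)"]] by (simp add: f norm_mult mult_ac)
    also have "\<dots> \<le> K * ((1 + norm x) ^ N * D N * gs_weight \<rho>1 \<rho>2 A2 0 (length is) * wt (x - lat n))"
      using K by (intro mult_left_mono lat_term_bound)
    also have "\<dots> \<le> K * ((1 + \<bar>R\<bar>) ^ N * D N * gs_weight \<rho>1 \<rho>2 A2 0 (length is) * ((1 + \<bar>R\<bar>) ^ (CARD('n) + 2) * wt (- lat n :: real^'n)))"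
      using K x D_nonneg gs_weight_A2_nonneg wt_pos[of "x - lat n"]
      by (intro mult_left_mono mult_mono mult_right_mono power_mono wt_shift_bound mult_nonneg_nonneg) (auto simp: less_imp_le)
    also have "\<dots> = B * wt (lat n :: real^'n)"
      by (simp add: B_def mult_ac)
    finally show "cmod (pdl is (?f n) x) \<le> B * wt (lat n :: real^'n)" .
  qed
  show "smooth_fun (lattice_series c)"
    unfolding lattice_series_def[abs_def] by (rule smooth_suminf(1)[OF f(1) M])
  show "pdl is (lattice_series c) x = (\<Sum>n. c n * pdl is \<phi> (x - lat n))"
    unfolding lattice_series_def[abs_def] smooth_suminf(2)[OF f(1) M] by (simp add: f)
qed

lemma q0_eq: "q0 \<phi> x y = (\<Sum>n. \<phi> (x - lat n) * cnj (\<phi> (y - lat n)))"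
  and summable_q0: "summable (\<lambda>n. cmod (\<phi> (x - lat n) * cnj (\<phi> (y - lat n))))"
  and q0_term_bound: "cmod (\<phi> (x - lat n) * cnj (\<phi> (y - lat n))) \<le> D 0 * D 0 * wt (x - lat n)"
proof -
  have *: "cmod (\<phi> (x - lat n) * cnj (\<phi> (y - lat n))) \<le> D 0 * D 0 * wt (x - lat n)" for n
  proof -
    have "cmod (\<phi> (x - lat n)) * cmod (\<phi> (y - lat n)) \<le> (D 0 * wt (x - lat n)) * D 0"
      using wt_pos[of "x - lat n"] D_nonneg[of 0] by (intro mult_mono phi_le phi_bounded) auto
    then show ?thesis by (simp add: norm_mult mult_ac)
  qed
  then show "cmod (\<phi> (x - lat n) * cnj (\<phi> (y - lat n))) \<le> D 0 * D 0 * wt (x - lat n)" .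
  show "summable (\<lambda>n. cmod (\<phi> (x - lat n) * cnj (\<phi> (y - lat n))))"
    by (rule summable_comparison_test'[of "\<lambda>n. D 0 * D 0 * wt (x - lat n)" 0]) 
       (use * in \<open>auto intro!: summable_mult summable_wt\<close>)
  then show "q0 \<phi> x y = (\<Sum>n. \<phi> (x - lat n) * cnj (\<phi> (y - lat n)))"
    unfolding q0_def by (rule infsum_lattice_eq_suminf)
qed

lemma q0_bound: "cmod (q0 \<phi> x y) \<le> D 0 * D 0 * wt_sum TYPE('n)"
proof -
  have "cmod (q0 \<phi> x y) \<le> (\<Sum>n. cmod (\<phi> (x - lat n) * cnj (\<phi> (y - lat n))))"
    unfolding q0_eq by (rule summable_norm[OF summable_q0])
  also have "\<dots> \<le> (\<Sum>n. D 0 * D 0 * wt (x - lat n))"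
    by (intro suminf_le q0_term_bound summable_q0 summable_mult summable_wt)
  also have "\<dots> = D 0 * D 0 * (\<Sum>n. wt (x - lat n))"
    by (intro suminf_mult summable_wt)
  also have "\<dots> \<le> D 0 * D 0 * wt_sum TYPE('n)"
    using D_nonneg[of 0] by (intro mult_left_mono suminf_wt_le) auto
  finally show ?thesis .
qed

definition Q :: "(real^'n \<Rightarrow> complex) \<Rightarrow> real^'n \<Rightarrow> complex" where
  "Q f x = (\<integral>y. f y * q0 \<phi> x y \<partial>lborel)"

text \<open>Sum and integral are exchanged: the integrals of the absolute values grow at most like a
  power of 1 + norm (lat n), while \<phi> (x - lat n) decays faster than every power. The series
  form makes \<open>Q f\<close> smooth for merely measurable f.\<close>

lemma
  assumes f: "poly_bounded_by N K f"
  shows integrable_Q: "integrable lborel (\<lambda>y. f y * q0 \<phi> x y)"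
    and Q_eq_lattice_series: "Q f x = lattice_series (coeff f) x"
proof -
  let ?h = "\<lambda>n y. \<phi> (x - lat n) * (f y * cnj (\<phi> (y - lat n)))"
  have h_int: "integrable lborel (?h n)" for n
    by (intro integrable_mult_right integrable_poly_bounded_by_phi[OF f])
  have sum1: "summable (\<lambda>n. norm (?h n y))" for y
  proof -
    have "summable (\<lambda>n. cmod (f y) * cmod (\<phi> (x - lat n) * cnj (\<phi> (y - lat n))))"
      by (intro summable_mult summable_q0)
    then show ?thesis by (simp add: norm_mult mult_ac)
  qed
  have sum2: "summable (\<lambda>n. \<integral>y. norm (?h n y) \<partial>lborel)"
  proof (rule summable_comparison_test'[of "\<lambda>n. K * D N * wt_integral TYPE('n) * ((1 + norm (lat n :: real^'n)) ^ N * cmod (pdl [] \<phi> (x - lat n)))" 0])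
    show "summable (\<lambda>n. K * D N * wt_integral TYPE('n) * ((1 + norm (lat n :: real^'n)) ^ N * cmod (pdl [] \<phi> (x - lat n))))"
      by (intro summable_mult summable_lat_term)
    fix n
    have "(\<integral>y. norm (?h n y) \<partial>lborel) = cmod (\<phi> (x - lat n)) * (\<integral>y. cmod (f y * cnj (\<phi> (y - lat n))) \<partial>lborel)"
      by (simp add: norm_mult)
    also have "\<dots> \<le> cmod (\<phi> (x - lat n)) * (K * D N * wt_integral TYPE('n) * (1 + norm (lat n :: real^'n)) ^ N)"
      by (intro mult_left_mono integral_norm_poly_bounded_by_phi[OF f]) auto
    finally have "(\<integral>y. norm (?h n y) \<partial>lborel) \<le> K * D N * wt_integral TYPE('n) * ((1 + norm (lat n :: real^'n)) ^ N * cmod (pdl [] \<phi> (x - lat n)))"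
      by (simp add: mult_ac)
    then show "norm (\<integral>y. norm (?h n y) \<partial>lborel) \<le> K * D N * wt_integral TYPE('n) * ((1 + norm (lat n :: real^'n)) ^ N * cmod (pdl [] \<phi> (x - lat n)))"
      by simp
  qed
  have eq: "f y * q0 \<phi> x y = (\<Sum>n. ?h n y)" for y
  proof -
    have "(\<Sum>n. ?h n y) = (\<Sum>n. f y * (\<phi> (x - lat n) * cnj (\<phi> (y - lat n))))"
      by (simp add: mult_ac)
    also have "\<dots> = f y * q0 \<phi> x y"
      unfolding q0_eq by (intro suminf_mult summable_norm_cancel[OF summable_q0])
    finally show ?thesis ..
  qed
  show "integrable lborel (\<lambda>y. f y * q0 \<phi> x y)"
    unfolding eq by (rule integrable_suminf) (use h_int sum1 sum2 in auto)
  have "Q f x = (\<Sum>n. integral\<^sup>L lborel (?h n))"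
    unfolding Q_def eq by (rule integral_suminf) (use h_int sum1 sum2 in auto)
  also have "\<dots> = lattice_series (coeff f) x"
    unfolding lattice_series_def coeff_def by (simp add: mult.commute)
  finally show "Q f x = lattice_series (coeff f) x" .
qed

lemma
  assumes f: "poly_bounded_by N K f"
  shows smooth_Q: "smooth_fun (Q f)"
    and pdl_Q: "pdl is (Q f) x = (\<Sum>n. coeff f n * pdl is \<phi> (x - lat n))"
    and summable_pdl_Q: "summable (\<lambda>n. cmod (coeff f n * pdl is \<phi> (x - lat n)))"
proof -
  have *: "Q f = lattice_series (coeff f)"
    using Q_eq_lattice_series[OF f] by blast
  show "smooth_fun (Q f)"
    unfolding * by (rule smooth_lattice_series[OF coeff_bound[OF f]])
  show "pdl is (Q f) x = (\<Sum>n. coeff f n * pdl is \<phi> (x - lat n))"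
    unfolding * by (rule pdl_lattice_series[OF coeff_bound[OF f]])
  show "summable (\<lambda>n. cmod (coeff f n * pdl is \<phi> (x - lat n)))"
    by (rule summable_lattice_series[OF coeff_bound[OF f]])
qed

end

section \<open>Integration by parts and moments\<close>

text \<open>The difference quotients have integral 0 by translation invariance, and
  \<open>wt_shift_bound\<close> dominates them. This yields integration by parts in any direction v
  without separating variables.\<close>

lemma integral_directional_derivative:
  fixes G DG :: "real^'n::finite \<Rightarrow> complex"
  assumes G: "integrable lborel G" and mG [measurable]: "G \<in> borel_measurable borel" "DG \<in> borel_measurable borel"
    and der: "\<And>x. ((\<lambda>t. G (x + t *\<^sub>R v)) has_vector_derivative DG x) (at 0)"
    and bd: "\<And>x. cmod (DG x) \<le> K * wt x"
  shows "integral\<^sup>L lborel DG = 0"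
proof -
  have K: "K \<ge> 0"
    using bd[of 0] wt_pos[of "0 :: real^'n"] norm_ge_zero[of "DG 0"] by (meson order_trans zero_le_mult_iff not_le)
  \<comment> \<open>Steps 1/(i+1) are never 0 and at most 1; the latter keeps all shifts within norm
    v, the radius used for the weight.\<close>
  define h where "h i = 1 / real (Suc i)" for i
  have h: "h i > 0" "h i \<le> 1" for i by (auto simp: h_def)
  have h0: "h \<longlonglongrightarrow> 0"
    unfolding h_def by (rule LIMSEQ_Suc[OF lim_1_over_n])
  define s where "s i x = (G (x + h i *\<^sub>R v) - G x) /\<^sub>R h i" for i x
  have shift_int: "integrable lborel (\<lambda>x. G (x + w))" for w
    using lborel_integrable_affine[of G 1 w] G by (simp add: add.commute)
  have "(\<lambda>i. integral\<^sup>L lborel (s i)) \<longlonglongrightarrow> integral\<^sup>L lborel DG"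
  proof (rule integral_dominated_convergence)
    show "integrable lborel (\<lambda>x. K * (1 + norm v) ^ (CARD('n) + 2) * wt x)"
      by (intro integrable_mult_right integrable_wt)
    show "AE x in lborel. (\<lambda>i. s i x) \<longlonglongrightarrow> DG x"
    proof (rule AE_I2)
      fix x
      have "(\<lambda>t. norm (G (x + t *\<^sub>R v) - G x - t *\<^sub>R DG x) / norm t) \<midarrow>0\<rightarrow> 0"
        using der[of x] unfolding has_vector_derivative_def has_derivative_at by simp
      moreover have "filterlim h (at 0) sequentially"
        using h0 h(1) by (auto simp: filterlim_at intro!: always_eventually) (metis less_irrefl)
      ultimately have "(\<lambda>i. norm (G (x + h i *\<^sub>R v) - G x - h i *\<^sub>R DG x) / norm (h i)) \<longlonglongrightarrow> 0"
        by (rule filterlim_compose)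
      moreover have "norm (G (x + h i *\<^sub>R v) - G x - h i *\<^sub>R DG x) / norm (h i) = norm (s i x - DG x)" for i
      proof -
        have "s i x - DG x = (G (x + h i *\<^sub>R v) - G x - h i *\<^sub>R DG x) /\<^sub>R h i"
          using h(1)[of i] by (simp add: s_def scaleR_diff_right)
        then show ?thesis by (simp add: divide_inverse mult.commute)
      qed
      ultimately show "(\<lambda>i. s i x) \<longlonglongrightarrow> DG x"
        by (simp add: LIM_zero_cancel tendsto_norm_zero_iff)
    qed
    show "AE x in lborel. norm (s i x) \<le> K * (1 + norm v) ^ (CARD('n) + 2) * wt x" for i
    proof (rule AE_I2)
      fix x
      have "norm ((\<lambda>t. G (x + t *\<^sub>R v)) (h i) - (\<lambda>t. G (x + t *\<^sub>R v)) 0) \<le> (K * (1 + norm v) ^ (CARD('n) + 2) * wt x) * \<bar>h i\<bar>"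
      proof (rule real_MVT_bound[OF line_derivative_shift[of G v DG, OF der]])
        fix t :: real assume "\<bar>t\<bar> \<le> \<bar>h i\<bar>"
        then have "\<bar>t\<bar> * norm v \<le> 1 * norm v"
          using h[of i] by (intro mult_right_mono) auto
        then have "wt (x + t *\<^sub>R v) \<le> (1 + norm v) ^ (CARD('n) + 2) * wt x"
          by (intro wt_shift_bound) simp
        then have "K * wt (x + t *\<^sub>R v) \<le> K * ((1 + norm v) ^ (CARD('n) + 2) * wt x)"
          using K by (rule mult_left_mono)
        then show "cmod (DG (x + t *\<^sub>R v)) \<le> K * (1 + norm v) ^ (CARD('n) + 2) * wt x"
          using bd[of "x + t *\<^sub>R v"] by (simp add: mult.assoc)
      qed
      then show "norm (s i x) \<le> K * (1 + norm v) ^ (CARD('n) + 2) * wt x"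
        using h(1)[of i] by (simp add: s_def divide_simps mult.commute)
    qed
    show "s i \<in> borel_measurable lborel" for i
      unfolding s_def[abs_def] by measurable
  qed measurable
  moreover have "integral\<^sup>L lborel (s i) = 0" for i
  proof -
    have "integral\<^sup>L lborel (s i) = ((\<integral>x. G (x + h i *\<^sub>R v) \<partial>lborel) - integral\<^sup>L lborel G) /\<^sub>R h i"
      unfolding s_def using G shift_int by simp
    also have "(\<integral>x. G (x + h i *\<^sub>R v) \<partial>lborel) = integral\<^sup>L lborel G"
      using lborel_integral_affine[of G 1 "h i *\<^sub>R v"] by (simp add: add.commute)
    finally show ?thesis by simp
  qed
  ultimately show ?thesis
    by (simp add: LIMSEQ_const_iff)
qed

text \<open>The list without its r-th entry, counted from 0: what is left of the monomial when its
  r-th factor is differentiated.\<close>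

definition monomial_omit :: "'n list \<Rightarrow> nat \<Rightarrow> 'n list" where
  "monomial_omit ks r = take r ks @ drop (Suc r) ks"

lemma length_monomial_omit: "r < length ks \<Longrightarrow> length (monomial_omit ks r) = length ks - 1"
  by (simp add: monomial_omit_def)

lemma monomial_omit: "r < length ks \<Longrightarrow> v $ (ks ! r) * monomial (monomial_omit ks r) v = monomial ks v"
  by (subst (3) id_take_nth_drop[of r ks]) (simp_all add: monomial_omit_def monomial_def)

lemma monomial_line_derivative:
  fixes x v :: "real^'n::finite"
  shows "((\<lambda>t. monomial ks (x + t *\<^sub>R v)) has_real_derivative (\<Sum>r<length ks. v $ (ks ! r) * monomial (monomial_omit ks r) x)) (at 0)"
proof (induction ks)
  case (Cons k ks)
  have d: "((\<lambda>t. (x + t *\<^sub>R v) $ k) has_real_derivative v $ k) (at 0)"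
    by (auto intro!: derivative_eq_intros)
  have "((\<lambda>t. (x + t *\<^sub>R v) $ k * monomial ks (x + t *\<^sub>R v)) has_real_derivative
     v $ k * monomial ks (x + 0 *\<^sub>R v) + (\<Sum>r<length ks. v $ (ks ! r) * monomial (monomial_omit ks r) x) * (x + 0 *\<^sub>R v) $ k) (at 0)"
    by (rule DERIV_mult[OF d Cons])
  also have "v $ k * monomial ks (x + 0 *\<^sub>R v) + (\<Sum>r<length ks. v $ (ks ! r) * monomial (monomial_omit ks r) x) * (x + 0 *\<^sub>R v) $ k
     = (\<Sum>r<length (k # ks). v $ ((k # ks) ! r) * monomial (monomial_omit (k # ks) r) x)"
    unfolding list.size(4) add_Suc_right add_0_right sum.lessThan_Suc_shift by (simp add: monomial_omit_def sum_distrib_left sum_distrib_right mult_ac)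
  finally show ?case by simp
qed simp

lemma monomial_measurable [measurable]: "monomial ks \<in> borel_measurable borel"
  by (intro borel_measurable_continuous_onI continuous_intros)

text \<open>The Schwartz condition with the integrable weight built in, so that products with
  monomials are integrable at once.\<close>

definition rapid :: "(real^'n::finite \<Rightarrow> complex) \<Rightarrow> bool" where
  "rapid f \<longleftrightarrow> smooth_fun f \<and> (\<forall>is N. \<exists>K. \<forall>x. (1 + norm x) ^ N * cmod (pdl is f x) \<le> K * wt x)"

lemma rapid_smooth: "rapid f \<Longrightarrow> smooth_fun f"
  by (simp add: rapid_def)

lemma rapid_pdl: "rapid f \<Longrightarrow> rapid (pdl js f)"
  unfolding rapid_def by (auto simp: smooth_pdl simp flip: pdl_append)

lemma rapid_monomial_bound:
  assumes "rapid f"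
  obtains K where "\<And>x. cmod (of_real (monomial ks x) * f x) \<le> K * wt x"
proof -
  obtain K where K: "\<And>x. (1 + norm x) ^ length ks * cmod (f x) \<le> K * wt x"
    using assms unfolding rapid_def by (metis pdl.simps(1))
  have "cmod (of_real (monomial ks x) * f x) \<le> K * wt x" for x
  proof -
    have "\<bar>monomial ks x\<bar> \<le> (1 + norm x) ^ length ks"
      by (rule order_trans[OF monomial_le power_mono]) auto
    then have "\<bar>monomial ks x\<bar> * cmod (f x) \<le> (1 + norm x) ^ length ks * cmod (f x)"
      by (rule mult_right_mono) auto
    also note K
    finally show ?thesis by (simp add: norm_mult)
  qed
  then show ?thesis by (rule that)
qed

lemma wt_integrable_bound:
  fixes f :: "real^'n::finite \<Rightarrow> complex"
  assumes [measurable]: "f \<in> borel_measurable borel" and "\<And>x. cmod (f x) \<le> K * wt x"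
  shows "integrable lborel f"
proof (rule Bochner_Integration.integrable_bound)
  show "integrable lborel (\<lambda>x::real^'n. K * wt x)"
    by (intro integrable_mult_right integrable_wt)
qed (use assms in \<open>auto intro: order_trans[OF _ abs_ge_self]\<close>)

lemma rapid_monomial_integrable:
  assumes "rapid f"
  shows "integrable lborel (\<lambda>x. of_real (monomial ks x) * f x)"
proof -
  obtain K where K: "\<And>x. cmod (of_real (monomial ks x) * f x) \<le> K * wt x"
    using rapid_monomial_bound[OF assms] by blast
  have [measurable]: "f \<in> borel_measurable borel"
    by (rule smooth_measurable[OF rapid_smooth[OF assms]])
  show ?thesis
    by (rule wt_integrable_bound[OF _ K]) measurable
qed

text \<open>The derivative along v of the product of the monomial with f has integral 0.
  \<open>DG1\<close> collects the terms in which f is differentiated, \<open>DG2\<close> those in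
  which a factor of the monomial is. Keeping v general lets the iterated version treat the whole
  form at once.\<close>

lemma integration_by_parts_monomial:
  fixes f :: "real^'n::finite \<Rightarrow> complex"
  assumes f: "rapid f"
  shows "(\<Sum>i\<in>UNIV. of_real (v $ i) * (\<integral>x. of_real (monomial ks x) * pd i f x \<partial>lborel))
    = - (\<Sum>r<length ks. of_real (v $ (ks ! r)) * (\<integral>x. of_real (monomial (monomial_omit ks r) x) * f x \<partial>lborel))"
proof -
  define G where "G x = of_real (monomial ks x) * f x" for x
  define DG1 where "DG1 x = (\<Sum>i\<in>UNIV. of_real (v $ i) * (of_real (monomial ks x) * pd i f x))" for x
  define DG2 where "DG2 x = (\<Sum>r<length ks. of_real (v $ (ks ! r)) * (of_real (monomial (monomial_omit ks r) x) * f x))" for x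
  have pdf: "rapid (pd i f)" for i using rapid_pdl[OF f, of "[i]"] by simp
  note int = rapid_monomial_integrable[OF f] rapid_monomial_integrable[OF pdf]
  note smooth_measurable[OF rapid_smooth[OF f], measurable] smooth_measurable[OF rapid_smooth[OF pdf], measurable]
  have i1: "integrable lborel DG1" and i2: "integrable lborel DG2"
    unfolding DG1_def DG2_def using int by auto
  have "integral\<^sup>L lborel (\<lambda>x. DG1 x + DG2 x) = 0"
  proof -
    have "\<exists>K. \<forall>x. cmod (DG1 x) \<le> K * wt x"
    proof -
      have "\<exists>K. \<forall>x. cmod (of_real (monomial ks x) * pd i f x) \<le> K * wt x" for i
        using rapid_monomial_bound[OF pdf] by metis
      then obtain K where K: "\<And>i x. cmod (of_real (monomial ks x) * pd i f x) \<le> K i * wt x" by metis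
      have "cmod (DG1 x) \<le> (\<Sum>i\<in>UNIV. \<bar>v $ i\<bar> * K i) * wt x" for x
        unfolding DG1_def sum_distrib_right
        by (rule order_trans[OF norm_sum sum_mono]) (use K in \<open>auto simp: norm_mult mult.assoc intro!: mult_left_mono\<close>)
      then show ?thesis by blast
    qed
    moreover have "\<exists>K. \<forall>x. cmod (DG2 x) \<le> K * wt x"
    proof -
      have "\<exists>K. \<forall>x. cmod (of_real (monomial (monomial_omit ks r) x) * f x) \<le> K * wt x" for r
        using rapid_monomial_bound[OF f] by metis
      then obtain K where K: "\<And>r x. cmod (of_real (monomial (monomial_omit ks r) x) * f x) \<le> K r * wt x" by metis
      have "cmod (DG2 x) \<le> (\<Sum>r<length ks. \<bar>v $ (ks ! r)\<bar> * K r) * wt x" for x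
        unfolding DG2_def sum_distrib_right
        by (rule order_trans[OF norm_sum sum_mono]) (use K in \<open>auto simp: norm_mult mult.assoc intro!: mult_left_mono\<close>)
      then show ?thesis by blast
    qed
    ultimately obtain K1 K2 where K12: "\<And>x. cmod (DG1 x) \<le> K1 * wt x" "\<And>x. cmod (DG2 x) \<le> K2 * wt x"
      by blast
    have bd: "cmod (DG1 x + DG2 x) \<le> (K1 + K2) * wt x" for x
      using norm_triangle_mono[OF K12[of x]] by (simp add: algebra_simps)
    have der: "((\<lambda>t. G (x + t *\<^sub>R v)) has_vector_derivative DG1 x + DG2 x) (at 0)" for x
    proof -
      have m: "((\<lambda>t. complex_of_real (monomial ks (x + t *\<^sub>R v))) has_vector_derivative
          of_real (\<Sum>r<length ks. v $ (ks ! r) * monomial (monomial_omit ks r) x)) (at 0)"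
        by (rule bounded_linear.has_vector_derivative[OF bounded_linear_of_real])
           (simp add: monomial_line_derivative flip: has_real_derivative_iff_has_vector_derivative)
      have "((\<lambda>t. G (x + t *\<^sub>R v)) has_vector_derivative
         complex_of_real (monomial ks (x + 0 *\<^sub>R v)) * (\<Sum>i\<in>UNIV. of_real (v $ i) * pd i f (x + 0 *\<^sub>R v))
         + of_real (\<Sum>r<length ks. v $ (ks ! r) * monomial (monomial_omit ks r) x) * f (x + 0 *\<^sub>R v)) (at 0)"
        unfolding G_def
        by (rule has_vector_derivative_mult[OF m smooth_line_derivative[OF rapid_smooth[OF f]]])
      then show ?thesis
        by (simp add: DG1_def DG2_def sum_distrib_left sum_distrib_right mult_ac)
    qed
    have "G \<in> borel_measurable borel" "(\<lambda>x. DG1 x + DG2 x) \<in> borel_measurable borel"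
      unfolding G_def DG1_def DG2_def by measurable
    moreover have "integrable lborel G"
      unfolding G_def[abs_def] by (rule rapid_monomial_integrable[OF f])
    ultimately show ?thesis
      by (intro integral_directional_derivative[where G = G and K = "K1 + K2" and v = v] bd der)
  qed
  then have "integral\<^sup>L lborel DG1 = - integral\<^sup>L lborel DG2"
    using i1 i2 by (simp add: eq_neg_iff_add_eq_0)
  moreover have "integral\<^sup>L lborel DG1 = (\<Sum>i\<in>UNIV. of_real (v $ i) * (\<integral>x. of_real (monomial ks x) * pd i f x \<partial>lborel))"
    unfolding DG1_def using int by (subst Bochner_Integration.integral_sum) auto
  moreover have "integral\<^sup>L lborel DG2 = (\<Sum>r<length ks. of_real (v $ (ks ! r)) * (\<integral>x. of_real (monomial (monomial_omit ks r) x) * f x \<partial>lborel))"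
    unfolding DG2_def using int by (subst Bochner_Integration.integral_sum) auto
  ultimately show ?thesis by simp
qed

text \<open>Each integration by parts moves one derivative onto the monomial and removes one of its
  factors, which reappears as a coordinate of v. The n! counts the orders in which the n factors can
  be removed.\<close>

lemma integral_monomial_dirderiv:
  fixes f :: "real^'n::finite \<Rightarrow> complex"
  assumes f: "rapid f" and "length ks = n"
  shows "(\<Sum>js | length js = n. of_real (monomial js v) * (\<integral>x. of_real (monomial ks x) * pdl js f x \<partial>lborel))
    = (-1) ^ n * fact n * of_real (monomial ks v) * integral\<^sup>L lborel f"
  using assms(2)
proof (induction n arbitrary: ks)
  case (Suc n)
  let ?I = "\<lambda>ks js. \<integral>x. of_real (monomial ks x) * pdl js f x \<partial>lborel"
  have "(\<Sum>js | length js = Suc n. of_real (monomial js v) * ?I ks js)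
     = (\<Sum>js | length js = n. of_real (monomial js v) * (\<Sum>i\<in>UNIV. of_real (v $ i) * (\<integral>x. of_real (monomial ks x) * pd i (pdl js f) x \<partial>lborel)))"
    unfolding sum_length_Suc by (subst sum.swap) (simp add: sum_distrib_left mult_ac)
  also have "\<dots> = (\<Sum>js | length js = n. of_real (monomial js v) * (- (\<Sum>r<length ks. of_real (v $ (ks ! r)) * ?I (monomial_omit ks r) js)))"
    by (simp only: integration_by_parts_monomial[OF rapid_pdl[OF f]])
  also have "\<dots> = - (\<Sum>r<length ks. of_real (v $ (ks ! r)) * (\<Sum>js | length js = n. of_real (monomial js v) * ?I (monomial_omit ks r) js))"
    unfolding sum_distrib_left mult_minus_right sum_negf
    by (subst sum.swap) (simp add: mult_ac)
  also have "\<dots> = - (\<Sum>r<length ks. of_real (v $ (ks ! r)) * ((-1) ^ n * fact n * of_real (monomial (monomial_omit ks r) v) * integral\<^sup>L lborel f))"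
    using Suc by (intro arg_cong[where f = uminus] sum.cong) (simp_all add: length_monomial_omit)
  also have "\<dots> = - (\<Sum>r<length ks. (-1) ^ n * fact n * of_real (monomial ks v) * integral\<^sup>L lborel f)"
  proof (intro arg_cong[where f = uminus] sum.cong refl)
    fix r assume "r \<in> {..<length ks}"
    then have "complex_of_real (monomial ks v) = of_real (v $ (ks ! r)) * of_real (monomial (monomial_omit ks r) v)"
      by (simp flip: of_real_mult add: monomial_omit)
    then show "of_real (v $ (ks ! r)) * ((-1) ^ n * fact n * of_real (monomial (monomial_omit ks r) v) * integral\<^sup>L lborel f)
      = (-1) ^ n * fact n * of_real (monomial ks v) * integral\<^sup>L lborel f"
      by (simp add: mult_ac)
  qed
  also have "\<dots> = (-1) ^ Suc n * fact (Suc n) * of_real (monomial ks v) * integral\<^sup>L lborel f"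
    using Suc.prems by (simp add: algebra_simps)
  finally show ?case .
qed simp

section \<open>Closure properties of polynomially bounded functions\<close>

definition poly_bounded :: "(real^'n::finite \<Rightarrow> complex) \<Rightarrow> bool" where
  "poly_bounded f \<longleftrightarrow> (\<exists>N K. poly_bounded_by N K f)"

lemma poly_bounded_by_mono: "poly_bounded_by N K f \<Longrightarrow> N \<le> N' \<Longrightarrow> poly_bounded_by N' K f"
  unfolding poly_bounded_by_def
proof (elim conjE, intro conjI allI)
  fix y assume "N \<le> N'" "\<forall>y. cmod (f y) \<le> K * (1 + norm y) ^ N"
  moreover from this have "K \<ge> 0" by (auto dest!: spec[of _ 0] intro: order_trans[OF norm_ge_zero])
  ultimately show "cmod (f y) \<le> K * (1 + norm y) ^ N'"
    by (meson mult_left_mono order_trans power_increasing le_add_same_cancel1 norm_ge_zero)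
qed

lemma poly_bounded_add: "poly_bounded f \<Longrightarrow> poly_bounded g \<Longrightarrow> poly_bounded (\<lambda>y. f y + g y)"
proof -
  assume "poly_bounded f" "poly_bounded g"
  then obtain N K N' K' where "poly_bounded_by N K f" "poly_bounded_by N' K' g" by (auto simp: poly_bounded_def)
  then have f: "poly_bounded_by (max N N') K f" and g: "poly_bounded_by (max N N') K' g"
    by (auto intro: poly_bounded_by_mono)
  have "poly_bounded_by (max N N') (K + K') (\<lambda>y. f y + g y)"
    unfolding poly_bounded_by_def
  proof (intro conjI allI)
    show "(\<lambda>y. f y + g y) \<in> borel_measurable borel"
      using poly_bounded_by_measurable[OF f] poly_bounded_by_measurable[OF g] by measurable
    show "cmod (f y + g y) \<le> (K + K') * (1 + norm y) ^ max N N'" for y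
      using norm_triangle_mono[OF poly_bounded_byD[OF f] poly_bounded_byD[OF g], of y y] by (simp add: algebra_simps)
  qed
  then show ?thesis by (auto simp: poly_bounded_def)
qed

lemma poly_bounded_cmult: "poly_bounded f \<Longrightarrow> poly_bounded (\<lambda>y. c * f y)"
proof -
  assume "poly_bounded f"
  then obtain N K where f: "poly_bounded_by N K f" by (auto simp: poly_bounded_def)
  have "poly_bounded_by N (cmod c * K) (\<lambda>y. c * f y)"
    unfolding poly_bounded_by_def
  proof (intro conjI allI)
    show "(\<lambda>y. c * f y) \<in> borel_measurable borel"
      using poly_bounded_by_measurable[OF f] by measurable
    show "cmod (c * f y) \<le> cmod c * K * (1 + norm y) ^ N" for y
      using poly_bounded_byD[OF f, of y] by (simp add: norm_mult mult.assoc mult_left_mono)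
  qed
  then show ?thesis by (auto simp: poly_bounded_def)
qed

lemma poly_bounded_sum: "(\<And>i. i \<in> I \<Longrightarrow> poly_bounded (f i)) \<Longrightarrow> poly_bounded (\<lambda>y. \<Sum>i\<in>I. f i y)"
proof (induction I rule: infinite_finite_induct)
  case (infinite I)
  have "poly_bounded_by 0 0 (\<lambda>y. 0 :: complex)" by (simp add: poly_bounded_by_def)
  then show ?case using infinite by (auto simp: poly_bounded_def)
next
  case empty
  have "poly_bounded_by 0 0 (\<lambda>y. 0 :: complex)" by (simp add: poly_bounded_by_def)
  then show ?case by (auto simp: poly_bounded_def)
qed (auto intro: poly_bounded_add)

lemma poly_bounded_diff: "poly_bounded f \<Longrightarrow> poly_bounded g \<Longrightarrow> poly_bounded (\<lambda>y. f y - g y)"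
  using poly_bounded_add[of f "\<lambda>y. (-1) * g y"] poly_bounded_cmult[of g "-1"] by simp

lemma norm_diff_le_mult: "norm (y - u) \<le> (1 + norm u) * (1 + norm y)"
proof -
  have "norm (y - u) \<le> norm y + norm u" by (rule norm_triangle_ineq4)
  then show ?thesis
    by (simp add: algebra_simps) (smt (verit) mult_nonneg_nonneg norm_ge_zero)
qed

lemma poly_bounded_norm_power: "poly_bounded (\<lambda>y. of_real (norm (y - u) ^ b))"
proof -
  have "poly_bounded_by b ((1 + norm u) ^ b) (\<lambda>y. of_real (norm (y - u) ^ b))"
    unfolding poly_bounded_by_def
  proof (intro conjI allI)
    fix y
    show "cmod (of_real (norm (y - u) ^ b)) \<le> (1 + norm u) ^ b * (1 + norm y) ^ b"
      unfolding power_mult_distrib[symmetric] using norm_diff_le_mult[of y u] by (simp add: power_mono norm_power)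
  qed measurable
  then show ?thesis by (auto simp: poly_bounded_def)
qed

lemma poly_bounded_monomial: "poly_bounded (\<lambda>y. of_real (monomial js (y - u)))"
proof -
  have "poly_bounded_by (length js) ((1 + norm u) ^ length js) (\<lambda>y. of_real (monomial js (y - u)))"
    unfolding poly_bounded_by_def
  proof (intro conjI allI)
    fix y
    have "\<bar>monomial js (y - u)\<bar> \<le> ((1 + norm u) * (1 + norm y)) ^ length js"
      by (rule order_trans[OF monomial_le power_mono[OF norm_diff_le_mult]]) simp
    then show "cmod (of_real (monomial js (y - u))) \<le> (1 + norm u) ^ length js * (1 + norm y) ^ length js"
      by (simp add: power_mult_distrib)
  qed measurable
  then show ?thesis by (auto simp: poly_bounded_def)
qed

lemma poly_bounded_dirderiv: "poly_bounded (\<lambda>y. dirderiv n f x (y - u))"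
  unfolding dirderiv_def mult.commute[of "complex_of_real _"] by (intro poly_bounded_sum poly_bounded_cmult poly_bounded_monomial)

lemma poly_bounded_taylor_poly: "poly_bounded (taylor_poly n f x)"
proof -
  have "taylor_poly n f x = (\<lambda>y. \<Sum>j\<le>n. (1 / fact j) * dirderiv j f x (y - x))"
    by (simp add: taylor_poly_def fun_eq_iff)
  then show ?thesis by (simp only:) (intro poly_bounded_sum poly_bounded_cmult poly_bounded_dirderiv)
qed

lemma bounded_imp_poly_bounded: "f \<in> borel_measurable borel \<Longrightarrow> (\<And>y. cmod (f y) \<le> K) \<Longrightarrow> poly_bounded f"
  unfolding poly_bounded_def by (intro exI[of _ 0] exI[of _ K]) (simp add: poly_bounded_by_def)

section \<open>Decay, periodicity and moments of the kernel\<close>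

context gs_kernel
begin

lemma rapid_phi: "rapid \<phi>"
  unfolding rapid_def using smooth decay_N by blast

lemma poly_bounded_integrable_Q: "poly_bounded f \<Longrightarrow> integrable lborel (\<lambda>y. f y * q0 \<phi> x y)"
  unfolding poly_bounded_def using integrable_Q by blast

lemma Q_add: "poly_bounded f \<Longrightarrow> poly_bounded g \<Longrightarrow> Q (\<lambda>y. f y + g y) x = Q f x + Q g x"
  unfolding Q_def by (simp add: distrib_right poly_bounded_integrable_Q)

lemma Q_cmult: "Q (\<lambda>y. c * f y) x = c * Q f x"
  unfolding Q_def by (simp add: mult.assoc)

lemma Q_diff: "poly_bounded f \<Longrightarrow> poly_bounded g \<Longrightarrow> Q (\<lambda>y. f y - g y) x = Q f x - Q g x"
  unfolding Q_def by (simp add: left_diff_distrib poly_bounded_integrable_Q)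

lemma Q_sum: "(\<And>i. i \<in> I \<Longrightarrow> poly_bounded (f i)) \<Longrightarrow> Q (\<lambda>y. \<Sum>i\<in>I. f i y) x = (\<Sum>i\<in>I. Q (f i) x)"
  unfolding Q_def sum_distrib_right by (rule Bochner_Integration.integral_sum) (auto intro: poly_bounded_integrable_Q)

definition kernel_const :: "nat \<Rightarrow> real" where
  "kernel_const N = D (CARD('n) + 2 + N) * D (CARD('n) + 2 + N) * wt_sum TYPE('n)"

lemma kernel_const_nonneg: "kernel_const N \<ge> 0"
  unfolding kernel_const_def by (intro mult_nonneg_nonneg D_nonneg wt_sum_nonneg)

text \<open>Through the lattice point, 1 + norm (y - x) is at most the product of the same
  expressions for \<open>x - lat n\<close> and \<open>y - lat n\<close>, so the two copies of \<phi>
  share the cost. One copy keeps a weight for the sum over n, and d + 2 surplus powers produce the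
  weight in y - x.\<close>

lemma q0_decay: "(1 + norm (y - x)) ^ N * cmod (q0 \<phi> x y) \<le> kernel_const N * wt (y - x)"
proof -
  define M where "M = CARD('n) + 2 + N"
  have trm: "(1 + norm (y - x)) ^ M * cmod (\<phi> (x - lat n) * cnj (\<phi> (y - lat n))) \<le> D M * D M * wt (x - lat n)" for n
  proof -
    have "(1 + norm (y - x)) ^ M \<le> (1 + norm (x - lat n)) ^ M * (1 + norm (y - lat n)) ^ M"
    proof -
      have "(1 + norm (y - x)) ^ M \<le> (1 + norm (- (x - lat n))) ^ M * (1 + norm (y - x - - (x - lat n))) ^ M"
        by (rule one_plus_norm_power_le)
      then show ?thesis by (simp add: norm_minus_commute algebra_simps)
    qed
    then have "(1 + norm (y - x)) ^ M * cmod (\<phi> (x - lat n) * cnj (\<phi> (y - lat n)))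
       \<le> ((1 + norm (x - lat n)) ^ M * (1 + norm (y - lat n)) ^ M) * cmod (\<phi> (x - lat n) * cnj (\<phi> (y - lat n)))"
      by (rule mult_right_mono) simp
    also have "\<dots> = ((1 + norm (x - lat n)) ^ M * cmod (\<phi> (x - lat n))) * ((1 + norm (y - lat n)) ^ M * cmod (\<phi> (y - lat n)))"
      by (simp add: norm_mult mult_ac)
    also have "\<dots> \<le> (D M * wt (x - lat n)) * (D M * 1)"
    proof (rule mult_mono[OF phi_N])
      show "(1 + norm (y - lat n)) ^ M * cmod (\<phi> (y - lat n)) \<le> D M * 1"
        by (rule order_trans[OF phi_N]) (intro mult_left_mono wt_le_1 D_nonneg)
      show "0 \<le> D M * wt (x - lat n)"
        by (intro mult_nonneg_nonneg D_nonneg less_imp_le[OF wt_pos])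
    qed simp
    finally show ?thesis by (simp add: mult_ac)
  qed
  have "(1 + norm (y - x)) ^ M * cmod (q0 \<phi> x y) \<le> (1 + norm (y - x)) ^ M * (\<Sum>n. cmod (\<phi> (x - lat n) * cnj (\<phi> (y - lat n))))"
    unfolding q0_eq by (intro mult_left_mono summable_norm summable_q0) auto
  also have "\<dots> = (\<Sum>n. (1 + norm (y - x)) ^ M * cmod (\<phi> (x - lat n) * cnj (\<phi> (y - lat n))))"
    by (rule suminf_mult[symmetric, OF summable_q0])
  also have "\<dots> \<le> (\<Sum>n. D M * D M * wt (x - lat n))"
    by (intro suminf_le trm summable_mult summable_wt summable_q0)
  also have "\<dots> = D M * D M * (\<Sum>n. wt (x - lat n))"
    by (rule suminf_mult[OF summable_wt])
  also have "\<dots> \<le> kernel_const N"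
    unfolding kernel_const_def M_def[symmetric] using D_nonneg[of M] by (intro mult_left_mono suminf_wt_le) auto
  finally have "(1 + norm (y - x)) ^ M * cmod (q0 \<phi> x y) \<le> kernel_const N" .
  moreover have "(1 + norm (y - x)) ^ M * cmod (q0 \<phi> x y) = ((1 + norm (y - x)) ^ N * cmod (q0 \<phi> x y)) / wt (y - x)"
    by (simp add: M_def wt_def power_add)
  ultimately show ?thesis
    using wt_pos[of "y - x"] by (simp add: pos_divide_le_eq)
qed

lemma q0_measurable [measurable]: "q0 \<phi> x \<in> borel_measurable borel"
proof -
  have "poly_bounded (\<lambda>y. 1)" by (rule bounded_imp_poly_bounded[where K = 1]) auto
  from poly_bounded_integrable_Q[OF this, of x] show ?thesis by auto
qed

lemma integrable_norm_q0: "integrable lborel (\<lambda>y. norm (y - x) ^ b * cmod (q0 \<phi> x y))"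
  using integrable_norm[OF poly_bounded_integrable_Q[OF poly_bounded_norm_power[of x b], of x]] by (simp add: norm_mult norm_power)

lemma integral_norm_q0: "(\<integral>y. norm (y - x) ^ b * cmod (q0 \<phi> x y) \<partial>lborel) \<le> kernel_const b * wt_integral TYPE('n)"
proof -
  have "(\<integral>y. norm (y - x) ^ b * cmod (q0 \<phi> x y) \<partial>lborel) \<le> (\<integral>y. kernel_const b * wt (y - x) \<partial>lborel)"
  proof (intro integral_mono integrable_norm_q0 integrable_mult_right integrable_wt_shift)
    fix y
    have "norm (y - x) ^ b * cmod (q0 \<phi> x y) \<le> (1 + norm (y - x)) ^ b * cmod (q0 \<phi> x y)"
      by (intro mult_right_mono power_mono) auto
    then show "norm (y - x) ^ b * cmod (q0 \<phi> x y) \<le> kernel_const b * wt (y - x)"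
      using q0_decay[of y x b] by linarith
  qed
  then show ?thesis by (simp add: integral_wt_shift)
qed

lemma q0_periodic:
  assumes k: "k \<in> lattice"
  shows "q0 \<phi> (x + k) (y + k) = q0 \<phi> x y"
proof -
  have bij: "bij_betw (\<lambda>l. l - k) lattice (lattice :: (real^'n) set)"
    by (rule bij_betw_byWitness[where f' = "\<lambda>l. l + k"]) (auto intro: lattice_add lattice_diff k)
  show ?thesis
    unfolding q0_def using infsum_reindex_bij_betw[OF bij, of "\<lambda>l. \<phi> (x - l) * cnj (\<phi> (y - l))"]
    by (simp add: algebra_simps)
qed

text \<open>The moment of the kernel in its second variable, centred at its first variable u. That
  it is 1 for the empty list and 0 otherwise says that \<open>Q\<close> reproduces all
  polynomials.\<close>

definition moment :: "'n list \<Rightarrow> real^'n \<Rightarrow> complex" where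
  "moment js u = Q (\<lambda>y. of_real (monomial js (y - u))) u"

lemma moment_periodic:
  assumes k: "k \<in> lattice"
  shows "moment js (u + k) = moment js u"
proof -
  have "moment js (u + k) = (\<integral>y. of_real (monomial js (y - (u + k))) * q0 \<phi> (u + k) y \<partial>lborel)"
    by (simp add: moment_def Q_def)
  also have "\<dots> = (\<integral>y. of_real (monomial js (k + 1 *\<^sub>R y - (u + k))) * q0 \<phi> (u + k) (k + 1 *\<^sub>R y) \<partial>lborel)"
    by (subst lborel_integral_affine[of _ 1 k]) simp_all
  also have "\<dots> = (\<integral>y. of_real (monomial js (y - u)) * q0 \<phi> u y \<partial>lborel)"
    using q0_periodic[OF k] by (simp add: add.commute[of k])
  finally show ?thesis by (simp add: moment_def Q_def)
qed

lemma Q_dirderiv: "Q (\<lambda>y. dirderiv n f x (y - u)) u = (\<Sum>js | length js = n. pdl js f x * moment js u)"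
  unfolding dirderiv_def moment_def mult.commute[of "complex_of_real _"]
  by (subst Q_sum) (simp_all add: poly_bounded_cmult poly_bounded_monomial Q_cmult)

lemma Q_taylor_poly: "Q (taylor_poly n f x) x = (\<Sum>j\<le>n. (1 / fact j) * (\<Sum>js | length js = j. pdl js f x * moment js x))"
proof -
  have "taylor_poly n f x = (\<lambda>y. \<Sum>j\<le>n. (1 / fact j) * dirderiv j f x (y - x))"
    by (simp add: taylor_poly_def fun_eq_iff)
  then show ?thesis
    by (simp only: Q_sum[OF poly_bounded_cmult[OF poly_bounded_dirderiv]] Q_cmult Q_dirderiv)
qed

end

section \<open>Reproduction of polynomials\<close>

lemma LIMSEQ_divide_power2_zero: "(\<lambda>m. c / 2 ^ m :: real) \<longlonglongrightarrow> 0"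
  using tendsto_mult_right[OF LIMSEQ_inverse_realpow_zero[of 2], of c] by (simp add: divide_inverse mult.commute)

text \<open>Inclusions lead from V 0 up to V m, and m halvings of the argument lead back down to V
  0.\<close>

lemma MRA_dilate:
  fixes V :: "int \<Rightarrow> (real^'n::finite \<Rightarrow> complex) set"
  assumes V: "MRA V" and f: "f \<in> V 0"
  shows "(\<lambda>x. f ((1 / 2 ^ m) *\<^sub>R x)) \<in> V 0"
proof -
  have inc: "V i \<subseteq> V (i + 1)" for i using V by (simp add: MRA_def)
  have dil: "g \<in> V i \<longleftrightarrow> (\<lambda>x. g (2 *\<^sub>R x)) \<in> V (i + 1)" for i g using V by (simp add: MRA_def)
  have fm: "f \<in> V (int m)" for m
  proof (induction m)
    case (Suc m)
    then show ?case using inc[of "int m"] by (auto simp: add.commute)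
  qed (simp add: f)
  have "(\<lambda>x. f ((1 / 2 ^ j) *\<^sub>R x)) \<in> V (int m - int j)" for j
  proof (induction j)
    case (Suc j)
    have "(\<lambda>x. f ((1 / 2 ^ Suc j) *\<^sub>R (2 *\<^sub>R x))) \<in> V (int m - int (Suc j) + 1)"
      using Suc by simp
    then show ?case
      by (subst dil)
  qed (simp add: fm)
  from this[of m] show ?thesis by simp
qed

lemma sum_in_closed_subspace:
  assumes W: "closed_subspace_L2 W" and "finite N" "\<And>k. k \<in> N \<Longrightarrow> f k \<in> W"
  shows "(\<lambda>x. \<Sum>k\<in>N. c k * f k x) \<in> W"
  using assms(2,3)
proof (induction N)
  case empty
  then show ?case using W by (simp add: closed_subspace_L2_def)
next
  case (insert k N)
  have lin: "\<forall>f\<in>W. \<forall>g\<in>W. \<forall>a b. (\<lambda>x. a * f x + b * g x) \<in> W"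
    using W by (simp add: closed_subspace_L2_def)
  have "f k \<in> W" "(\<lambda>x. \<Sum>k\<in>N. c k * f k x) \<in> W"
    using insert by auto
  then have "(\<lambda>x. c k * f k x + 1 * (\<Sum>k\<in>N. c k * f k x)) \<in> W"
    using lin[rule_format, of "f k" "\<lambda>x. \<Sum>k\<in>N. c k * f k x" "c k" 1] by blast
  then show ?case using insert by simp
qed

lemma (in gs_kernel) Q_reproduces_shift:
  assumes orth: "\<And>n k. n \<in> lattice \<Longrightarrow> k \<in> lattice \<Longrightarrow> l2_inner (\<lambda>x. \<phi> (x - n)) (\<lambda>x. \<phi> (x - k)) = (if n = k then 1 else 0)"
    and k: "k \<in> lattice"
  shows "Q (\<lambda>y. \<phi> (y - k)) x = \<phi> (x - k)"
proof -
  obtain n0 where n0: "lat n0 = k"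
    using bij_lat k by (metis bij_betw_imp_surj_on imageE)
  have "(\<lambda>y. \<phi> (y - k)) \<in> borel_measurable borel" by measurable
  then have "poly_bounded_by 0 (D 0) (\<lambda>y. \<phi> (y - k))"
    using phi_bounded by (simp add: poly_bounded_by_def)
  then have "Q (\<lambda>y. \<phi> (y - k)) x = lattice_series (coeff (\<lambda>y. \<phi> (y - k))) x"
    by (rule Q_eq_lattice_series)
  also have "coeff (\<lambda>y. \<phi> (y - k)) = (\<lambda>n. if n = n0 then 1 else 0)"
  proof
    fix n
    have "coeff (\<lambda>y. \<phi> (y - k)) n = (if k = lat n then 1 else 0)"
      using orth[OF k, of "lat n"] by (simp add: coeff_def l2_inner_def)
    also have "k = lat n \<longleftrightarrow> n = n0"
      using n0 inj_lat by (auto dest: injD)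
    finally show "coeff (\<lambda>y. \<phi> (y - k)) n = (if n = n0 then 1 else 0)" .
  qed
  also have "lattice_series (\<lambda>n. if n = n0 then 1 else 0) x = (\<Sum>n. if n = n0 then \<phi> (x - lat n) else 0)"
    unfolding lattice_series_def by (intro arg_cong[where f = suminf]) auto
  also have "\<dots> = \<phi> (x - k)"
    using sums_unique[OF sums_single[of n0 "\<lambda>n. \<phi> (x - lat n)"]] n0 by simp
  finally show ?thesis .
qed

text \<open>Approximation by translates holds only in the mean, while the identity is pointwise. A
  finite combination p of translates is reproduced exactly, Q f - p = Q (f - p) is uniformly small
  because the kernel is square integrable uniformly in its first variable, and f - p is small in the
  mean.\<close>

lemma (in gs_kernel) Q_reproduces:
  assumes orth: "\<And>n k. n \<in> lattice \<Longrightarrow> k \<in> lattice \<Longrightarrow> l2_inner (\<lambda>x. \<phi> (x - n)) (\<lambda>x. \<phi> (x - k)) = (if n = k then 1 else 0)"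
    and W: "closed_subspace_L2 W" "\<And>n. n \<in> lattice \<Longrightarrow> (\<lambda>x. \<phi> (x - n)) \<in> W"
    and f: "f \<in> W" "continuous_on UNIV f" "\<And>x. cmod (f x) \<le> K"
    and approx: "\<And>\<epsilon>. \<epsilon> > 0 \<Longrightarrow> \<exists>N c. finite N \<and> N \<subseteq> lattice \<and> l2_norm (\<lambda>x. f x - (\<Sum>n\<in>N. c n * \<phi> (x - n))) < \<epsilon>"
  shows "Q f x = f x"
proof (rule ccontr)
  assume ne: "Q f x \<noteq> f x"
  define r where "r y = cmod (Q f y - f y)" for y
  have mf [measurable]: "f \<in> borel_measurable borel"
    by (rule borel_measurable_continuous_onI[OF f(2)])
  have pbf: "poly_bounded_by 0 K f" using f(3) by (simp add: poly_bounded_by_def)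
  have "continuous_on UNIV (\<lambda>y. Q f y - f y)"
    by (intro continuous_intros smooth_continuous[OF smooth_Q[OF pbf]] f)
  then have "isCont r x"
    unfolding r_def by (simp add: continuous_on_eq_continuous_at)
  \<comment> \<open>If the identity fails at x, then by continuity the defect is at least \<eta> on
    a whole ball around x.\<close>
  define \<eta> where "\<eta> = r x / 2"
  have \<eta>: "\<eta> > 0" using ne by (simp add: \<eta>_def r_def)
  obtain d where d: "d > 0" "\<And>y. dist y x < d \<Longrightarrow> dist (r y) (r x) < \<eta>"
    using \<open>isCont r x\<close> \<eta> unfolding continuous_at_eps_delta by blast
  have r_ge: "\<eta> \<le> r y" if "y \<in> ball x d" for y
  proof -
    have "dist (r y) (r x) < \<eta>" using d(2)[of y] that by (simp add: dist_commute)
    then show ?thesis unfolding dist_real_def \<eta>_def by linarith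
  qed
  define vol where "vol = measure lborel (ball x d)"
  have vol: "vol > 0"
    unfolding vol_def using d(1) by (simp add: content_ball_pos)
  \<comment> \<open>A bound for the integral of |q0|^2 over the second variable: the supremum of the
    kernel times its L1 bound.\<close>
  define B where "B = D 0 * D 0 * wt_sum TYPE('n) * (kernel_const 0 * wt_integral TYPE('n))"
  have B: "B \<ge> 0" unfolding B_def
    by (intro mult_nonneg_nonneg D_nonneg wt_sum_nonneg kernel_const_nonneg wt_integral_nonneg)
  have sq2: "(a + b)\<^sup>2 \<le> 2 * a\<^sup>2 + 2 * b\<^sup>2" for a b :: real
    using zero_le_power2[of "a - b"] by (simp add: power2_eq_square algebra_simps)
  \<comment> \<open>The square of the defect is integrated over the ball. The left side does not
    depend on \<epsilon>, while the right side is of order \<epsilon>^2.\<close>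
  have main: "\<eta>\<^sup>2 * vol \<le> 2 * (\<epsilon> * (1 + B) / 2)\<^sup>2 * vol + 2 * \<epsilon>\<^sup>2" if \<epsilon>: "\<epsilon> > 0" for \<epsilon>
  proof -
    obtain N c where N: "finite N" "N \<subseteq> lattice" "l2_norm (\<lambda>x. f x - (\<Sum>n\<in>N. c n * \<phi> (x - n))) < \<epsilon>"
      using approx[OF \<epsilon>] by blast
    define p where "p x = (\<Sum>n\<in>N. c n * \<phi> (x - n))" for x
    have pW: "p \<in> W" unfolding p_def[abs_def]
      by (rule sum_in_closed_subspace[OF W(1) N(1)]) (use N W in auto)
    have "(\<lambda>x. 1 * f x + (-1) * p x) \<in> W"
      using W(1) f(1) pW unfolding closed_subspace_L2_def by blast
    then have "(\<lambda>x. f x - p x) \<in> L2"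
      using W(1) by (auto simp: closed_subspace_L2_def)
    then have i2: "integrable lborel (\<lambda>x. (cmod (f x - p x))\<^sup>2)" by (simp add: L2_def)
    have l2: "(\<integral>y. (cmod (f y - p y))\<^sup>2 \<partial>lborel) \<le> \<epsilon>\<^sup>2"
    proof -
      have "sqrt (\<integral>y. (cmod (f y - p y))\<^sup>2 \<partial>lborel) < \<epsilon>"
        using N(3) by (simp add: l2_norm_def p_def)
      then show ?thesis
        using \<epsilon> by (meson less_imp_le real_sqrt_le_iff sqrt_le_D)
    qed
    have [measurable]: "p \<in> borel_measurable borel"
      unfolding p_def[abs_def] by measurable
    have pbs: "poly_bounded (\<lambda>y. c k * \<phi> (y - k))" for k
    proof (intro poly_bounded_cmult bounded_imp_poly_bounded)
      show "cmod (\<phi> (y - k)) \<le> D 0" for y by (rule phi_bounded)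
    qed measurable
    have pbp: "poly_bounded p"
      unfolding p_def[abs_def] by (rule poly_bounded_sum[OF pbs])
    have Qp: "Q p y = p y" for y
    proof -
      have "Q p y = (\<Sum>k\<in>N. Q (\<lambda>y. c k * \<phi> (y - k)) y)"
        unfolding p_def[abs_def] by (rule Q_sum[OF pbs])
      also have "\<dots> = p y"
        unfolding p_def Q_cmult using N(2) by (intro sum.cong refl arg_cong2[where f = "(*)"] Q_reproduces_shift orth) auto
      finally show ?thesis .
    qed
    have pbf': "poly_bounded f" using pbf by (auto simp: poly_bounded_def)
    have close: "cmod (Q f y - p y) \<le> \<epsilon> * (1 + B) / 2" for y
    proof -
      have iq: "integrable lborel (\<lambda>z. (cmod (q0 \<phi> y z))\<^sup>2)"
      proof (rule Bochner_Integration.integrable_bound)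
        show "integrable lborel (\<lambda>z. D 0 * D 0 * wt_sum TYPE('n) * (norm (z - y) ^ 0 * cmod (q0 \<phi> y z)))"
          by (intro integrable_mult_right integrable_norm_q0)
        show "AE z in lborel. norm ((cmod (q0 \<phi> y z))\<^sup>2) \<le> norm (D 0 * D 0 * wt_sum TYPE('n) * (norm (z - y) ^ 0 * cmod (q0 \<phi> y z)))"
        proof (rule AE_I2)
          fix z
          have "(cmod (q0 \<phi> y z))\<^sup>2 \<le> D 0 * D 0 * wt_sum TYPE('n) * (norm (z - y) ^ 0 * cmod (q0 \<phi> y z))"
            using q0_bound[of y z] by (simp add: power2_eq_square mult_right_mono)
          then show "norm ((cmod (q0 \<phi> y z))\<^sup>2) \<le> norm (D 0 * D 0 * wt_sum TYPE('n) * (norm (z - y) ^ 0 * cmod (q0 \<phi> y z)))"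
            by simp
        qed
      qed measurable
      have iqb: "(\<integral>z. (cmod (q0 \<phi> y z))\<^sup>2 \<partial>lborel) \<le> B"
      proof -
        have "(\<integral>z. (cmod (q0 \<phi> y z))\<^sup>2 \<partial>lborel) \<le> (\<integral>z. D 0 * D 0 * wt_sum TYPE('n) * (norm (z - y) ^ 0 * cmod (q0 \<phi> y z)) \<partial>lborel)"
          by (intro integral_mono iq integrable_mult_right integrable_norm_q0)
             (use q0_bound[of y] in \<open>auto simp: power2_eq_square intro!: mult_right_mono\<close>)
        also have "\<dots> = D 0 * D 0 * wt_sum TYPE('n) * (\<integral>z. norm (z - y) ^ 0 * cmod (q0 \<phi> y z) \<partial>lborel)"
          by simp
        also have "\<dots> \<le> B"
          unfolding B_def by (intro mult_left_mono integral_norm_q0 mult_nonneg_nonneg D_nonneg wt_sum_nonneg)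
        finally show ?thesis .
      qed
      have "Q f y - p y = Q (\<lambda>z. f z - p z) y"
        using Q_diff[OF pbf' pbp, of y] Qp by simp
      also have "cmod \<dots> \<le> (\<integral>z. cmod ((f z - p z) * q0 \<phi> y z) \<partial>lborel)"
        unfolding Q_def by (rule integral_norm_bound)
      \<comment> \<open>The inequality a b \<le> a^2/(2\<epsilon>) + \<epsilon> b^2/2 stands in for
        Cauchy-Schwarz; as the integral of a^2 is at most \<epsilon>^2, both terms are of order
        \<epsilon>.\<close>
      also have "\<dots> \<le> (\<integral>z. (1 / (2 * \<epsilon>)) * (cmod (f z - p z))\<^sup>2 + (\<epsilon> / 2) * (cmod (q0 \<phi> y z))\<^sup>2 \<partial>lborel)"
      proof (rule integral_mono)
        show "integrable lborel (\<lambda>z. cmod ((f z - p z) * q0 \<phi> y z))"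
          by (intro integrable_norm poly_bounded_integrable_Q poly_bounded_diff pbf' pbp)
        show "integrable lborel (\<lambda>z. (1 / (2 * \<epsilon>)) * (cmod (f z - p z))\<^sup>2 + (\<epsilon> / 2) * (cmod (q0 \<phi> y z))\<^sup>2)"
          by (intro Bochner_Integration.integrable_add integrable_mult_right i2 iq)
        fix z
        let ?a = "cmod (f z - p z)" and ?b = "cmod (q0 \<phi> y z)"
        have "0 \<le> (?a - \<epsilon> * ?b)\<^sup>2" by simp
        then have "2 * \<epsilon> * (?a * ?b) \<le> ?a\<^sup>2 + \<epsilon>\<^sup>2 * ?b\<^sup>2"
          by (simp add: power2_eq_square algebra_simps)
        then have "?a * ?b \<le> (?a\<^sup>2 + \<epsilon>\<^sup>2 * ?b\<^sup>2) / (2 * \<epsilon>)"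
          using \<epsilon> by (simp add: pos_le_divide_eq mult_ac)
        also have "\<dots> = (1 / (2 * \<epsilon>)) * ?a\<^sup>2 + (\<epsilon> / 2) * ?b\<^sup>2"
          using \<epsilon> by (simp add: field_simps power2_eq_square)
        finally show "cmod ((f z - p z) * q0 \<phi> y z) \<le> (1 / (2 * \<epsilon>)) * ?a\<^sup>2 + (\<epsilon> / 2) * ?b\<^sup>2"
          by (simp add: norm_mult)
      qed
      also have "\<dots> = (1 / (2 * \<epsilon>)) * (\<integral>z. (cmod (f z - p z))\<^sup>2 \<partial>lborel) + (\<epsilon> / 2) * (\<integral>z. (cmod (q0 \<phi> y z))\<^sup>2 \<partial>lborel)"
        using i2 iq by simp
      also have "\<dots> \<le> (1 / (2 * \<epsilon>)) * \<epsilon>\<^sup>2 + (\<epsilon> / 2) * B"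
        using \<epsilon> by (intro add_mono mult_left_mono l2 iqb) auto
      also have "\<dots> = \<epsilon> * (1 + B) / 2"
        using \<epsilon> by (simp add: field_simps power2_eq_square)
      finally show ?thesis .
    qed
    have ib: "integrable lborel (indicator (ball x d) :: _ \<Rightarrow> real)"
      by (intro integrable_real_indicator emeasure_lborel_ball_finite) simp
    have "\<eta>\<^sup>2 * vol = (\<integral>y. \<eta>\<^sup>2 * indicator (ball x d) y \<partial>lborel)"
      by (simp add: vol_def)
    also have "\<dots> \<le> (\<integral>y. 2 * (\<epsilon> * (1 + B) / 2)\<^sup>2 * indicator (ball x d) y + 2 * (cmod (f y - p y))\<^sup>2 \<partial>lborel)"
    proof (rule integral_mono)
      show "integrable lborel (\<lambda>y. \<eta>\<^sup>2 * indicator (ball x d) y)"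
        by (intro integrable_mult_right ib)
      show "integrable lborel (\<lambda>y. 2 * (\<epsilon> * (1 + B) / 2)\<^sup>2 * indicator (ball x d) y + 2 * (cmod (f y - p y))\<^sup>2)"
        by (intro Bochner_Integration.integrable_add integrable_mult_right ib i2)
      fix y
      show "\<eta>\<^sup>2 * indicator (ball x d) y \<le> 2 * (\<epsilon> * (1 + B) / 2)\<^sup>2 * indicator (ball x d) y + 2 * (cmod (f y - p y))\<^sup>2"
      proof (cases "y \<in> ball x d")
        case True
        have "\<eta> \<le> cmod ((Q f y - p y) - (f y - p y))"
          using r_ge[OF True] by (simp add: r_def)
        also have "\<dots> \<le> \<epsilon> * (1 + B) / 2 + cmod (f y - p y)"
          by (rule order_trans[OF norm_triangle_ineq4 add_right_mono[OF close]])
        finally have "\<eta>\<^sup>2 \<le> (\<epsilon> * (1 + B) / 2 + cmod (f y - p y))\<^sup>2"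
          using \<eta> by (intro power_mono) auto
        also have "\<dots> \<le> 2 * (\<epsilon> * (1 + B) / 2)\<^sup>2 + 2 * (cmod (f y - p y))\<^sup>2"
          by (rule sq2)
        finally show ?thesis using True by simp
      qed simp
    qed
    also have "\<dots> = 2 * (\<epsilon> * (1 + B) / 2)\<^sup>2 * vol + 2 * (\<integral>y. (cmod (f y - p y))\<^sup>2 \<partial>lborel)"
      using i2 ib by (simp add: vol_def)
    also have "\<dots> \<le> 2 * (\<epsilon> * (1 + B) / 2)\<^sup>2 * vol + 2 * \<epsilon>\<^sup>2"
      using l2 by simp
    finally show ?thesis .
  qed
  have "((\<lambda>\<epsilon>. 2 * (\<epsilon> * (1 + B) / 2)\<^sup>2 * vol + 2 * \<epsilon>\<^sup>2) \<longlongrightarrow> 2 * (0 * (1 + B) / 2)\<^sup>2 * vol + 2 * 0\<^sup>2) (at_right 0)"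
    by (intro tendsto_intros) auto
  then have "\<eta>\<^sup>2 * vol \<le> 2 * (0 * (1 + B) / 2)\<^sup>2 * vol + 2 * 0\<^sup>2"
  proof (rule tendsto_lowerbound)
    show "\<forall>\<^sub>F \<epsilon> in at_right 0. \<eta>\<^sup>2 * vol \<le> 2 * (\<epsilon> * (1 + B) / 2)\<^sup>2 * vol + 2 * \<epsilon>\<^sup>2"
      using eventually_at_right_less by eventually_elim (rule main)
  qed simp
  moreover have "\<eta>\<^sup>2 * vol > 0" using \<eta> vol by simp
  ultimately show False by simp
qed

context gs_kernel
begin

context
  assumes repro: "\<And>m x. Q (\<lambda>x. \<phi> ((1 / 2 ^ m) *\<^sub>R x)) x = \<phi> ((1 / 2 ^ m) *\<^sub>R x)"
begin

text \<open>In the Taylor expansion of \<phi> (c x), c = 2^(-m), at u + k the induction hypothesis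
  removes all orders below n, the order n scales as c^n and the remainder as c^(n+1). Dividing by
  c^n leaves a bound of order c that is uniform in k.\<close>

lemma moment_step_bound:
  assumes IH: "\<And>js. length js < n \<Longrightarrow> moment js u = (if js = [] then 1 else 0)"
  shows "\<exists>B. \<forall>m k. k \<in> lattice \<longrightarrow>
    cmod (\<Sum>js | length js = n. pdl js \<phi> ((1 / 2 ^ m) *\<^sub>R (u + k)) * (moment js u - (if js = [] then 1 else 0))) \<le> B / 2 ^ m"
proof -
  define B0 where "B0 = D 0 * gs_weight \<rho>1 \<rho>2 A2 0 (Suc n)"
  have B0: "cmod (pdl js \<phi> x) \<le> B0" if "length js = Suc n" for js x
  proof -
    have "cmod (pdl js \<phi> x) \<le> B0 * wt x"
      using decay_a[of x 0 js] that by (simp add: B0_def)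
    also have "\<dots> \<le> B0 * 1"
      unfolding B0_def by (intro mult_left_mono wt_le_1 mult_nonneg_nonneg D_nonneg gs_weight_A2_nonneg)
    finally show ?thesis by simp
  qed
  \<comment> \<open>The dimension factor of the remainder, the bound for derivatives of order n + 1,
    and the absolute moment of order n + 1 of the kernel; none of them depends on m or k.\<close>
  define B1 where "B1 = real CARD('n) ^ Suc n * B0 * (kernel_const (Suc n) * wt_integral TYPE('n))"
  have "cmod (\<Sum>js | length js = n. pdl js \<phi> ((1 / 2 ^ m) *\<^sub>R (u + k)) * (moment js u - (if js = [] then 1 else 0))) \<le> B1 / 2 ^ m"
    if k: "k \<in> lattice" for m k
  proof -
    define c :: real where "c = 1 / 2 ^ m"
    have c: "c > 0" by (simp add: c_def)
    define X where "X = u + k"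
    define \<Phi> where "\<Phi> x = \<phi> (c *\<^sub>R x)" for x
    have \<Phi>: "smooth_fun \<Phi>" "pdl js \<Phi> x = of_real c ^ length js * pdl js \<phi> (c *\<^sub>R x)" for js x
      using smooth_affine[OF smooth, where c = c and b = 0] unfolding \<Phi>_def[abs_def] by simp_all
    have pbP: "poly_bounded \<Phi>"
    proof (rule bounded_imp_poly_bounded)
      show "\<Phi> \<in> borel_measurable borel" by (rule smooth_measurable[OF \<Phi>(1)])
      show "cmod (\<Phi> x) \<le> D 0" for x
        unfolding \<Phi>_def by (rule phi_bounded)
    qed
    let ?\<delta> = "\<lambda>js. if js = [] then 1 else 0 :: complex"
    have moment: "moment js X = moment js u" for js
      unfolding X_def by (rule moment_periodic[OF k])
    define S where "S = (\<Sum>js | length js = n. pdl js \<phi> (c *\<^sub>R X) * (moment js u - ?\<delta> js))"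
    have "\<Phi> X = taylor_poly n \<Phi> X X" by (simp add: taylor_poly_self)
    also have "\<dots> = (\<Sum>j\<le>n. (1 / fact j) * (\<Sum>js | length js = j. pdl js \<Phi> X * ?\<delta> js))"
    proof -
      have "complex_of_real (monomial js 0) = ?\<delta> js" for js :: "'n list"
        by (cases js) auto
      then show ?thesis by (simp add: taylor_poly_def dirderiv_def mult.commute)
    qed
    finally have 1: "Q (taylor_poly n \<Phi> X) X - \<Phi> X = (\<Sum>j\<le>n. (1 / fact j) * (\<Sum>js | length js = j. pdl js \<Phi> X * (moment js u - ?\<delta> js)))"
      unfolding Q_taylor_poly moment by (simp add: right_diff_distrib sum_subtractf)
    \<comment> \<open>For j < n every factor \<open>moment js u - ?\<delta> js\<close> vanishes by
      the hypothesis.\<close>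
    also have "\<dots> = (\<Sum>j\<in>{n}. (1 / fact j) * (\<Sum>js | length js = j. pdl js \<Phi> X * (moment js u - ?\<delta> js)))"
      by (rule sum.mono_neutral_right) (auto intro!: sum.neutral simp: IH)
    also have "\<dots> = of_real c ^ n / fact n * S"
      by (simp add: S_def \<Phi>(2) sum_distrib_left mult_ac)
    finally have 2: "Q (taylor_poly n \<Phi> X) X - \<Phi> X = of_real c ^ n / fact n * S" .
    have "\<Phi> X = Q \<Phi> X"
      using repro[of m X] by (simp add: \<Phi>_def[abs_def] c_def)
    then have "Q (taylor_poly n \<Phi> X) X - \<Phi> X = Q (\<lambda>y. taylor_poly n \<Phi> X y - \<Phi> y) X"
      by (simp add: Q_diff poly_bounded_taylor_poly pbP)
    also have "cmod \<dots> \<le> (\<integral>y. cmod ((taylor_poly n \<Phi> X y - \<Phi> y) * q0 \<phi> X y) \<partial>lborel)"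
      unfolding Q_def by (rule integral_norm_bound)
    also have "\<dots> \<le> (\<integral>y. (real CARD('n) ^ Suc n * (c ^ Suc n * B0) / fact n) * (norm (y - X) ^ Suc n * cmod (q0 \<phi> X y)) \<partial>lborel)"
    proof (rule integral_mono)
      show "integrable lborel (\<lambda>y. cmod ((taylor_poly n \<Phi> X y - \<Phi> y) * q0 \<phi> X y))"
        by (intro integrable_norm poly_bounded_integrable_Q poly_bounded_diff poly_bounded_taylor_poly pbP)
      show "integrable lborel (\<lambda>y. (real CARD('n) ^ Suc n * (c ^ Suc n * B0) / fact n) * (norm (y - X) ^ Suc n * cmod (q0 \<phi> X y)))"
        by (intro integrable_mult_right integrable_norm_q0)
      fix y
      have "cmod (\<Phi> y - taylor_poly n \<Phi> X y) \<le> (real CARD('n) ^ Suc n * norm (y - X) ^ Suc n * (c ^ Suc n * B0)) / fact n"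
      proof (rule taylor_poly_remainder_bound[OF \<Phi>(1) dirderiv_bound])
        show "cmod (pdl js \<Phi> z) \<le> c ^ Suc n * B0" if "length js = Suc n" for js z
          using c B0[OF that] that unfolding \<Phi>(2) by (simp add: norm_mult norm_power mult_left_mono)
      qed
      then have "cmod (taylor_poly n \<Phi> X y - \<Phi> y) * cmod (q0 \<phi> X y) \<le> (real CARD('n) ^ Suc n * norm (y - X) ^ Suc n * (c ^ Suc n * B0)) / fact n * cmod (q0 \<phi> X y)"
        by (intro mult_right_mono) (auto simp: norm_minus_commute)
      then show "cmod ((taylor_poly n \<Phi> X y - \<Phi> y) * q0 \<phi> X y) \<le> (real CARD('n) ^ Suc n * (c ^ Suc n * B0) / fact n) * (norm (y - X) ^ Suc n * cmod (q0 \<phi> X y))"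
        by (simp add: norm_mult mult_ac)
    qed
    also have "\<dots> = (real CARD('n) ^ Suc n * (c ^ Suc n * B0) / fact n) * (\<integral>y. norm (y - X) ^ Suc n * cmod (q0 \<phi> X y) \<partial>lborel)"
      by simp
    also have "\<dots> \<le> (real CARD('n) ^ Suc n * (c ^ Suc n * B0) / fact n) * (kernel_const (Suc n) * wt_integral TYPE('n))"
      using c D_nonneg[of 0] gs_weight_A2_nonneg unfolding B0_def by (intro mult_left_mono integral_norm_q0) auto
    also have "\<dots> = c ^ n / fact n * (B1 * c)"
      by (simp add: B1_def mult_ac)
    finally have "c ^ n / fact n * cmod S \<le> c ^ n / fact n * (B1 * c)"
      unfolding 2 using c by (simp add: norm_mult norm_divide norm_power)
    then have "cmod S \<le> B1 * c"
      using c by (subst (asm) mult_le_cancel_left_pos) auto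
    then show ?thesis by (simp add: S_def X_def c_def)
  qed
  then show ?thesis by (intro exI[of _ B1] allI impI)
qed

lemma moment_step:
  assumes IH: "\<And>js. length js < n \<Longrightarrow> moment js u = (if js = [] then 1 else 0)"
  shows "(\<Sum>js | length js = n. pdl js \<phi> x * (moment js u - (if js = [] then 1 else 0))) = 0"
proof -
  define S where "S x = (\<Sum>js | length js = n. pdl js \<phi> x * (moment js u - (if js = [] then 1 else 0)))" for x
  have "\<exists>B. \<forall>m k. k \<in> lattice \<longrightarrow> cmod (S ((1 / 2 ^ m) *\<^sub>R (u + k))) \<le> B / 2 ^ m"
    unfolding S_def by (rule moment_step_bound) (rule IH)
  then obtain B where "\<forall>m k. k \<in> lattice \<longrightarrow> cmod (S ((1 / 2 ^ m) *\<^sub>R (u + k))) \<le> B / 2 ^ m"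
    by (elim exE) (rule that)
  then have B: "cmod (S ((1 / 2 ^ m) *\<^sub>R (u + k))) \<le> B / 2 ^ m" if "k \<in> lattice" for m k
    using that by simp
  \<comment> \<open>Rounding down places u + k m within 1 of 2^m x in every coordinate, so the
    scaled points converge to x.\<close>
  define k where "k m = ((\<chi> i. of_int \<lfloor>2 ^ m * x $ i - u $ i\<rfloor>) :: real^'n)" for m :: nat
  have k: "k m \<in> lattice" for m by (simp add: k_def lattice_def)
  define z where "z m = (1 / 2 ^ m) *\<^sub>R (u + k m)" for m
  have zx: "z \<longlonglongrightarrow> x"
  proof (rule vec_tendstoI)
    fix i
    have "\<bar>z m $ i - x $ i\<bar> \<le> 1 / 2 ^ m" for m
    proof -
      have "z m $ i - x $ i = (of_int \<lfloor>2 ^ m * x $ i - u $ i\<rfloor> - (2 ^ m * x $ i - u $ i)) / 2 ^ m"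
        by (simp add: z_def k_def field_simps)
      moreover have "\<bar>of_int \<lfloor>2 ^ m * x $ i - u $ i\<rfloor> - (2 ^ m * x $ i - u $ i)\<bar> \<le> 1"
        by linarith
      ultimately show ?thesis by (simp add: divide_right_mono)
    qed
    then have "(\<lambda>m. z m $ i - x $ i) \<longlonglongrightarrow> 0"
      by (intro Lim_null_comparison[OF _ LIMSEQ_divide_power2_zero[of 1]]) auto
    then show "(\<lambda>m. z m $ i) \<longlonglongrightarrow> x $ i" by (rule LIM_zero_cancel)
  qed
  have "continuous_on UNIV S"
    unfolding S_def by (intro continuous_intros pdl_continuous smooth)
  then have "(\<lambda>m. S (z m)) \<longlonglongrightarrow> S x"
    using zx by (auto simp: continuous_on_eq_continuous_at intro: isCont_tendsto_compose)
  moreover have "(\<lambda>m. S (z m)) \<longlonglongrightarrow> 0"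
    by (rule Lim_null_comparison[OF _ LIMSEQ_divide_power2_zero[of B]]) (use B k in \<open>auto simp: z_def\<close>)
  ultimately have "S x = 0" by (rule LIMSEQ_unique)
  then show ?thesis by (simp add: S_def)
qed

lemma moments:
  assumes nz: "\<exists>x. \<phi> x \<noteq> 0"
  shows "moment js u = (if js = [] then 1 else 0)"
proof -
  have P0: "moment [] u = 1" for u
  proof -
    obtain x where "\<phi> x \<noteq> 0" using nz by blast
    moreover have "\<phi> x * (moment [] u - 1) = 0"
      using moment_step[of 0 u x] by simp
    ultimately show ?thesis by simp
  qed
  \<comment> \<open>If \<phi> had integral 0, all lattice coefficients of the constant 1 would
    vanish, and with them \<open>moment [] 0\<close>, which equals 1 by \<open>P0\<close>.\<close>
  have int_nz: "integral\<^sup>L lborel \<phi> \<noteq> 0"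
  proof
    assume 0: "integral\<^sup>L lborel \<phi> = 0"
    have "coeff (\<lambda>y. 1) n = 0" for n
    proof -
      have "coeff (\<lambda>y. 1) n = cnj (\<integral>y. \<phi> (y - lat n) \<partial>lborel)"
        by (simp add: coeff_def)
      also have "(\<integral>y. \<phi> (y - lat n) \<partial>lborel) = integral\<^sup>L lborel \<phi>"
        using lborel_integral_affine[of \<phi> 1 "- lat n"] by simp
      finally show ?thesis using 0 by simp
    qed
    moreover have "moment [] 0 = lattice_series (coeff (\<lambda>y. 1)) 0"
      unfolding moment_def by (simp, rule Q_eq_lattice_series[where N = 0 and K = 1]) (simp add: poly_bounded_by_def)
    ultimately have "moment [] 0 = 0" by (simp add: lattice_series_def)
    then show False using P0 by simp
  qed
  show ?thesis
  proof (induction "length js" arbitrary: js rule: less_induct)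
    case less
    show ?case
    proof (cases "js = []")
      case False
      define n where "n = length js"
      have n: "n > 0" using False by (simp add: n_def)
      have step: "(\<Sum>ks | length ks = n. pdl ks \<phi> x * moment ks u) = 0" for x
      proof -
        have "(\<Sum>ks | length ks = n. pdl ks \<phi> x * (moment ks u - (if ks = [] then 1 else 0))) = 0"
          by (rule moment_step) (use less n_def in auto)
        moreover have "(\<Sum>ks | length ks = n. pdl ks \<phi> x * (moment ks u - (if ks = [] then 1 else 0))) = (\<Sum>ks | length ks = n. pdl ks \<phi> x * moment ks u)"
          using n by (intro sum.cong) auto
        ultimately show ?thesis by simp
      qed
      \<comment> \<open>The identity \<open>step\<close> is integrated in x against the monomial
        \<open>js\<close>. The result is \<open>Q\<close> of a polynomial in y - u, which by
        \<open>integral_monomial_dirderiv\<close> is a nonzero multiple of the single monomial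
        \<open>js\<close>.\<close>
      define b where "b ks = (\<integral>x. of_real (monomial js x) * pdl ks \<phi> x \<partial>lborel)" for ks
      have int: "integrable lborel (\<lambda>x. of_real (monomial js x) * pdl ks \<phi> x)" for ks
        by (intro rapid_monomial_integrable rapid_pdl rapid_phi)
      have "0 = (\<integral>x. of_real (monomial js x) * (\<Sum>ks | length ks = n. pdl ks \<phi> x * moment ks u) \<partial>lborel)"
        by (simp add: step)
      also have "\<dots> = (\<integral>x. (\<Sum>ks | length ks = n. (of_real (monomial js x) * pdl ks \<phi> x) * moment ks u) \<partial>lborel)"
        by (simp add: sum_distrib_left mult.assoc)
      also have "\<dots> = (\<Sum>ks | length ks = n. b ks * moment ks u)"
        unfolding b_def using int by (subst Bochner_Integration.integral_sum) auto
      also have "\<dots> = Q (\<lambda>y. \<Sum>ks | length ks = n. b ks * of_real (monomial ks (y - u))) u"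
        by (subst Q_sum) (simp_all add: poly_bounded_cmult poly_bounded_monomial Q_cmult moment_def)
      also have "(\<lambda>y. \<Sum>ks | length ks = n. b ks * of_real (monomial ks (y - u)))
          = (\<lambda>y. ((-1) ^ n * fact n * integral\<^sup>L lborel \<phi>) * of_real (monomial js (y - u)))"
      proof
        fix y
        show "(\<Sum>ks | length ks = n. b ks * of_real (monomial ks (y - u))) = ((-1) ^ n * fact n * integral\<^sup>L lborel \<phi>) * of_real (monomial js (y - u))"
          using integral_monomial_dirderiv[OF rapid_phi, of js n "y - u"] n_def by (simp add: b_def mult_ac)
      qed
      also have "Q \<dots> u = ((-1) ^ n * fact n * integral\<^sup>L lborel \<phi>) * moment js u"
        by (simp only: Q_cmult moment_def)
      finally have "moment js u = 0" using int_nz by simp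
      then show ?thesis using False by simp
    qed (simp add: P0)
  qed
qed

end

end

section \<open>The approximation error\<close>

lemma poly_bounded_mult: "poly_bounded f \<Longrightarrow> poly_bounded g \<Longrightarrow> poly_bounded (\<lambda>y. f y * g y)"
proof -
  assume "poly_bounded f" "poly_bounded g"
  then obtain N K N' K' where f: "poly_bounded_by N K f" and g: "poly_bounded_by N' K' g" by (auto simp: poly_bounded_def)
  have "poly_bounded_by (N + N') (K * K') (\<lambda>y. f y * g y)"
    unfolding poly_bounded_by_def
  proof (intro conjI allI)
    show "(\<lambda>y. f y * g y) \<in> borel_measurable borel"
      using poly_bounded_by_measurable[OF f] poly_bounded_by_measurable[OF g] by measurable
    fix y
    have "cmod (f y) * cmod (g y) \<le> (K * (1 + norm y) ^ N) * (K' * (1 + norm y) ^ N')"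
      using poly_bounded_by_nonneg[OF f] by (intro mult_mono poly_bounded_byD[OF f] poly_bounded_byD[OF g]) auto
    then show "cmod (f y * g y) \<le> K * K' * (1 + norm y) ^ (N + N')"
      by (simp add: norm_mult power_add mult_ac)
  qed
  then show ?thesis by (auto simp: poly_bounded_def)
qed

lemma gs_weight_split: "gs_weight r1 r2 A a 0 * gs_weight r1 r2 A 0 l = gs_weight r1 r2 A a l"
  by (simp add: gs_weight_def power_add)

lemma Suc_le_power2: "real (Suc n) \<le> 2 ^ Suc n"
  by (metis less_exp less_imp_le of_nat_le_iff of_nat_numeral of_nat_power)

section \<open>Derivatives of the kernel paired with powers of the distance, and the error at level
  0\<close>

context gs_kernel
begin

text \<open>The distance from y to X is split through k: one part is constant in y, the other is
  absorbed by the decay of \<phi> (y - k).\<close>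

lemma integral_norm_power_phi:
  fixes k X :: "real^'n"
  shows "integrable lborel (\<lambda>y. norm (y - X) ^ b * cmod (\<phi> (y - k)))" (is ?int)
    and "(\<integral>y. norm (y - X) ^ b * cmod (\<phi> (y - k)) \<partial>lborel)
      \<le> 2 ^ b * D 0 * wt_integral TYPE('n) * (norm (X - k) ^ b + gs_weight \<rho>1 \<rho>2 A2 b 0)" (is ?le)
proof -
  let ?g = "\<lambda>y. 2 ^ b * (norm (X - k) ^ b * (D 0 * wt (y - k)) + D 0 * gs_weight \<rho>1 \<rho>2 A2 b 0 * wt (y - k))"
  have bd: "norm (y - X) ^ b * cmod (\<phi> (y - k)) \<le> ?g y" for y
  proof -
    have "norm (y - X) \<le> norm (X - k) + norm (y - k)"
      using norm_triangle_ineq4[of "y - k" "X - k"] by simp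
    then have "norm (y - X) ^ b \<le> (norm (X - k) + norm (y - k)) ^ b"
      by (intro power_mono) auto
    also have "\<dots> \<le> 2 ^ b * (norm (X - k) ^ b + norm (y - k) ^ b)"
      by (intro add_power_le) auto
    finally have "norm (y - X) ^ b * cmod (\<phi> (y - k)) \<le> 2 ^ b * (norm (X - k) ^ b + norm (y - k) ^ b) * cmod (\<phi> (y - k))"
      by (rule mult_right_mono) simp
    also have "\<dots> = 2 ^ b * (norm (X - k) ^ b * cmod (\<phi> (y - k)) + norm (y - k) ^ b * cmod (\<phi> (y - k)))"
      by (simp add: algebra_simps)
    also have "\<dots> \<le> ?g y"
      using decay_a[of "y - k" b "[]"] by (intro mult_left_mono add_mono phi_le) auto
    finally show ?thesis .
  qed
  have ig: "integrable lborel ?g"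
    by (intro integrable_mult_right Bochner_Integration.integrable_add integrable_wt_shift)
  show ?int
  proof (rule Bochner_Integration.integrable_bound[OF ig])
    show "AE y in lborel. norm (norm (y - X) ^ b * cmod (\<phi> (y - k))) \<le> norm (?g y)"
      using bd by (intro AE_I2) (simp add: order_trans[OF _ abs_ge_self])
  qed measurable
  then have "(\<integral>y. norm (y - X) ^ b * cmod (\<phi> (y - k)) \<partial>lborel) \<le> integral\<^sup>L lborel ?g"
    by (intro integral_mono ig bd)
  also have "\<dots> = 2 ^ b * D 0 * wt_integral TYPE('n) * (norm (X - k) ^ b + gs_weight \<rho>1 \<rho>2 A2 b 0)"
    using integrable_wt_shift[of k] by (simp add: integral_wt_shift algebra_simps)
  finally show ?le .
qed

text \<open>The derivatives fall on \<phi> (X - lat n), the b powers either on the same factor or on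
  the other one. In the first case the joint estimate for \<phi> gives the weight directly, in the
  second the two separate weights multiply to the same value by
  \<open>gs_weight_split\<close>.\<close>

lemma lattice_moment:
  shows "summable (\<lambda>n. cmod (pdl bs \<phi> (X - lat n)) * (\<integral>y. norm (y - X) ^ b * cmod (\<phi> (y - lat n)) \<partial>lborel))" (is "summable ?f")
    and "(\<Sum>n. cmod (pdl bs \<phi> (X - lat n)) * (\<integral>y. norm (y - X) ^ b * cmod (\<phi> (y - lat n)) \<partial>lborel))
      \<le> 2 ^ Suc b * (D 0 * D 0 * wt_integral TYPE('n) * wt_sum TYPE('n)) * gs_weight \<rho>1 \<rho>2 A2 b (length bs)" (is ?le)
proof -
  define K where "K = 2 ^ Suc b * (D 0 * D 0 * wt_integral TYPE('n)) * gs_weight \<rho>1 \<rho>2 A2 b (length bs)"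
  have K: "K \<ge> 0" unfolding K_def
    using D_nonneg wt_integral_nonneg[where 'n = 'n] gs_weight_A2_nonneg by (intro mult_nonneg_nonneg) auto
  have bd: "?f n \<le> K * wt (X - lat n)" for n
  proof -
    let ?p = "cmod (pdl bs \<phi> (X - lat n))"
    have "?f n \<le> ?p * (2 ^ b * D 0 * wt_integral TYPE('n) * (norm (X - lat n) ^ b + gs_weight \<rho>1 \<rho>2 A2 b 0))"
      by (intro mult_left_mono integral_norm_power_phi) auto
    also have "\<dots> = 2 ^ b * D 0 * wt_integral TYPE('n) * (norm (X - lat n) ^ b * ?p + gs_weight \<rho>1 \<rho>2 A2 b 0 * (norm (X - lat n) ^ 0 * ?p))"
      by (simp add: algebra_simps)
    also have "\<dots> \<le> 2 ^ b * D 0 * wt_integral TYPE('n) * (D 0 * gs_weight \<rho>1 \<rho>2 A2 b (length bs) * wt (X - lat n)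
        + gs_weight \<rho>1 \<rho>2 A2 b 0 * (D 0 * gs_weight \<rho>1 \<rho>2 A2 0 (length bs) * wt (X - lat n)))"
      using D_nonneg wt_integral_nonneg[where 'n = 'n] gs_weight_A2_nonneg
      by (intro mult_left_mono[OF add_mono[OF decay_a mult_left_mono[OF decay_a]]] mult_nonneg_nonneg) auto
    also have "\<dots> = K * wt (X - lat n)"
      unfolding K_def gs_weight_split[of \<rho>1 \<rho>2 A2 b "length bs", symmetric] by (simp add: algebra_simps)
    finally show ?thesis .
  qed
  have nn: "0 \<le> ?f n" for n by (intro mult_nonneg_nonneg integral_nonneg_AE) auto
  show s: "summable ?f"
    by (rule summable_comparison_test'[of "\<lambda>n. K * wt (X - lat n)" 0])
       (use bd nn in \<open>auto intro!: summable_mult summable_wt\<close>)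
  have "suminf ?f \<le> (\<Sum>n. K * wt (X - lat n))"
    by (intro suminf_le bd s summable_mult summable_wt)
  also have "\<dots> = K * (\<Sum>n. wt (X - lat n))"
    by (rule suminf_mult[OF summable_wt])
  also have "\<dots> \<le> K * wt_sum TYPE('n)"
    by (intro mult_left_mono suminf_wt_le K)
  finally show ?le by (simp add: K_def mult_ac)
qed

lemma poly_bounded_coeff_bound:
  assumes "poly_bounded r" and r: "\<And>y. cmod (r y) \<le> R1 * norm (y - X) ^ b1 + R2 * norm (y - X) ^ b2"
  shows "cmod (coeff r n) \<le> R1 * (\<integral>y. norm (y - X) ^ b1 * cmod (\<phi> (y - lat n)) \<partial>lborel)
      + R2 * (\<integral>y. norm (y - X) ^ b2 * cmod (\<phi> (y - lat n)) \<partial>lborel)"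
proof -
  note int = integral_norm_power_phi(1)[of X _ "lat n"]
  have "cmod (coeff r n) \<le> (\<integral>y. cmod (r y * cnj (\<phi> (y - lat n))) \<partial>lborel)"
    unfolding coeff_def by (rule integral_norm_bound)
  also have "\<dots> \<le> (\<integral>y. R1 * (norm (y - X) ^ b1 * cmod (\<phi> (y - lat n))) + R2 * (norm (y - X) ^ b2 * cmod (\<phi> (y - lat n))) \<partial>lborel)"
  proof (rule integral_mono)
    show "integrable lborel (\<lambda>y. cmod (r y * cnj (\<phi> (y - lat n))))"
      using assms(1) unfolding poly_bounded_def by (elim exE) (rule integrable_norm[OF integrable_poly_bounded_by_phi])
    show "integrable lborel (\<lambda>y. R1 * (norm (y - X) ^ b1 * cmod (\<phi> (y - lat n))) + R2 * (norm (y - X) ^ b2 * cmod (\<phi> (y - lat n))))"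
      by (intro Bochner_Integration.integrable_add integrable_mult_right int)
    show "cmod (r y * cnj (\<phi> (y - lat n))) \<le> R1 * (norm (y - X) ^ b1 * cmod (\<phi> (y - lat n))) + R2 * (norm (y - X) ^ b2 * cmod (\<phi> (y - lat n)))" for y
      using mult_right_mono[OF r[of y] norm_ge_zero[of "\<phi> (y - lat n)"]] by (simp add: norm_mult algebra_simps)
  qed
  also have "\<dots> = R1 * (\<integral>y. norm (y - X) ^ b1 * cmod (\<phi> (y - lat n)) \<partial>lborel)
      + R2 * (\<integral>y. norm (y - X) ^ b2 * cmod (\<phi> (y - lat n)) \<partial>lborel)"
    using int by simp
  finally show ?thesis .
qed

definition moment_const :: real where "moment_const = D 0 * D 0 * wt_integral TYPE('n) * wt_sum TYPE('n)"

lemma moment_const_nonneg: "moment_const \<ge> 0"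
  unfolding moment_const_def by (intro mult_nonneg_nonneg D_nonneg wt_integral_nonneg wt_sum_nonneg)

text \<open>Two powers are allowed because the Taylor remainder, multiplied by a power of the norm
  of X, has two orders of growth in the distance from X.\<close>

lemma pdl_Q_bound:
  assumes pbr: "poly_bounded r" and r: "\<And>y. cmod (r y) \<le> R1 * norm (y - X) ^ b1 + R2 * norm (y - X) ^ b2"
    and R: "R1 \<ge> 0" "R2 \<ge> 0"
  shows "cmod (pdl bs (Q r) X) \<le> R1 * (2 ^ Suc b1 * moment_const * gs_weight \<rho>1 \<rho>2 A2 b1 (length bs))
     + R2 * (2 ^ Suc b2 * moment_const * gs_weight \<rho>1 \<rho>2 A2 b2 (length bs))"
proof -
  obtain N K where rNK: "poly_bounded_by N K r" using pbr by (auto simp: poly_bounded_def)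
  let ?T = "\<lambda>b n. cmod (pdl bs \<phi> (X - lat n)) * (\<integral>y. norm (y - X) ^ b * cmod (\<phi> (y - lat n)) \<partial>lborel)"
  have "cmod (pdl bs (Q r) X) \<le> (\<Sum>n. cmod (coeff r n * pdl bs \<phi> (X - lat n)))"
    unfolding pdl_Q[OF rNK] by (rule summable_norm[OF summable_pdl_Q[OF rNK]])
  also have "\<dots> \<le> (\<Sum>n. R1 * ?T b1 n + R2 * ?T b2 n)"
  proof (intro suminf_le summable_pdl_Q[OF rNK] summable_add summable_mult lattice_moment)
    fix n
    show "cmod (coeff r n * pdl bs \<phi> (X - lat n)) \<le> R1 * ?T b1 n + R2 * ?T b2 n"
      using mult_right_mono[OF poly_bounded_coeff_bound[OF pbr r, of n] norm_ge_zero[of "pdl bs \<phi> (X - lat n)"]]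
      by (simp add: norm_mult algebra_simps)
  qed
  also have "\<dots> = R1 * (\<Sum>n. ?T b1 n) + R2 * (\<Sum>n. ?T b2 n)"
    by (simp add: suminf_add[symmetric] suminf_mult summable_mult lattice_moment)
  also have "\<dots> \<le> R1 * (2 ^ Suc b1 * moment_const * gs_weight \<rho>1 \<rho>2 A2 b1 (length bs)) + R2 * (2 ^ Suc b2 * moment_const * gs_weight \<rho>1 \<rho>2 A2 b2 (length bs))"
    unfolding moment_const_def using R by (intro add_mono mult_left_mono lattice_moment)
  finally show ?thesis .
qed

context
  assumes mom: "\<And>js u. moment js u = (if js = [] then 1 else 0)"
begin

text \<open>Writing y - z = (y - x) + (x - z) in one coordinate at a time moves factors from
  \<open>ks\<close> to \<open>js\<close>, which is why \<open>js\<close> must be arbitrary in the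
  induction. By the moment hypothesis only terms in which \<open>js\<close> stays empty
  survive.\<close>

lemma Q_monomial_monomial:
  "Q (\<lambda>y. of_real (monomial js (y - x)) * of_real (monomial ks (y - z))) x = (if js = [] then of_real (monomial ks (x - z)) else 0)"
proof (induction ks arbitrary: js)
  case Nil
  then show ?case using mom[of js x] by (simp add: moment_def)
next
  case (Cons k ks)
  have eq: "(\<lambda>y. complex_of_real (monomial js (y - x)) * of_real (monomial (k # ks) (y - z)))
    = (\<lambda>y. of_real (monomial (k # js) (y - x)) * of_real (monomial ks (y - z)) + of_real ((x - z) $ k) * (of_real (monomial js (y - x)) * of_real (monomial ks (y - z))))"
    by (auto simp: fun_eq_iff algebra_simps)
  show ?case
    unfolding eq by (subst Q_add) (simp_all add: poly_bounded_mult poly_bounded_monomial poly_bounded_cmult Q_cmult Cons del: monomial_simps, simp)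
qed

text \<open>Moments are centred at the evaluation point x, the polynomial at an arbitrary z. Having
  the identity at all x for fixed z is what permits differentiating it in x.\<close>

lemma Q_reproduces_taylor_poly: "Q (taylor_poly n f z) x = taylor_poly n f z x"
proof -
  have Q1: "Q (\<lambda>y. of_real (monomial ks (y - z))) x = of_real (monomial ks (x - z))" for ks
    using Q_monomial_monomial[of "[]" x ks z] by simp
  have Q2: "Q (\<lambda>y. dirderiv j f z (y - z)) x = dirderiv j f z (x - z)" for j
    unfolding dirderiv_def mult.commute[of "complex_of_real _"]
    by (subst Q_sum) (simp_all add: poly_bounded_cmult poly_bounded_monomial Q_cmult Q1)
  have "taylor_poly n f z = (\<lambda>y. \<Sum>j\<le>n. (1 / fact j) * dirderiv j f z (y - z))"
    by (simp add: taylor_poly_def fun_eq_iff)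
  then show ?thesis
    by (simp only: Q_sum[OF poly_bounded_cmult[OF poly_bounded_dirderiv]] Q_cmult Q2)
qed

text \<open>\<open>Q\<close> leaves the Taylor polynomial unchanged, and at X its derivatives of
  order at most n are those of f; so it may be subtracted under \<open>Q\<close> and only the
  remainder is left.\<close>

lemma pdl_Q_diff:
  assumes f: "smooth_fun f" "poly_bounded f" and n: "length bs \<le> n"
  shows "pdl bs (Q f) X - pdl bs f X = pdl bs (Q (\<lambda>y. f y - taylor_poly n f X y)) X"
proof -
  have eq: "Q (\<lambda>y. f y - taylor_poly n f X y) = (\<lambda>x. Q f x - taylor_poly n f X x)"
    using Q_diff[OF f(2) poly_bounded_taylor_poly] Q_reproduces_taylor_poly by (simp add: fun_eq_iff)
  obtain N K where "poly_bounded_by N K f" using f(2) by (auto simp: poly_bounded_def)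
  then show ?thesis
    unfolding eq using smooth_diff(2)[OF smooth_Q taylor_poly_smooth(1)[OF f(1)], of N K f bs n X] pdl_taylor_poly_self[OF f(1) n, of X]
    by simp
qed

text \<open>One power of \<open>c\<close> more than the number of derivatives: this makes the error vanish.\<close>

lemma error_bound:
  fixes g :: "real^'n \<Rightarrow> complex" and r1 t B K c :: real
  assumes g: "smooth_fun g" "gs_decay r1 t B K g" and B: "B \<ge> 1" and r1: "r1 \<ge> 0" and t: "t \<ge> \<rho>2"
    and \<rho>21: "\<rho>2 \<ge> 1" and c: "0 < c" "c \<le> 1"
  defines "G \<equiv> \<lambda>x. g (c *\<^sub>R x)"
    and "Y \<equiv> 4 * real CARD('n) * B * (2 * A2 * A2 * 2 powr \<rho>2 * B) * 2 powr (r1 + \<rho>1 + \<rho>2 - 1)"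
  shows "norm (c *\<^sub>R X) ^ a * cmod (pdl bs (Q G) X - pdl bs G X)
      \<le> c ^ Suc (length bs) * K * (4 * moment_const * Y) * gs_weight (r1 + \<rho>1 + \<rho>2 - 1) t Y a (length bs)"
proof -
  define n where "n = length bs"
  define d where "d = real CARD('n)"
  have d: "d \<ge> 1" by (simp add: d_def Suc_leI)
  have K: "K \<ge> 0" by (rule gs_decay_nonneg[OF g(2)])
  have G: "smooth_fun G" "pdl js G x = of_real c ^ length js * pdl js g (c *\<^sub>R x)" for js x
    using smooth_affine[OF g(1), where c = c and b = 0] unfolding G_def by simp_all
  have pbG: "poly_bounded G"
  proof (rule bounded_imp_poly_bounded)
    show "G \<in> borel_measurable borel" by (rule smooth_measurable[OF G(1)])
    show "cmod (G x) \<le> K" for x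
      using gs_decayD[OF g(2), of "c *\<^sub>R x" 0 "[]"] by (simp add: G_def)
  qed
  define r where "r y = G y - taylor_poly n G X y" for y
  have pbr: "poly_bounded r" unfolding r_def[abs_def] by (intro poly_bounded_diff pbG poly_bounded_taylor_poly)
  have err: "pdl bs (Q G) X - pdl bs G X = pdl bs (Q r) X"
    unfolding r_def[abs_def] by (rule pdl_Q_diff[OF G(1) pbG]) (simp add: n_def)
  define P where "P = norm (c *\<^sub>R X) ^ a"
  have P: "P \<ge> 0" by (simp add: P_def)
  define F where "F = fact (Suc n) powr r1"
  \<comment> \<open>Everything common to the two orders of growth: dimension factor, scale c^(n+1),
    the 2^a from splitting a power of a sum, and the bound for derivatives of g of order n + 1 with
    the 1/n! of the remainder.\<close>
  define R where "R = (d * c) ^ Suc n * 2 ^ a * K * B ^ Suc n * F / fact n"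
  have R: "R \<ge> 0" unfolding R_def F_def using d c K B by auto
  define R1 where "R1 = R * (B ^ a * fact a powr t)"
  have R1: "R1 \<ge> 0" using R B by (simp add: R1_def)
  \<comment> \<open>The factor P, a power of the norm of c X, must be transferred from X to the
    points of the segment where the derivatives of g are evaluated; the cost of this transfer is the
    second term, with a further powers of the distance.\<close>
  have rb: "P * cmod (r y) \<le> R1 * norm (y - X) ^ Suc n + R * norm (y - X) ^ (Suc n + a)" for y
  proof (cases "P = 0")
    case True
    then show ?thesis using R R1 by simp
  next
    case False
    then have P': "P > 0" using P by simp
    define N where "N = norm (y - X)"
    have N: "N \<ge> 0" by (simp add: N_def)
    \<comment> \<open>\<open>H\<close> bounds P times the derivatives of G on the segment. The
      remainder estimate is applied with H / P, hence the separate case P = 0.\<close>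
    define H where "H = c ^ Suc n * (2 ^ a * (K * (B ^ Suc n * F) * (B ^ a * fact a powr t + N ^ a)))"
    have "cmod (r y) \<le> (d ^ Suc n * N ^ Suc n * (H / P)) / fact n"
      unfolding r_def d_def N_def
    proof (rule taylor_poly_remainder_bound[OF G(1) dirderiv_bound])
      fix \<tau> :: real and js :: "'n list" assume \<tau>: "0 \<le> \<tau>" "\<tau> \<le> 1" and js: "length js = Suc n"
      define z where "z = X + \<tau> *\<^sub>R (y - X)"
      have "norm (c *\<^sub>R X) \<le> norm (c *\<^sub>R z) + N"
      proof -
        have "c *\<^sub>R X = c *\<^sub>R z - (c * \<tau>) *\<^sub>R (y - X)"
          by (simp add: z_def algebra_simps)
        then have "norm (c *\<^sub>R X) \<le> norm (c *\<^sub>R z) + norm ((c * \<tau>) *\<^sub>R (y - X))"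
          using norm_triangle_ineq4 by metis
        also have "norm ((c * \<tau>) *\<^sub>R (y - X)) \<le> 1 * N"
          unfolding norm_scaleR N_def using c \<tau> by (intro mult_right_mono) (auto simp: abs_mult mult_le_one)
        finally show ?thesis by simp
      qed
      then have "P \<le> (norm (c *\<^sub>R z) + N) ^ a"
        unfolding P_def by (intro power_mono) auto
      also have "\<dots> \<le> 2 ^ a * (norm (c *\<^sub>R z) ^ a + N ^ a)"
        by (intro add_power_le N) auto
      finally have "P * cmod (pdl js g (c *\<^sub>R z)) \<le> 2 ^ a * (norm (c *\<^sub>R z) ^ a + N ^ a) * cmod (pdl js g (c *\<^sub>R z))"
        by (rule mult_right_mono) simp
      also have "\<dots> = 2 ^ a * (norm (c *\<^sub>R z) ^ a * cmod (pdl js g (c *\<^sub>R z)) + N ^ a * (norm (c *\<^sub>R z) ^ 0 * cmod (pdl js g (c *\<^sub>R z))))"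
        by (simp add: algebra_simps)
      also have "\<dots> \<le> 2 ^ a * (K * gs_weight r1 t B a (Suc n) + N ^ a * (K * gs_weight r1 t B 0 (Suc n)))"
        using N gs_decayD[OF g(2), of "c *\<^sub>R z" a js] gs_decayD[OF g(2), of "c *\<^sub>R z" 0 js]
        unfolding js by (intro mult_left_mono add_mono) auto
      also have "\<dots> = 2 ^ a * (K * (B ^ Suc n * F) * (B ^ a * fact a powr t + N ^ a))"
        by (simp add: gs_weight_def F_def power_add algebra_simps)
      finally have "P * (c ^ Suc n * cmod (pdl js g (c *\<^sub>R z))) \<le> H"
        unfolding H_def using c by (subst mult.left_commute) (intro mult_left_mono, auto)
      then have "c ^ Suc n * cmod (pdl js g (c *\<^sub>R z)) \<le> H / P"
        using P' by (simp add: pos_le_divide_eq mult.commute)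
      then show "cmod (pdl js G (X + \<tau> *\<^sub>R (y - X))) \<le> H / P"
        unfolding G(2) js using c by (simp add: norm_mult norm_power z_def)
    qed
    then have "P * cmod (r y) \<le> P * ((d ^ Suc n * N ^ Suc n * (H / P)) / fact n)"
      by (rule mult_left_mono) (rule P)
    also have "\<dots> = d ^ Suc n * N ^ Suc n * H / fact n"
      using P' by simp
    also have "\<dots> = R1 * N ^ Suc n + R * N ^ (Suc n + a)"
      by (simp add: H_def R1_def R_def power_add power_mult_distrib algebra_simps add_divide_distrib)
    finally show ?thesis by (simp add: N_def)
  qed
  define W where "W b = 2 ^ Suc b * moment_const * gs_weight \<rho>1 \<rho>2 A2 b n" for b
  have "P * cmod (pdl bs (Q r) X) = cmod (pdl bs (Q (\<lambda>y. of_real P * r y)) X)"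
  proof -
    obtain N K where rNK: "poly_bounded_by N K r" using pbr by (auto simp: poly_bounded_def)
    have "Q (\<lambda>y. of_real P * r y) = (\<lambda>x. of_real P * Q r x)"
      by (simp add: Q_cmult fun_eq_iff)
    then show ?thesis
      using P by (simp add: smooth_mult_left(2)[OF smooth_Q[OF rNK]] norm_mult)
  qed
  also have "\<dots> \<le> R1 * W (Suc n) + R * W (Suc n + a)"
    unfolding W_def n_def
  proof (rule pdl_Q_bound[OF poly_bounded_cmult[OF pbr]])
    show "cmod (of_real P * r y) \<le> R1 * norm (y - X) ^ Suc (length bs) + R * norm (y - X) ^ (Suc (length bs) + a)" for y
      using rb[of y] P by (simp add: norm_mult n_def)
  qed (use R R1 in auto)
  finally have main: "P * cmod (pdl bs (Q G) X - pdl bs G X) \<le> R1 * W (Suc n) + R * W (Suc n + a)"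
    unfolding err .
  define T where "T = 2 powr \<rho>2"
  have T: "T \<ge> 1" unfolding T_def using \<rho>2 by (intro ge_one_powr_ge_zero) auto
  \<comment> \<open>One rate that dominates the geometric factors of both terms. T stems from
    splitting (n + 1 + a)! into (n + 1)! and a!, raised to the power \<rho>2.\<close>
  define Z where "Z = 2 * A2 * A2 * T * B"
  have A2T: "A2 * T \<ge> 1" using A2 T mult_mono[of 1 A2 1 T] by simp
  have ineqs: "2 * A2 * A2 \<le> Z" "B \<le> Z" "2 * A2 * A2 * T \<le> Z" "1 \<le> Z"
  proof -
    have AA: "1 \<le> A2 * A2" using A2 mult_mono[of 1 A2 1 A2] by simp
    have TB: "1 \<le> T * B" using T B mult_mono[of 1 T 1 B] by simp
    have AAT: "1 \<le> A2 * A2 * T" using AA T mult_mono[of 1 "A2 * A2" 1 T] by simp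
    have "2 * (A2 * A2) * 1 \<le> 2 * (A2 * A2) * (T * B)"
      using AA TB by (intro mult_left_mono) auto
    then show "2 * A2 * A2 \<le> Z" by (simp add: Z_def mult_ac)
    have "1 * B \<le> (2 * (A2 * A2 * T)) * B"
      using AAT B by (intro mult_right_mono) auto
    then show BZ: "B \<le> Z" by (simp add: Z_def mult_ac)
    have "(2 * (A2 * A2 * T)) * 1 \<le> (2 * (A2 * A2 * T)) * B"
      using AAT B by (intro mult_left_mono) auto
    then show "2 * A2 * A2 * T \<le> Z" by (simp add: Z_def mult_ac)
    show "1 \<le> Z" using B BZ by simp
  qed
  define f1 where "f1 = fact (Suc n) powr \<rho>2"
  define f2 where "f2 = fact n powr \<rho>1"
  define ft where "ft = fact a powr t"
  have f_nonneg: "f1 \<ge> 0" "f2 \<ge> 0" "ft \<ge> 0" "F \<ge> 0" by (auto simp: f1_def f2_def ft_def F_def)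
  have ft1: "ft \<ge> 1" unfolding ft_def using t \<rho>2 by (intro ge_one_powr_ge_zero) (auto simp: fact_ge_1)
  have br1: "B ^ a * ft * W (Suc n) \<le> 2 * moment_const * Z ^ (Suc n + a) * (f1 * f2 * ft)"
  proof -
    have "B ^ a * (2 ^ Suc n * A2 ^ (Suc n + n)) \<le> Z ^ a * (2 * A2 * A2) ^ Suc n"
    proof (rule mult_mono)
      show "B ^ a \<le> Z ^ a" using ineqs B by (intro power_mono) auto
      have "A2 ^ (Suc n + n) \<le> A2 ^ (Suc n + Suc n)" by (intro power_increasing A2) simp
      then have "2 ^ Suc n * A2 ^ (Suc n + n) \<le> 2 ^ Suc n * A2 ^ (Suc n + Suc n)"
        by (rule mult_left_mono) simp
      also have "\<dots> = (2 * A2 * A2) ^ Suc n"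
        by (simp add: power_mult_distrib power_add mult_ac)
      finally show "2 ^ Suc n * A2 ^ (Suc n + n) \<le> (2 * A2 * A2) ^ Suc n" .
    qed (use A2 ineqs in auto)
    also have "\<dots> \<le> Z ^ a * Z ^ Suc n"
      using ineqs A2 by (intro mult_left_mono power_mono) auto
    finally have "B ^ a * (2 ^ Suc n * A2 ^ (Suc n + n)) * (2 * moment_const * (f1 * f2 * ft)) \<le> Z ^ a * Z ^ Suc n * (2 * moment_const * (f1 * f2 * ft))"
      using moment_const_nonneg f_nonneg by (intro mult_right_mono) auto
    then show ?thesis
      by (simp add: W_def gs_weight_def f1_def f2_def power_add mult_ac)
  qed
  \<comment> \<open>Here the kernel moment has order n + 1 + a. Its factorial is split, and
    a!^\<rho>2 is enlarged to a!^t by t \<ge> \<rho>2.\<close>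
  have br2: "W (Suc n + a) \<le> 2 * moment_const * Z ^ (Suc n + a) * (f1 * f2 * ft)"
  proof -
    have "fact (Suc n + a) powr \<rho>2 \<le> (2 ^ (Suc n + a) * (fact (Suc n) * fact a)) powr \<rho>2"
      using \<rho>2 by (intro powr_mono2 fact_add_le) auto
    also have "\<dots> = T ^ (Suc n + a) * (f1 * fact a powr \<rho>2)"
      by (simp add: powr_mult power_powr_swap T_def f1_def del: fact_Suc)
    also have "\<dots> \<le> T ^ (Suc n + a) * (f1 * ft)"
      unfolding ft_def using T t f_nonneg by (intro mult_left_mono powr_le_mono_exp_fact) auto
    finally have 1: "fact (Suc n + a) powr \<rho>2 \<le> T ^ (Suc n + a) * (f1 * ft)" .
    have "A2 ^ (Suc n + a + n) \<le> A2 ^ ((Suc n + a) + (Suc n + a))" by (intro power_increasing A2) simp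
    then have "2 ^ (Suc n + a) * A2 ^ (Suc n + a + n) * fact (Suc n + a) powr \<rho>2
       \<le> 2 ^ (Suc n + a) * (A2 ^ (Suc n + a) * A2 ^ (Suc n + a)) * (T ^ (Suc n + a) * (f1 * ft))"
      using A2 1 by (intro mult_mono mult_left_mono) (auto simp: power_add)
    also have "\<dots> = (2 * A2 * A2 * T) ^ (Suc n + a) * (f1 * ft)"
      by (simp only: power_mult_distrib mult_ac)
    also have "\<dots> \<le> Z ^ (Suc n + a) * (f1 * ft)"
      using ineqs A2 T f_nonneg by (intro mult_right_mono power_mono) auto
    finally have "2 ^ (Suc n + a) * A2 ^ (Suc n + a + n) * fact (Suc n + a) powr \<rho>2 * (2 * moment_const * f2)
      \<le> Z ^ (Suc n + a) * (f1 * ft) * (2 * moment_const * f2)"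
      using moment_const_nonneg f_nonneg by (intro mult_right_mono) auto
    then show ?thesis
      by (simp add: W_def gs_weight_def f2_def mult_ac del: fact_Suc)
  qed
  have "R1 * W (Suc n) + R * W (Suc n + a) = R * (B ^ a * ft * W (Suc n) + W (Suc n + a))"
    by (simp add: R1_def ft_def algebra_simps)
  also have "\<dots> \<le> R * (2 * moment_const * Z ^ (Suc n + a) * (f1 * f2 * ft) + 2 * moment_const * Z ^ (Suc n + a) * (f1 * f2 * ft))"
    using R by (intro mult_left_mono add_mono br1 br2)
  also have "\<dots> = (c ^ Suc n * K * (4 * moment_const)) * ((d * B) ^ Suc n * 2 ^ a * Z ^ (Suc n + a) * ft * (F * f1 * f2 / fact n))"
    by (simp add: R_def power_mult_distrib mult_ac)
  also have "\<dots> \<le> (c ^ Suc n * K * (4 * moment_const)) * (Y ^ (Suc n + a) * ft * fact n powr (r1 + \<rho>1 + \<rho>2 - 1))"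
  proof (rule mult_left_mono)
    define s where "s = r1 + \<rho>1 + \<rho>2 - 1"
    define U where "U = 2 powr s"
    have s: "s \<ge> 0" using r1 \<rho>1 \<rho>21 by (simp add: s_def)
    have U: "U \<ge> 1" unfolding U_def using s by (intro ge_one_powr_ge_zero) auto
    define q :: real where "q = fact (Suc n)"
    have q: "q \<ge> 1" "q = real (Suc n) * fact n" by (simp_all add: q_def fact_ge_1 del: fact_Suc) simp
    \<comment> \<open>The factorial count: (n+1)! to the power r1 + \<rho>1 + \<rho>2, divided by
      n!, is n + 1 times (n+1)! to the power s; this division is the -1 in s. The factor n + 1 and
      the passage from (n+1)! to n! cost only geometric factors.\<close>
    have fU: "F * f1 * f2 / fact n \<le> 2 ^ Suc n * (U ^ Suc n * fact n powr s)"
    proof -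
      have "f2 \<le> q powr \<rho>1"
        unfolding f2_def q_def using \<rho>1 by (intro powr_mono2 fact_mono) auto
      then have "F * f1 * f2 / fact n \<le> F * f1 * q powr \<rho>1 / fact n"
        using f_nonneg by (intro divide_right_mono mult_left_mono) auto
      also have "\<dots> = q powr (r1 + \<rho>1 + \<rho>2) / fact n"
        by (simp add: F_def f1_def q_def powr_add mult_ac del: fact_Suc)
      also have "q powr (r1 + \<rho>1 + \<rho>2) = q * q powr s"
        using q(1) by (simp add: s_def powr_diff)
      also have "q * q powr s / fact n = real (Suc n) * q powr s"
        using q(2) by simp
      also have "q powr s = real (Suc n) powr s * fact n powr s"
        unfolding q(2) by (simp add: powr_mult)
      also have "real (Suc n) * (real (Suc n) powr s * fact n powr s) \<le> 2 ^ Suc n * ((2 ^ Suc n) powr s * fact n powr s)"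
        using s by (intro mult_mono Suc_le_power2 powr_mono2) auto
      also have "(2 ^ Suc n) powr s = U ^ Suc n"
        unfolding U_def by (rule power_powr_swap) simp
      finally show ?thesis .
    qed
    have dB: "d * B \<ge> 1" using d B mult_mono[of 1 d 1 B] by simp
    show "(d * B) ^ Suc n * 2 ^ a * Z ^ (Suc n + a) * ft * (F * f1 * f2 / fact n) \<le> Y ^ (Suc n + a) * ft * fact n powr (r1 + \<rho>1 + \<rho>2 - 1)"
    proof -
      have "(d * B) ^ Suc n * 2 ^ a * Z ^ (Suc n + a) * ft * (F * f1 * f2 / fact n)
         \<le> (d * B) ^ Suc n * 2 ^ a * Z ^ (Suc n + a) * ft * (2 ^ Suc n * (U ^ Suc n * fact n powr s))"
        using fU dB ineqs f_nonneg by (intro mult_left_mono) auto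
      also have "\<dots> = ((d * B) ^ Suc n * 2 ^ (Suc n + a) * Z ^ (Suc n + a) * U ^ Suc n) * (ft * fact n powr s)"
        by (simp add: power_add mult_ac)
      also have "\<dots> \<le> ((d * B) ^ (Suc n + a) * 4 ^ (Suc n + a) * Z ^ (Suc n + a) * U ^ (Suc n + a)) * (ft * fact n powr s)"
        using dB U ineqs f_nonneg by (intro mult_right_mono mult_mono power_increasing power_mono) auto
      also have "(d * B) ^ (Suc n + a) * 4 ^ (Suc n + a) * Z ^ (Suc n + a) * U ^ (Suc n + a) = Y ^ (Suc n + a)"
        unfolding Y_def U_def s_def Z_def T_def d_def by (simp only: power_mult_distrib mult_ac)
      finally show ?thesis by (simp add: s_def mult.assoc)
    qed
  qed (use c K moment_const_nonneg in auto)
  \<comment> \<open>The power n + 1 + a of Y exceeds the order of the weight by one; the surplus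
    factor becomes the Y in the constant.\<close>
  also have "\<dots> = c ^ Suc n * K * (4 * moment_const * Y) * gs_weight (r1 + \<rho>1 + \<rho>2 - 1) t Y a n"
    by (simp add: gs_weight_def ft_def power_add mult_ac)
  finally show ?thesis using main by (simp add: P_def n_def)
qed

end

end

section \<open>Convergence and duality\<close>

lemma qker_scale:
  fixes \<phi> :: "real^'n::finite \<Rightarrow> complex"
  defines "l \<equiv> \<lambda>m. 2 powr real_of_int m"
  shows "qker \<phi> m x y = of_real (l m ^ CARD('n)) * q0 \<phi> (l m *\<^sub>R x) (l m *\<^sub>R y)"
proof -
  have "2 powr (real_of_int m * real CARD('n)) = l m ^ CARD('n)"
    unfolding l_def powr_powr[symmetric] by (rule powr_realpow) simp
  then show ?thesis by (simp add: qker_def l_def)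
qed

lemma poly_bounded_affine:
  fixes f :: "real^'n::finite \<Rightarrow> complex"
  assumes "poly_bounded f"
  shows "poly_bounded (\<lambda>y. f (c *\<^sub>R y))"
proof -
  from assms obtain N K where f: "poly_bounded_by N K f" by (auto simp: poly_bounded_def)
  have "poly_bounded_by N (K * (1 + \<bar>c\<bar>) ^ N) (\<lambda>y. f (c *\<^sub>R y))"
    unfolding poly_bounded_by_def
  proof (intro conjI allI)
    show "(\<lambda>y. f (c *\<^sub>R y)) \<in> borel_measurable borel"
      using poly_bounded_by_measurable[OF f] by measurable
    fix y :: "real^'n"
    have "1 + norm (c *\<^sub>R y) \<le> (1 + \<bar>c\<bar>) * (1 + norm y)"
      by (simp add: algebra_simps)
    then have "(1 + norm (c *\<^sub>R y)) ^ N \<le> ((1 + \<bar>c\<bar>) * (1 + norm y)) ^ N"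
      by (intro power_mono) auto
    then have "K * (1 + norm (c *\<^sub>R y)) ^ N \<le> K * ((1 + \<bar>c\<bar>) * (1 + norm y)) ^ N"
      by (rule mult_left_mono) (rule poly_bounded_by_nonneg[OF f])
    then show "cmod (f (c *\<^sub>R y)) \<le> K * (1 + \<bar>c\<bar>) ^ N * (1 + norm y) ^ N"
      using poly_bounded_byD[OF f, of "c *\<^sub>R y"] by (simp add: power_mult_distrib mult.assoc)
  qed
  then show ?thesis by (auto simp: poly_bounded_def)
qed

lemma poly_bounded_gs_decay: "smooth_fun f \<Longrightarrow> gs_decay r1 r2 A C f \<Longrightarrow> poly_bounded f"
proof (rule bounded_imp_poly_bounded)
  assume "gs_decay r1 r2 A C f"
  then show "cmod (f x) \<le> C" for x
    using gs_decayD[of r1 r2 A C f x 0 "[]"] by simp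
qed (rule smooth_measurable)

text \<open>The dilation by 2^m reduces level m to level 0; the power of 2 in front of the kernel is
  exactly the Jacobian.\<close>

lemma (in gs_kernel)
  assumes g: "poly_bounded g"
  shows integrable_qfun: "integrable lborel (\<lambda>y. g y * qker \<phi> m x y)"
    and qfun_eq: "qfun \<phi> m g x = Q (\<lambda>y. g ((1 / 2 powr real_of_int m) *\<^sub>R y)) (2 powr real_of_int m *\<^sub>R x)"
proof -
  define l where "l = 2 powr real_of_int m"
  have l: "l > 0" by (simp add: l_def)
  define G where "G y = g ((1 / l) *\<^sub>R y)" for y
  have pbG: "poly_bounded G" unfolding G_def[abs_def] by (rule poly_bounded_affine[OF g])
  define F where "F y = G y * q0 \<phi> (l *\<^sub>R x) y" for y
  have iF: "integrable lborel F" unfolding F_def[abs_def] by (rule poly_bounded_integrable_Q[OF pbG])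
  have mF [measurable]: "F \<in> borel_measurable borel" using iF by auto
  have eq: "g y * qker \<phi> m x y = of_real (l ^ CARD('n)) * F (0 + l *\<^sub>R y)" for y
    using l by (simp add: F_def G_def qker_scale l_def[symmetric] mult_ac)
  have iF': "integrable lborel (\<lambda>y. F (0 + l *\<^sub>R y))"
    using iF l by (subst lborel_integrable_affine) auto
  then show "integrable lborel (\<lambda>y. g y * qker \<phi> m x y)"
    unfolding eq by (rule integrable_mult_right)
  have "qfun \<phi> m g x = of_real (l ^ CARD('n)) * (\<integral>y. F (0 + l *\<^sub>R y) \<partial>lborel)"
    unfolding qfun_def eq by simp
  also have "\<dots> = integral\<^sup>L lborel F"
    using l by (subst lborel_integral_affine[of F l 0]) (simp_all add: scaleR_conv_of_real)
  finally show "qfun \<phi> m g x = Q (\<lambda>y. g ((1 / 2 powr real_of_int m) *\<^sub>R y)) (2 powr real_of_int m *\<^sub>R x)"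
    by (simp add: Q_def F_def[abs_def] G_def l_def)
qed

text \<open>With n derivatives, undoing the dilation costs 2^(mn), while the error at level 0
  carries 2^(-m(n+1)), so one factor 2^(-m) remains. The rate \<open>Y\<close> is independent of m,
  hence all errors lie in one step space.\<close>

lemma (in gs_kernel) qfun_error:
  fixes g :: "real^'n \<Rightarrow> complex" and r1 t B K :: real and m :: nat
  assumes mom: "\<And>js u. moment js u = (if js = [] then 1 else 0)"
    and g: "smooth_fun g" "gs_decay r1 t B K g" and B: "B \<ge> 1" and r1: "r1 \<ge> 0" and t: "t \<ge> \<rho>2" and \<rho>21: "\<rho>2 \<ge> 1"
  defines "Y \<equiv> 4 * real CARD('n) * B * (2 * A2 * A2 * 2 powr \<rho>2 * B) * 2 powr (r1 + \<rho>1 + \<rho>2 - 1)"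
  shows "smooth_fun (qfun \<phi> (int m) g)"
    and "gs_decay (r1 + \<rho>1 + \<rho>2 - 1) t Y (K * (4 * moment_const * Y) / 2 ^ m) (\<lambda>x. qfun \<phi> (int m) g x - g x)"
proof -
  define l :: real where "l = 2 ^ m"
  have l: "l \<ge> 1" by (simp add: l_def)
  have l_powr: "2 powr real m = l"
    by (simp add: l_def powr_realpow)
  define c where "c = 1 / l"
  have c: "0 < c" "c \<le> 1" "c * l = 1" using l by (auto simp: c_def)
  define G where "G = (\<lambda>y. g (c *\<^sub>R y))"
  have G: "smooth_fun G" "pdl js G x = of_real c ^ length js * pdl js g (c *\<^sub>R x)" for js x
    using smooth_affine[OF g(1), where c = c and b = 0] unfolding G_def by simp_all
  have pbg: "poly_bounded g" by (rule poly_bounded_gs_decay[OF g])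
  have pbG: "poly_bounded G" unfolding G_def by (rule poly_bounded_affine[OF pbg])
  have sQ: "smooth_fun (Q G)" using pbG smooth_Q unfolding poly_bounded_def by blast
  have qf: "qfun \<phi> (int m) g = (\<lambda>x. Q G (l *\<^sub>R x + 0))"
    using qfun_eq[OF pbg, of "int m"] by (simp add: fun_eq_iff l_powr G_def c_def)
  show sm: "smooth_fun (qfun \<phi> (int m) g)"
    unfolding qf by (rule smooth_affine(1)[OF sQ])
  show "gs_decay (r1 + \<rho>1 + \<rho>2 - 1) t Y (K * (4 * moment_const * Y) / 2 ^ m) (\<lambda>x. qfun \<phi> (int m) g x - g x)"
    unfolding gs_decay_def
  proof (intro allI)
    fix js :: "'n list" and a :: nat and x :: "real^'n"
    let ?n = "length (js :: 'n list)"
    have clx: "c *\<^sub>R (l *\<^sub>R x) = x"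
      using c(3) by simp
    have p1: "pdl js (qfun \<phi> (int m) g) = (\<lambda>x. of_real l ^ ?n * pdl js (Q G) (l *\<^sub>R x + 0))"
      unfolding qf by (rule smooth_affine(2)[OF sQ])
    have "pdl js (\<lambda>x. qfun \<phi> (int m) g x - g x) x = of_real l ^ ?n * pdl js (Q G) (l *\<^sub>R x) - pdl js g x"
      unfolding smooth_diff(2)[OF sm g(1)] p1 by simp
    also have "pdl js g x = of_real l ^ ?n * pdl js G (l *\<^sub>R x)"
    proof -
      have "complex_of_real l ^ ?n * of_real c ^ ?n = of_real ((c * l) ^ ?n)"
        by (simp add: power_mult_distrib)
      then have "of_real l ^ ?n * (of_real c ^ ?n * pdl js g x) = pdl js g x"
        unfolding c(3) by (simp flip: mult.assoc)
      then show ?thesis unfolding G(2) clx by simp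
    qed
    also have "of_real l ^ ?n * pdl js (Q G) (l *\<^sub>R x) - \<dots> = of_real l ^ ?n * (pdl js (Q G) (l *\<^sub>R x) - pdl js G (l *\<^sub>R x))"
      by (simp add: algebra_simps)
    finally have eq: "cmod (pdl js (\<lambda>x. qfun \<phi> (int m) g x - g x) x) = l ^ ?n * cmod (pdl js (Q G) (l *\<^sub>R x) - pdl js G (l *\<^sub>R x))"
      using l by (simp add: norm_mult norm_power)
    have "norm (c *\<^sub>R (l *\<^sub>R x)) ^ a * cmod (pdl js (Q G) (l *\<^sub>R x) - pdl js G (l *\<^sub>R x))
      \<le> c ^ Suc ?n * K * (4 * moment_const * Y) * gs_weight (r1 + \<rho>1 + \<rho>2 - 1) t Y a ?n"
      unfolding G_def Y_def by (rule error_bound[OF mom g B r1 t \<rho>21 c(1,2)])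
    then have "norm x ^ a * cmod (pdl js (Q G) (l *\<^sub>R x) - pdl js G (l *\<^sub>R x))
      \<le> c ^ Suc ?n * K * (4 * moment_const * Y) * gs_weight (r1 + \<rho>1 + \<rho>2 - 1) t Y a ?n"
      unfolding clx .
    then have "l ^ ?n * (norm x ^ a * cmod (pdl js (Q G) (l *\<^sub>R x) - pdl js G (l *\<^sub>R x)))
      \<le> l ^ ?n * (c ^ Suc ?n * K * (4 * moment_const * Y) * gs_weight (r1 + \<rho>1 + \<rho>2 - 1) t Y a ?n)"
      by (rule mult_left_mono) (use l in simp)
    also have "\<dots> = (c * l) ^ ?n * (c * K * (4 * moment_const * Y) * gs_weight (r1 + \<rho>1 + \<rho>2 - 1) t Y a ?n)"
      by (simp add: power_mult_distrib mult_ac)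
    also have "\<dots> = K * (4 * moment_const * Y) / 2 ^ m * gs_weight (r1 + \<rho>1 + \<rho>2 - 1) t Y a ?n"
      unfolding c(3) by (simp add: c_def l_def)
    finally show "norm x ^ a * cmod (pdl js (\<lambda>x. qfun \<phi> (int m) g x - g x) x) \<le> K * (4 * moment_const * Y) / 2 ^ m * gs_weight (r1 + \<rho>1 + \<rho>2 - 1) t Y a ?n"
      unfolding eq by (simp add: mult_ac)
  qed
qed

lemma gs_bound_mono: "gs_bound r1 r2 h f C \<Longrightarrow> C \<le> D \<Longrightarrow> gs_bound r1 r2 h f D"
  unfolding gs_bound_def by (meson order_trans)

text \<open>Every neighbourhood of 0 contains a ball of each step norm, so convergence in a single
  step norm implies convergence in the inductive limit.\<close>

lemma gs_tendstoI:
  fixes f :: "real^'n::finite \<Rightarrow> complex"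
  assumes f: "f \<in> GS r1 r2" and r: "r1 \<ge> 0" "r2 \<ge> 0" and A: "A > 0"
    and F: "\<And>m. smooth_fun (F m)" and gs_decay: "\<And>m. gs_decay r1 r2 A (C m) (\<lambda>x. F m x - f x)"
    and C: "C \<longlonglongrightarrow> 0"
  shows "gs_tendsto r1 r2 F f"
  unfolding gs_tendsto_def
proof (intro conjI allI impI f)
  have sf: "smooth_fun f" using GS_D[OF f r] by blast
  have sd: "smooth_fun (\<lambda>x. F m x - f x)" for m
    by (rule smooth_diff(1)[OF F sf])
  have d: "(\<lambda>x. F m x - f x) \<in> GS r1 r2" for m
    by (rule GS_I[OF sd gs_decay A r])
  show "F m \<in> GS r1 r2" for m
    using GS_lincomb[OF d[of m] f r, of 1 1] by simp
  fix U :: "(real^'n \<Rightarrow> complex) set" assume U: "gs_nbhd0 r1 r2 U"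
  then obtain \<epsilon> where \<epsilon>: "\<epsilon> > 0" "\<And>f. schwartz f \<and> gs_bound r1 r2 (step_scale r1 r2 A CARD('n)) f \<epsilon> \<Longrightarrow> f \<in> U"
    using step_scale_pos[OF A] unfolding gs_nbhd0_def by metis
  have "\<forall>\<^sub>F m in sequentially. C m < \<epsilon>"
    using C \<epsilon>(1) by (rule order_tendstoD)
  then show "\<forall>\<^sub>F m in sequentially. (\<lambda>x. F m x - f x) \<in> U"
  proof eventually_elim
    case (elim m)
    have "gs_bound r1 r2 (step_scale r1 r2 A CARD('n)) (\<lambda>x. F m x - f x) (C m)"
      by (rule gs_decay_imp_gs_bound[OF sd gs_decay A r])
    then show ?case
      using elim by (intro \<epsilon>(2) conjI gs_decay_imp_schwartz[OF sd gs_decay]) (auto elim: gs_bound_mono)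
  qed
qed

definition gs_linear :: "real \<Rightarrow> real \<Rightarrow> ((real^'n::finite \<Rightarrow> complex) \<Rightarrow> complex) \<Rightarrow> bool" where
  "gs_linear r1 r2 T \<longleftrightarrow> (\<forall>f\<in>GS r1 r2. \<forall>g\<in>GS r1 r2. \<forall>a b::complex. T (\<lambda>x. a * f x + b * g x) = a * T f + b * T g)"

lemma gs_linearD: "gs_linear r1 r2 T \<Longrightarrow> f \<in> GS r1 r2 \<Longrightarrow> g \<in> GS r1 r2 \<Longrightarrow> T (\<lambda>x. a * f x + b * g x) = a * T f + b * T g"
  unfolding gs_linear_def by blast

lemma gs_linear_mult: "gs_linear r1 r2 T \<Longrightarrow> f \<in> GS r1 r2 \<Longrightarrow> T (\<lambda>x. a * f x) = a * T f"
  using gs_linearD[of r1 r2 T f f a 0] by simp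

lemma gs_linear_add: "gs_linear r1 r2 T \<Longrightarrow> f \<in> GS r1 r2 \<Longrightarrow> g \<in> GS r1 r2 \<Longrightarrow> T (\<lambda>x. f x + g x) = T f + T g"
  using gs_linearD[of r1 r2 T f g 1 1] by simp

lemma gs_dual_linear: "gs_dual r1 r2 T \<Longrightarrow> gs_linear r1 r2 T"
  by (simp add: gs_dual_def gs_linear_def)

text \<open>A neighbourhood on which |T| < 1 contains a ball of radius \<epsilon> of the step norm
  belonging to A, and scaling turns this into the bound with constant 1/\<epsilon>.\<close>

lemma gs_dual_bound:
  fixes T :: "(real^'n::finite \<Rightarrow> complex) \<Rightarrow> complex"
  assumes T: "gs_dual r1 r2 T" and r: "r1 \<ge> 0" "r2 \<ge> 0" and A: "A > 0"
  obtains K where "K \<ge> 0" "\<And>f C. smooth_fun f \<Longrightarrow> gs_decay r1 r2 A C f \<Longrightarrow> cmod (T f) \<le> K * C"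
proof -
  note lin = gs_dual_linear[OF T]
  obtain U where U: "gs_nbhd0 r1 r2 U" "\<And>f. f \<in> U \<Longrightarrow> cmod (T f) < 1"
    using T unfolding gs_dual_def by (metis zero_less_one)
  then obtain \<epsilon> where \<epsilon>: "\<epsilon> > 0" "\<And>f. schwartz f \<and> gs_bound r1 r2 (step_scale r1 r2 A CARD('n)) f \<epsilon> \<Longrightarrow> f \<in> U"
    using step_scale_pos[OF A] unfolding gs_nbhd0_def by metis
  have pos: "cmod (T f) \<le> C / \<epsilon>" if f: "smooth_fun f" "gs_decay r1 r2 A C f" and C: "C > 0" for f C
  proof -
    let ?a = "complex_of_real (\<epsilon> / C)"
    have sf: "smooth_fun (\<lambda>x. ?a * f x)" by (rule smooth_mult_left(1)[OF f(1)])
    have "gs_decay r1 r2 A (cmod ?a * C) (\<lambda>x. ?a * f x)" by (rule gs_decay_mult_left[OF f A])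
    moreover have "cmod ?a * C = \<epsilon>" using \<epsilon>(1) C by (simp add: norm_divide)
    ultimately have i: "gs_decay r1 r2 A \<epsilon> (\<lambda>x. ?a * f x)" by simp
    have "(\<lambda>x. ?a * f x) \<in> U"
      by (intro \<epsilon>(2) conjI gs_decay_imp_schwartz[OF sf i] gs_decay_imp_gs_bound[OF sf i A r])
    then have "cmod (T (\<lambda>x. ?a * f x)) < 1" by (rule U(2))
    moreover have "T (\<lambda>x. ?a * f x) = ?a * T f"
      by (rule gs_linear_mult[OF lin GS_I[OF f A r]])
    ultimately have "(\<epsilon> / C) * cmod (T f) < 1"
      using \<epsilon>(1) C by (simp add: norm_mult norm_divide)
    then show ?thesis using \<epsilon>(1) C by (simp add: field_simps)
  qed
  \<comment> \<open>\<open>C\<close> may be 0, where scaling by \<epsilon>/C is impossible; an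
    arbitrarily small increase of \<open>C\<close> covers that case.\<close>
  have "cmod (T f) \<le> 1 / \<epsilon> * C" if f: "smooth_fun f" "gs_decay r1 r2 A C f" for f C
  proof (rule field_le_epsilon)
    fix \<delta> :: real assume \<delta>: "\<delta> > 0"
    have C: "C \<ge> 0" by (rule gs_decay_nonneg[OF f(2)])
    have "gs_decay r1 r2 A (C + \<epsilon> * \<delta>) f"
      by (rule gs_decay_mono[OF f(2)]) (use A \<epsilon> \<delta> in auto)
    then have "cmod (T f) \<le> (C + \<epsilon> * \<delta>) / \<epsilon>"
      by (rule pos[OF f(1)]) (use C \<epsilon> \<delta> in \<open>simp add: add_nonneg_pos\<close>)
    then show "cmod (T f) \<le> 1 / \<epsilon> * C + \<delta>"
      using \<epsilon>(1) by (simp add: field_simps)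
  qed
  then show ?thesis using that[of "1 / \<epsilon>"] \<epsilon>(1) by simp
qed

text \<open>Polars of families of functionals that are equicontinuous on every step space are
  neighbourhoods of zero; this replaces any appeal to the regularity of the inductive limit.\<close>

lemma gs_nbhd0_polar:
  fixes L :: "'i \<Rightarrow> (real^'n::finite \<Rightarrow> complex) \<Rightarrow> complex"
  assumes lin: "\<And>i. gs_linear r1 r2 (L i)" and r: "r1 \<ge> 0" "r2 \<ge> 0" and \<epsilon>: "\<epsilon> > 0"
    and bound: "\<And>A. A \<ge> 1 \<Longrightarrow> \<exists>K. \<forall>i f C. smooth_fun f \<longrightarrow> gs_decay r1 r2 A C f \<longrightarrow> cmod (L i f) \<le> K * C"
  shows "gs_nbhd0 r1 r2 {f \<in> GS r1 r2. \<forall>i. cmod (L i f) \<le> \<epsilon>}"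
  unfolding gs_nbhd0_def
proof (intro conjI ballI allI impI)
  show "{f \<in> GS r1 r2. \<forall>i. cmod (L i f) \<le> \<epsilon>} \<subseteq> GS r1 r2" by blast
next
  fix f g and a b :: complex
  assume f: "f \<in> {f \<in> GS r1 r2. \<forall>i. cmod (L i f) \<le> \<epsilon>}" and g: "g \<in> {f \<in> GS r1 r2. \<forall>i. cmod (L i f) \<le> \<epsilon>}"
    and ab: "cmod a + cmod b \<le> 1"
  have "cmod (L i (\<lambda>x. a * f x + b * g x)) \<le> \<epsilon>" for i
  proof -
    have "cmod (L i (\<lambda>x. a * f x + b * g x)) \<le> cmod a * cmod (L i f) + cmod b * cmod (L i g)"
      using f g by (simp add: gs_linearD[OF lin]) (metis norm_mult norm_triangle_ineq)
    also have "\<dots> \<le> cmod a * \<epsilon> + cmod b * \<epsilon>"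
      using f g by (intro add_mono mult_left_mono) auto
    also have "\<dots> = (cmod a + cmod b) * \<epsilon>" by (simp add: algebra_simps)
    also have "\<dots> \<le> 1 * \<epsilon>" using ab \<epsilon> by (intro mult_right_mono) auto
    finally show ?thesis by simp
  qed
  then show "(\<lambda>x. a * f x + b * g x) \<in> {f \<in> GS r1 r2. \<forall>i. cmod (L i f) \<le> \<epsilon>}"
    using f g r by (auto intro: GS_lincomb)
next
  fix h :: real assume h: "h > 0"
  define A where "A = max 1 (real CARD('n) / h)"
  have A: "A \<ge> 1" by (simp add: A_def)
  obtain K where K: "\<And>i f C. smooth_fun f \<Longrightarrow> gs_decay r1 r2 A C f \<Longrightarrow> cmod (L i f) \<le> K * C"
    using bound[OF A] by blast
  \<comment> \<open>\<open>bound\<close> gives no sign for \<open>K\<close>; |K| + 1 is positive in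
    every case.\<close>
  define \<delta> where "\<delta> = \<epsilon> / (\<bar>K\<bar> + 1)"
  have \<delta>: "\<delta> > 0" using \<epsilon> by (simp add: \<delta>_def)
  have K\<delta>: "K * \<delta> \<le> \<epsilon>"
  proof -
    have "K * \<delta> \<le> (\<bar>K\<bar> + 1) * \<delta>" using \<delta> by (intro mult_right_mono) auto
    then show ?thesis by (simp add: \<delta>_def add_nonneg_eq_0_iff)
  qed
  show "\<exists>\<epsilon>'>0. \<forall>f. schwartz f \<and> gs_bound r1 r2 h f \<epsilon>' \<longrightarrow> f \<in> {f \<in> GS r1 r2. \<forall>i. cmod (L i f) \<le> \<epsilon>}"
  proof (intro exI[of _ \<delta>] conjI \<delta> allI impI)
    fix f :: "real^'n \<Rightarrow> complex" assume f: "schwartz f \<and> gs_bound r1 r2 h f \<delta>"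
    then have sf: "smooth_fun f" by (simp add: schwartz_def)
    have "gs_decay r1 r2 (real CARD('n) / h) \<delta> f"
      using f by (intro gs_bound_imp_gs_decay[OF sf _ h r]) auto
    then have "gs_decay r1 r2 A \<delta> f"
      by (rule gs_decay_mono) (use h in \<open>auto simp: A_def\<close>)
    then have "cmod (L i f) \<le> \<epsilon>" for i
      using K[OF sf, of \<delta> i] K\<delta> by linarith
    moreover have "f \<in> GS r1 r2" using f h by (auto simp: GS_def)
    ultimately show "f \<in> {f \<in> GS r1 r2. \<forall>i. cmod (L i f) \<le> \<epsilon>}" by simp
  qed
qed

text \<open>Boundedness on all step spaces gives continuity: the polar of a family with one member
  is a neighbourhood of 0. It is taken at level \<epsilon>/2 because \<open>gs_dual\<close> asks for
  a strict inequality.\<close>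

lemma gs_dualI:
  fixes T :: "(real^'n::finite \<Rightarrow> complex) \<Rightarrow> complex"
  assumes lin: "gs_linear r1 r2 T" and r: "r1 \<ge> 0" "r2 \<ge> 0"
    and bound: "\<And>A. A \<ge> 1 \<Longrightarrow> \<exists>K. \<forall>f C. smooth_fun f \<longrightarrow> gs_decay r1 r2 A C f \<longrightarrow> cmod (T f) \<le> K * C"
  shows "gs_dual r1 r2 T"
  unfolding gs_dual_def
proof (intro conjI allI impI)
  show "\<forall>f\<in>GS r1 r2. \<forall>g\<in>GS r1 r2. \<forall>a b. T (\<lambda>x. a * f x + b * g x) = a * T f + b * T g"
    using lin by (simp add: gs_linear_def)
  fix \<epsilon> :: real assume \<epsilon>: "\<epsilon> > 0"
  have "gs_nbhd0 r1 r2 {f \<in> GS r1 r2. \<forall>i::unit. cmod (T f) \<le> \<epsilon> / 2}"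
    using bound by (intro gs_nbhd0_polar[where L = "\<lambda>_. T"] lin r) (use \<epsilon> in auto)
  then show "\<exists>U. gs_nbhd0 r1 r2 U \<and> (\<forall>f\<in>U. cmod (T f) < \<epsilon>)"
    using \<epsilon> by (intro exI conjI) auto
qed

section \<open>Expansion of an ultradistribution\<close>

lemma gs_linear_sum:
  fixes f :: "nat \<Rightarrow> real^'n::finite \<Rightarrow> complex"
  assumes lin: "gs_linear r1 r2 T" and f: "\<And>n. f n \<in> GS r1 r2" and r: "r1 \<ge> 0" "r2 \<ge> 0"
  shows "T (\<lambda>x. \<Sum>n<N. f n x) = (\<Sum>n<N. T (f n)) \<and> (\<lambda>x. \<Sum>n<N. f n x) \<in> GS r1 r2"
proof (induction N)
  case 0
  have "T (\<lambda>x. 0) = 0" "(\<lambda>x::real^'n. 0) \<in> GS r1 r2"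
    using gs_linearD[OF lin f[of 0] f[of 0], of 0 0] GS_lincomb[OF f[of 0] f[of 0] r, of 0 0] by simp_all
  then show ?case by simp
next
  case (Suc N)
  then show ?case
    using gs_linear_add[OF lin, of "\<lambda>x. \<Sum>n<N. f n x" "f N"] GS_lincomb[OF _ f[of N] r, of "\<lambda>x. \<Sum>n<N. f n x" 1 1] f by simp
qed

lemma norm_power_split:
  fixes y k :: "real^'n::finite"
  assumes "l > 0"
  shows "norm y ^ a \<le> (2 / l) ^ a * (norm (l *\<^sub>R y - k) ^ a + norm k ^ a)"
    and "norm k ^ a \<le> 2 ^ a * (norm (l *\<^sub>R y) ^ a + norm (l *\<^sub>R y - k) ^ a)"
proof -
  have "l * norm y \<le> norm (l *\<^sub>R y - k) + norm k"
    using norm_triangle_ineq[of "l *\<^sub>R y - k" k] assms by simp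
  then have "(l * norm y) ^ a \<le> (norm (l *\<^sub>R y - k) + norm k) ^ a"
    using assms by (intro power_mono) auto
  also have "\<dots> \<le> 2 ^ a * (norm (l *\<^sub>R y - k) ^ a + norm k ^ a)"
    by (intro add_power_le) auto
  finally have "l ^ a * norm y ^ a \<le> 2 ^ a * (norm (l *\<^sub>R y - k) ^ a + norm k ^ a)"
    by (simp add: power_mult_distrib)
  then show "norm y ^ a \<le> (2 / l) ^ a * (norm (l *\<^sub>R y - k) ^ a + norm k ^ a)"
    using assms by (simp add: power_divide field_simps)
  have "norm k \<le> norm (l *\<^sub>R y) + norm (l *\<^sub>R y - k)"
    using norm_triangle_ineq4[of "l *\<^sub>R y" "l *\<^sub>R y - k"] by simp
  then have "norm k ^ a \<le> (norm (l *\<^sub>R y) + norm (l *\<^sub>R y - k)) ^ a"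
    by (intro power_mono) auto
  also have "\<dots> \<le> 2 ^ a * (norm (l *\<^sub>R y) ^ a + norm (l *\<^sub>R y - k) ^ a)"
    by (intro add_power_le) auto
  finally show "norm k ^ a \<le> 2 ^ a * (norm (l *\<^sub>R y) ^ a + norm (l *\<^sub>R y - k) ^ a)" .
qed

context gs_kernel
begin

text \<open>Coefficient sequences with Gelfand-Shilov decay of order t along the lattice. The
  summable factor \<omega> is kept explicit: truncating it bounds the tails of a lattice series in
  one fixed step norm.\<close>

definition decaying :: "real \<Rightarrow> real \<Rightarrow> real \<Rightarrow> (nat \<Rightarrow> complex) \<Rightarrow> (nat \<Rightarrow> real) \<Rightarrow> bool" where
  "decaying t B K c \<omega> \<longleftrightarrow> summable \<omega> \<and> (\<forall>n. \<omega> n \<ge> 0) \<and>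
     (\<forall>n a. norm (lat n :: real^'n) ^ a * cmod (c n) \<le> K * (B ^ a * fact a powr t) * \<omega> n)"

lemma decaying_le: "decaying t B K c \<omega> \<Longrightarrow> cmod (c n) \<le> K * \<omega> n"
  unfolding decaying_def by (elim conjE allE[of _ n] allE[of _ 0]) simp

lemma decaying_mono:
  "decaying t B K c \<omega> \<Longrightarrow> (\<And>n. cmod (c' n) \<le> cmod (c n)) \<Longrightarrow> decaying t B K c' \<omega>"
  unfolding decaying_def by (meson mult_left_mono order_trans norm_ge_zero zero_le_power)

section \<open>Lattice series at scale l as elements of the Gelfand-Shilov space\<close>

context
  fixes s t l :: real
  assumes st: "s \<ge> \<rho>1" "t \<ge> \<rho>2" and l: "l > 0"
begin

text \<open>Derivatives produce powers of l, powers of the norm of y produce powers of 2 / l; the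
  factor 2 (l + 1 / l) dominates both, whether l is large or small.\<close>

definition rate :: "real \<Rightarrow> real" where "rate B = 2 * (l + 1 / l) * A2 * B"

lemma rate_pos: "B \<ge> 1 \<Longrightarrow> rate B > 0"
  unfolding rate_def using A2 l by (intro mult_pos_pos add_pos_pos) auto

text \<open>Powers of the norm of y are shared between l y - lat n, where \<phi> decays, and lat n,
  where the coefficient decays.\<close>

lemma term_bound:
  fixes y :: "real^'n"
  assumes c: "decaying t B K c \<omega>" and B: "B \<ge> 1" and K: "K \<ge> 0"
  shows "norm y ^ a * (l ^ length js * (cmod (c n) * cmod (pdl js \<phi> (l *\<^sub>R y - lat n))))
     \<le> 2 * D 0 * K * \<omega> n * gs_weight s t (rate B) a (length js)"
proof -
  define k :: "real^'n" where "k = lat n"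
  define z where "z = l *\<^sub>R y - k"
  define p where "p = cmod (pdl js \<phi> z)"
  define j where "j = length js"
  have \<omega>: "\<omega> n \<ge> 0" using c by (simp add: decaying_def)
  have 1: "norm z ^ a * p \<le> D 0 * gs_weight s t (A2 * B) a j" for a
  proof -
    have "norm z ^ a * p \<le> D 0 * gs_weight \<rho>1 \<rho>2 A2 a j * wt z"
      unfolding p_def j_def by (rule decay_a)
    also have "\<dots> \<le> D 0 * gs_weight \<rho>1 \<rho>2 A2 a j * 1"
      using D_nonneg gs_weight_A2_nonneg wt_le_1 by (intro mult_left_mono mult_nonneg_nonneg) auto
    also have "\<dots> \<le> D 0 * gs_weight s t (A2 * B) a j * 1"
    proof -
      have "A2 \<le> A2 * B" using A2 B by simp
      then show ?thesis using A2 st D_nonneg[of 0] by (intro mult_right_mono mult_left_mono gs_weight_mono) auto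
    qed
    finally show ?thesis by simp
  qed
  have 2: "norm z ^ a * p * cmod (c n) \<le> D 0 * gs_weight s t (A2 * B) a j * (K * \<omega> n)"
    by (intro mult_mono 1 decaying_le[OF c])
       (use D_nonneg[of 0] gs_weight_pos[of "A2 * B"] A2 B in \<open>auto intro!: mult_nonneg_nonneg simp: less_imp_le p_def\<close>)
  have 3: "norm k ^ a * cmod (c n) * p \<le> K * (B ^ a * fact a powr t) * \<omega> n * (D 0 * (A2 ^ j * fact j powr s))"
  proof (rule mult_mono)
    show "norm k ^ a * cmod (c n) \<le> K * (B ^ a * fact a powr t) * \<omega> n"
      using c unfolding decaying_def k_def by blast
    have "p \<le> D 0 * gs_weight \<rho>1 \<rho>2 A2 0 j * wt z"
      using decay_a[of z 0 js] by (simp add: p_def j_def)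
    also have "\<dots> \<le> D 0 * gs_weight s t A2 0 j * 1"
      using A2 st D_nonneg[of 0] gs_weight_A2_nonneg wt_le_1[of z] less_imp_le[OF wt_pos[of z]]
      by (intro mult_mono mult_left_mono gs_weight_mono mult_nonneg_nonneg) auto
    finally show "p \<le> D 0 * (A2 ^ j * fact j powr s)" by (simp add: gs_weight_def)
  qed (use K B \<omega> in \<open>auto simp: p_def\<close>)
  have 4: "K * (B ^ a * fact a powr t) * \<omega> n * (D 0 * (A2 ^ j * fact j powr s)) \<le> D 0 * gs_weight s t (A2 * B) a j * (K * \<omega> n)"
  proof -
    have "B ^ a * A2 ^ j \<le> B ^ (a + j) * A2 ^ (a + j)"
      using A2 B by (intro mult_mono power_increasing) auto
    then have "(B ^ a * A2 ^ j) * (fact a powr t * fact j powr s * (D 0 * (K * \<omega> n))) \<le> (B ^ (a + j) * A2 ^ (a + j)) * (fact a powr t * fact j powr s * (D 0 * (K * \<omega> n)))"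
      using D_nonneg[of 0] K \<omega> by (intro mult_right_mono) auto
    then show ?thesis by (simp add: gs_weight_def power_mult_distrib mult_ac)
  qed
  have "norm y ^ a * (l ^ j * (cmod (c n) * p)) \<le> ((2 / l) ^ a * (norm z ^ a + norm k ^ a)) * (l ^ j * (cmod (c n) * p))"
    using l unfolding z_def by (intro mult_right_mono norm_power_split) (auto simp: p_def)
  also have "\<dots> = (2 / l) ^ a * l ^ j * (norm z ^ a * p * cmod (c n) + norm k ^ a * cmod (c n) * p)"
    by (simp add: algebra_simps)
  also have "\<dots> \<le> (2 / l) ^ a * l ^ j * (D 0 * gs_weight s t (A2 * B) a j * (K * \<omega> n) + D 0 * gs_weight s t (A2 * B) a j * (K * \<omega> n))"
    using l 2 order_trans[OF 3 4] by (intro mult_left_mono add_mono) auto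
  also have "\<dots> = 2 * D 0 * K * \<omega> n * ((2 / l) ^ a * l ^ j * gs_weight s t (A2 * B) a j)"
    by (simp add: algebra_simps)
  also have "\<dots> \<le> 2 * D 0 * K * \<omega> n * ((2 * (l + 1 / l)) ^ a * (2 * (l + 1 / l)) ^ j * gs_weight s t (A2 * B) a j)"
  proof -
    have "(2 / l) ^ a \<le> (2 * (l + 1 / l)) ^ a" "l ^ j \<le> (2 * (l + 1 / l)) ^ j"
      using l by (auto intro!: power_mono)
    then show ?thesis
      using l D_nonneg[of 0] K \<omega> gs_weight_pos[of "A2 * B"] A2 B
      by (intro mult_left_mono mult_right_mono mult_mono mult_nonneg_nonneg) (auto simp: less_imp_le)
  qed
  also have "(2 * (l + 1 / l)) ^ a * (2 * (l + 1 / l)) ^ j * gs_weight s t (A2 * B) a j = gs_weight s t (rate B) a j"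
    by (simp add: gs_weight_def rate_def power_add power_mult_distrib mult_ac)
  finally show ?thesis by (simp add: p_def z_def k_def j_def)
qed

lemma
  assumes c: "decaying t B K c \<omega>" and B: "B \<ge> 1" and K: "K \<ge> 0"
  shows smooth_lattice_series_scaled: "smooth_fun (\<lambda>y. lattice_series c (l *\<^sub>R y))"
    and gs_decay_lattice_series_scaled: "gs_decay s t (rate B) (2 * D 0 * K * suminf \<omega>) (\<lambda>y. lattice_series c (l *\<^sub>R y))"
    and gs_decay_term_scaled: "gs_decay s t (rate B) (2 * D 0 * K * \<omega> n) (\<lambda>y. c n * \<phi> (l *\<^sub>R y - lat n))"
    and summable_lattice_series_scaled: "summable (\<lambda>n. cmod (c n * \<phi> (x - lat n)))"
proof -
  have \<omega>: "summable \<omega>" "\<And>n. \<omega> n \<ge> 0" using c by (auto simp: decaying_def)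
  have bd: "cmod (c n) \<le> (K * suminf \<omega>) * (1 + norm (lat n :: real^'n)) ^ 0" for n
  proof -
    have "\<omega> n \<le> suminf \<omega>"
      using sum_le_suminf[OF \<omega>(1), of "{n}"] \<omega>(2) by simp
    then have "K * \<omega> n \<le> K * suminf \<omega>" using K by (rule mult_left_mono)
    then show ?thesis using decaying_le[OF c, of n] by simp
  qed
  show "summable (\<lambda>n. cmod (c n * \<phi> (x - lat n)))"
    using summable_lattice_series[OF bd, of "[]" x] by simp
  have sS: "smooth_fun (lattice_series c)" by (rule smooth_lattice_series[OF bd])
  have eq: "(\<lambda>y. lattice_series c (l *\<^sub>R y)) = (\<lambda>y. lattice_series c (l *\<^sub>R y + 0))" by simp
  show "smooth_fun (\<lambda>y. lattice_series c (l *\<^sub>R y))"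
    unfolding eq by (rule smooth_affine(1)[OF sS])
  show "gs_decay s t (rate B) (2 * D 0 * K * suminf \<omega>) (\<lambda>y. lattice_series c (l *\<^sub>R y))"
    unfolding gs_decay_def
  proof (intro allI)
    fix js :: "'n list" and a :: nat and y :: "real^'n"
    have "pdl js (\<lambda>y. lattice_series c (l *\<^sub>R y)) y = of_real l ^ length js * (\<Sum>n. c n * pdl js \<phi> (l *\<^sub>R y - lat n))"
      unfolding eq smooth_affine(2)[OF sS] pdl_lattice_series[OF bd] by simp
    then have "norm y ^ a * cmod (pdl js (\<lambda>y. lattice_series c (l *\<^sub>R y)) y)
       \<le> norm y ^ a * (l ^ length js * (\<Sum>n. cmod (c n * pdl js \<phi> (l *\<^sub>R y - lat n))))"
      using l summable_norm[OF summable_lattice_series[OF bd, of js "l *\<^sub>R y"]]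
      by (auto simp: norm_mult norm_power intro!: mult_left_mono)
    also have "\<dots> = (\<Sum>n. norm y ^ a * (l ^ length js * cmod (c n * pdl js \<phi> (l *\<^sub>R y - lat n))))"
      by (simp only: suminf_mult summable_mult summable_lattice_series[OF bd])
    also have "\<dots> \<le> (\<Sum>n. 2 * D 0 * K * gs_weight s t (rate B) a (length js) * \<omega> n)"
    proof (intro suminf_le summable_mult summable_lattice_series[OF bd] \<omega>)
      show "norm y ^ a * (l ^ length js * cmod (c n * pdl js \<phi> (l *\<^sub>R y - lat n))) \<le> 2 * D 0 * K * gs_weight s t (rate B) a (length js) * \<omega> n" for n
        using term_bound[OF c B K, of y a js n] by (simp add: norm_mult mult_ac)
    qed
    also have "\<dots> = 2 * D 0 * K * gs_weight s t (rate B) a (length js) * suminf \<omega>"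
      by (rule suminf_mult[OF \<omega>(1)])
    finally show "norm y ^ a * cmod (pdl js (\<lambda>y. lattice_series c (l *\<^sub>R y)) y) \<le> 2 * D 0 * K * suminf \<omega> * gs_weight s t (rate B) a (length js)"
      by (simp add: mult_ac)
  qed
  show "gs_decay s t (rate B) (2 * D 0 * K * \<omega> n) (\<lambda>y. c n * \<phi> (l *\<^sub>R y - lat n))"
    unfolding gs_decay_def
  proof (intro allI)
    fix js :: "'n list" and a :: nat and y :: "real^'n"
    have sa: "smooth_fun (\<lambda>y. \<phi> (l *\<^sub>R y + (- lat n)))" by (rule smooth_affine(1)[OF smooth])
    have "pdl js (\<lambda>y. c n * \<phi> (l *\<^sub>R y + (- lat n))) y = c n * (of_real l ^ length js * pdl js \<phi> (l *\<^sub>R y + (- lat n)))"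
      unfolding smooth_mult_left(2)[OF sa] smooth_affine(2)[OF smooth] ..
    then show "norm y ^ a * cmod (pdl js (\<lambda>y. c n * \<phi> (l *\<^sub>R y - lat n)) y) \<le> 2 * D 0 * K * \<omega> n * gs_weight s t (rate B) a (length js)"
      using term_bound[OF c B K, of y a js n] l by (simp add: norm_mult norm_power mult_ac)
  qed
qed

lemma smooth_term: "smooth_fun (\<lambda>y. \<phi> (l *\<^sub>R y - lat n))"
  using smooth_affine(1)[OF smooth, of l "- lat n"] by simp

lemma st_nonneg: "s \<ge> 0" "t \<ge> 0"
  using st \<rho>1 \<rho>2 by auto

text \<open>The unit sequence at n is \<open>decaying\<close> with rate 1 + norm (lat n), so the
  general estimate for a term of a lattice series applies.\<close>

lemma term_in_GS: "(\<lambda>y. \<phi> (l *\<^sub>R y - lat n)) \<in> GS s t"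
proof -
  define c where "c i = (if i = n then 1 else 0 :: complex)" for i :: nat
  define \<omega> where "\<omega> i = (if i = n then 1 else 0 :: real)" for i :: nat
  define B where "B = 1 + norm (lat n :: real^'n)"
  have B: "B \<ge> 1" by (simp add: B_def)
  have "decaying t B 1 c \<omega>"
    unfolding decaying_def
  proof (intro conjI allI)
    show "summable \<omega>" unfolding \<omega>_def by (rule summable_single)
    fix i a
    have "norm (lat n :: real^'n) ^ a \<le> B ^ a * fact a powr t"
    proof -
      have "norm (lat n :: real^'n) ^ a * 1 \<le> B ^ a * fact a powr t"
        using st_nonneg B by (intro mult_mono power_mono ge_one_powr_ge_zero) (auto simp: B_def fact_ge_1)
      then show ?thesis by simp
    qed
    then show "norm (lat i :: real^'n) ^ a * cmod (c i) \<le> 1 * (B ^ a * fact a powr t) * \<omega> i"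
      by (simp add: c_def \<omega>_def)
  qed (simp add: \<omega>_def)
  from gs_decay_term_scaled[OF this B, of n] have "gs_decay s t (rate B) (2 * D 0 * 1 * \<omega> n) (\<lambda>y. \<phi> (l *\<^sub>R y - lat n))"
    by (simp add: c_def)
  then show ?thesis
    by (rule GS_I[OF smooth_term _ rate_pos[OF B] st_nonneg])
qed

context
  fixes T :: "(real^'n \<Rightarrow> complex) \<Rightarrow> complex"
  assumes T: "gs_dual s t T"
begin

definition dual_coeff :: "nat \<Rightarrow> complex" where "dual_coeff n = T (\<lambda>y. \<phi> (l *\<^sub>R y - lat n))"

text \<open>The tail of a lattice series is again a lattice series, with truncated \<omega>, so its
  step norm and its image under T are bounded by a multiple of the tail of the sum of \<omega>. The
  constant is chosen before c, \<omega> and K, since several sequences with the same B share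
  it.\<close>

lemma T_lattice_series:
  assumes B: "B \<ge> 1"
  shows "\<exists>KT. \<forall>c \<omega> K. decaying t B K c \<omega> \<and> 0 \<le> K \<longrightarrow>
    (\<forall>n. cmod (c n * dual_coeff n) \<le> KT * K * \<omega> n) \<and> (\<lambda>n. c n * dual_coeff n) sums T (\<lambda>y. lattice_series c (l *\<^sub>R y))"
proof -
  note lin = gs_dual_linear[OF T]
  obtain KT where KT: "KT \<ge> 0" "\<And>f C. smooth_fun f \<Longrightarrow> gs_decay s t (rate B) C f \<Longrightarrow> cmod (T f) \<le> KT * C"
    using gs_dual_bound[OF T st_nonneg rate_pos[OF B]] by blast
  have Tterm: "T (\<lambda>y. c n * \<phi> (l *\<^sub>R y - lat n)) = c n * dual_coeff n" for c n
    unfolding dual_coeff_def by (rule gs_linear_mult[OF lin term_in_GS])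
  have b1: "cmod (c n * dual_coeff n) \<le> (KT * (2 * D 0)) * K * \<omega> n" if c: "decaying t B K c \<omega>" "K \<ge> 0" for c \<omega> K n
    using KT(2)[OF smooth_mult_left(1)[OF smooth_term] gs_decay_term_scaled[OF c(1) B c(2)], of n]
    by (simp add: Tterm mult_ac)
  have b2: "(\<lambda>n. c n * dual_coeff n) sums T (\<lambda>y. lattice_series c (l *\<^sub>R y))" if c: "decaying t B K c \<omega>" "K \<ge> 0" for c \<omega> K
  proof -
    have \<omega>: "summable \<omega>" "\<And>n. \<omega> n \<ge> 0" using c by (auto simp: decaying_def)
    define R where "R N = suminf \<omega> - (\<Sum>n<N. \<omega> n)" for N
    have R0: "R \<longlonglongrightarrow> 0"
      unfolding R_def using tendsto_diff[OF tendsto_const[of "suminf \<omega>"] summable_LIMSEQ[OF \<omega>(1)]] by simp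
    have rem: "cmod ((\<Sum>n<N. c n * dual_coeff n) - T (\<lambda>y. lattice_series c (l *\<^sub>R y))) \<le> KT * (2 * D 0 * K) * R N" for N
    proof -
      define c' where "c' n = (if n < N then 0 else c n)" for n
      define \<omega>' where "\<omega>' n = (if n < N then 0 else \<omega> n)" for n
      have s\<omega>': "\<omega>' sums R N"
      proof -
        have "(\<lambda>n. if n \<in> {..<N} then \<omega> n else 0) sums (\<Sum>n<N. \<omega> n)"
          by (rule sums_If_finite_set) simp
        from sums_diff[OF summable_sums[OF \<omega>(1)] this] show ?thesis
          unfolding \<omega>'_def R_def by (rule sums_cong[THEN iffD1, rotated]) auto
      qed
      have d': "decaying t B K c' \<omega>'"
        using c s\<omega>' unfolding decaying_def c'_def \<omega>'_def by (auto simp: sums_iff)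
      have i': "gs_decay s t (rate B) (2 * D 0 * K * R N) (\<lambda>y. lattice_series c' (l *\<^sub>R y))"
        using gs_decay_lattice_series_scaled[OF d' B c(2)] s\<omega>' by (simp add: sums_iff)
      have split: "lattice_series c x = (\<Sum>n<N. c n * \<phi> (x - lat n)) + lattice_series c' x" for x
      proof -
        have "(\<lambda>n. if n \<in> {..<N} then c n * \<phi> (x - lat n) else 0) sums (\<Sum>n<N. c n * \<phi> (x - lat n))"
          by (rule sums_If_finite_set) simp
        moreover have "(\<lambda>n. c' n * \<phi> (x - lat n)) sums lattice_series c' x"
          unfolding lattice_series_def by (intro summable_sums summable_norm_cancel[OF summable_lattice_series_scaled[OF d' B c(2)]])
        ultimately have "(\<lambda>n. (if n \<in> {..<N} then c n * \<phi> (x - lat n) else 0) + c' n * \<phi> (x - lat n)) sums ((\<Sum>n<N. c n * \<phi> (x - lat n)) + lattice_series c' x)"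
          by (rule sums_add)
        moreover have "(if n \<in> {..<N} then c n * \<phi> (x - lat n) else 0) + c' n * \<phi> (x - lat n) = c n * \<phi> (x - lat n)" for n
          by (simp add: c'_def)
        ultimately show ?thesis by (simp add: lattice_series_def sums_iff)
      qed
      have inGS: "(\<lambda>y. c n * \<phi> (l *\<^sub>R y - lat n)) \<in> GS s t" for n
        using GS_lincomb[OF term_in_GS term_in_GS st_nonneg, of "c n" n 0 n] by simp
      note sm = gs_linear_sum[OF lin, of "\<lambda>n y. c n * \<phi> (l *\<^sub>R y - lat n)" N, OF inGS st_nonneg]
      have GS': "(\<lambda>y. lattice_series c' (l *\<^sub>R y)) \<in> GS s t"
        by (rule GS_I[OF smooth_lattice_series_scaled[OF d' B c(2)] i' rate_pos[OF B] st_nonneg])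
      have "T (\<lambda>y. lattice_series c (l *\<^sub>R y)) = T (\<lambda>y. (\<Sum>n<N. c n * \<phi> (l *\<^sub>R y - lat n)) + lattice_series c' (l *\<^sub>R y))"
        by (simp add: split)
      also have "\<dots> = (\<Sum>n<N. c n * dual_coeff n) + T (\<lambda>y. lattice_series c' (l *\<^sub>R y))"
        using gs_linear_add[OF lin _ GS'] sm by (simp add: Tterm)
      finally have "(\<Sum>n<N. c n * dual_coeff n) - T (\<lambda>y. lattice_series c (l *\<^sub>R y)) = - T (\<lambda>y. lattice_series c' (l *\<^sub>R y))"
        by simp
      then show ?thesis
        using KT(2)[OF smooth_lattice_series_scaled[OF d' B c(2)] i'] by (simp add: mult_ac)
    qed
    have "(\<lambda>N. (\<Sum>n<N. c n * dual_coeff n) - T (\<lambda>y. lattice_series c (l *\<^sub>R y))) \<longlonglongrightarrow> 0"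
      by (rule Lim_null_comparison[OF always_eventually[OF allI[OF rem]]])
         (use tendsto_mult_right[OF R0, of "KT * (2 * D 0 * K)"] in \<open>simp add: mult.commute\<close>)
    then show ?thesis unfolding sums_def by (rule LIM_zero_cancel)
  qed
  show ?thesis
    by (intro exI[of _ "KT * (2 * D 0)"] allI impI conjI; elim conjE; rule b1 b2)
qed

end

end

end

text \<open>Conjugating \<phi> swaps the arguments of the kernel. As a function of y, the kernel of
  the conjugate is therefore a lattice series of \<phi> itself, to which the preceding expansion
  applies.\<close>

lemma q0_cnj: "q0 (\<lambda>x. cnj (\<phi> x)) x y = q0 \<phi> y x"
  by (simp add: q0_def mult.commute)

lemma qker_cnj: "qker (\<lambda>x. cnj (\<phi> x)) m x y = qker \<phi> m y x"
  by (simp add: qker_def q0_cnj)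

context gs_kernel
begin

lemma lat_phi_bound:
  assumes t: "t \<ge> \<rho>2" and l: "l > 0"
  shows "norm (lat n :: real^'n) ^ a * cmod (\<phi> (l *\<^sub>R x - lat n))
    \<le> D 0 * wt (l *\<^sub>R x - lat n) * (2 ^ a * (norm (l *\<^sub>R x) ^ a + A2 ^ a * fact a powr t))"
proof -
  define k :: "real^'n" where "k = lat n"
  define z where "z = l *\<^sub>R x - k"
  have "norm k ^ a * cmod (\<phi> z) \<le> 2 ^ a * (norm (l *\<^sub>R x) ^ a + norm z ^ a) * cmod (\<phi> z)"
    unfolding z_def using norm_power_split(2)[OF l] by (rule mult_right_mono) simp
  also have "\<dots> = 2 ^ a * (norm (l *\<^sub>R x) ^ a * cmod (\<phi> z) + norm z ^ a * cmod (\<phi> z))"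
    by (simp add: algebra_simps)
  also have "\<dots> \<le> 2 ^ a * (norm (l *\<^sub>R x) ^ a * (D 0 * wt z) + D 0 * gs_weight \<rho>1 \<rho>2 A2 a 0 * wt z)"
    using decay_a[of z a "[]"] by (intro mult_left_mono add_mono phi_le) auto
  also have "\<dots> \<le> 2 ^ a * (norm (l *\<^sub>R x) ^ a * (D 0 * wt z) + D 0 * (A2 ^ a * fact a powr t) * wt z)"
  proof -
    have "gs_weight \<rho>1 \<rho>2 A2 a 0 \<le> A2 ^ a * fact a powr t"
      unfolding gs_weight_def using A2 t by (auto intro!: mult_left_mono powr_le_mono_exp_fact)
    then show ?thesis
      using D_nonneg[of 0] wt_pos[of z] by (intro mult_left_mono add_left_mono mult_right_mono) auto
  qed
  finally show ?thesis by (simp add: z_def k_def algebra_simps)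
qed

lemma qdist_expansion:
  fixes m :: int and T :: "(real^'n \<Rightarrow> complex) \<Rightarrow> complex" and x :: "real^'n"
  assumes st: "s \<ge> \<rho>1" "t \<ge> \<rho>2" and T: "gs_dual s t T"
  defines "l \<equiv> 2 powr real_of_int m"
  defines "cx \<equiv> \<lambda>n. of_real (l ^ CARD('n)) * cnj (\<phi> (l *\<^sub>R x - lat n))"
  shows "(\<lambda>n. cx n * dual_coeff l T n) sums qdist (\<lambda>x. cnj (\<phi> x)) m T x"
    and "summable (\<lambda>n. cmod (cx n * dual_coeff l T n))"
proof -
  have l: "l > 0" by (simp add: l_def)
  define L where "L = l ^ CARD('n)"
  have L: "L > 0" using l by (simp add: L_def)
  have t0: "t \<ge> 0" using st \<rho>2 by simp
  have fact_t: "(fact a :: real) powr t \<ge> 1" for a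
    using t0 by (intro ge_one_powr_ge_zero) (auto simp: fact_ge_1)
  \<comment> \<open>The rate depends on x, because the coefficients are concentrated near l x rather
    than near 0.\<close>
  define B where "B = 2 * (1 + norm (l *\<^sub>R x)) * A2"
  have B: "B \<ge> 1"
  proof -
    have "1 * 1 \<le> (2 * (1 + norm (l *\<^sub>R x))) * A2"
      using A2 by (intro mult_mono) auto
    then show ?thesis by (simp add: B_def)
  qed
  have dx: "decaying t B (L * (2 * D 0)) (cx) (\<lambda>n. wt (l *\<^sub>R x - lat n))"
    unfolding decaying_def
  proof (intro conjI allI)
    fix n a
    define u where "u = norm (l *\<^sub>R x)"
    have u: "u \<ge> 0" by (simp add: u_def)
    have Bu: "B = 2 * (A2 * (1 + u))" by (simp add: B_def u_def)
    have "2 ^ a * (u ^ a + A2 ^ a * fact a powr t) \<le> 2 * (B ^ a * fact a powr t)"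
    proof -
      have "1 * u \<le> A2 * (1 + u)" "A2 * 1 \<le> A2 * (1 + u)"
        using A2 u by (intro mult_mono; simp)+
      then have "2 * u \<le> B" "2 * A2 \<le> B"
        by (simp_all add: Bu)
      then have "(2 * u) ^ a \<le> B ^ a" "(2 * A2) ^ a \<le> B ^ a"
        using A2 u by (intro power_mono; simp)+
      then have "(2 * u) ^ a * 1 \<le> B ^ a * fact a powr t" "(2 * A2) ^ a * fact a powr t \<le> B ^ a * fact a powr t"
        using fact_t[of a] B by (intro mult_mono; simp)+
      moreover have "2 ^ a * (u ^ a + A2 ^ a * fact a powr t) = (2 * u) ^ a * 1 + (2 * A2) ^ a * fact a powr t"
        by (simp add: power_mult_distrib algebra_simps)
      ultimately show ?thesis by linarith
    qed
    then have "D 0 * wt (l *\<^sub>R x - lat n) * (2 ^ a * (u ^ a + A2 ^ a * fact a powr t)) \<le> D 0 * wt (l *\<^sub>R x - lat n) * (2 * (B ^ a * fact a powr t))"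
      using D_nonneg[of 0] wt_pos[of "l *\<^sub>R x - lat n"] by (intro mult_left_mono) auto
    then have "norm (lat n :: real^'n) ^ a * cmod (\<phi> (l *\<^sub>R x - lat n)) \<le> D 0 * wt (l *\<^sub>R x - lat n) * (2 * (B ^ a * fact a powr t))"
      using lat_phi_bound[OF st(2) l, of n a x] unfolding u_def by linarith
    then have "L * (norm (lat n :: real^'n) ^ a * cmod (\<phi> (l *\<^sub>R x - lat n))) \<le> L * (D 0 * wt (l *\<^sub>R x - lat n) * (2 * (B ^ a * fact a powr t)))"
      using L by (intro mult_left_mono) auto
    then show "norm (lat n :: real^'n) ^ a * cmod (cx n) \<le> L * (2 * D 0) * (B ^ a * fact a powr t) * wt (l *\<^sub>R x - lat n)"
      using L by (simp add: cx_def L_def[symmetric] norm_mult mult_ac)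
  qed (use summable_wt less_imp_le[OF wt_pos] in auto)
  have KL: "0 \<le> L * (2 * D 0)" using L D_nonneg[of 0] by simp
  have qd: "qdist (\<lambda>x. cnj (\<phi> x)) m T x = T (\<lambda>y. lattice_series cx (l *\<^sub>R y))"
  proof -
    have "qker (\<lambda>x. cnj (\<phi> x)) m x y = lattice_series cx (l *\<^sub>R y)" for y
    proof -
      have "qker (\<lambda>x. cnj (\<phi> x)) m x y = of_real L * q0 \<phi> (l *\<^sub>R y) (l *\<^sub>R x)"
        by (simp add: qker_cnj qker_scale l_def L_def)
      also have "\<dots> = (\<Sum>n. of_real L * (\<phi> (l *\<^sub>R y - lat n) * cnj (\<phi> (l *\<^sub>R x - lat n))))"
        unfolding q0_eq by (rule suminf_mult[symmetric]) (rule summable_norm_cancel[OF summable_q0])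
      also have "\<dots> = lattice_series cx (l *\<^sub>R y)"
        by (simp add: lattice_series_def cx_def L_def mult_ac)
      finally show ?thesis .
    qed
    then show ?thesis by (simp add: qdist_def)
  qed
  obtain KT where *: "\<forall>c \<omega> K. decaying t B K c \<omega> \<and> 0 \<le> K \<longrightarrow>
      (\<forall>n. cmod (c n * dual_coeff l T n) \<le> KT * K * \<omega> n) \<and> (\<lambda>n. c n * dual_coeff l T n) sums T (\<lambda>y. lattice_series c (l *\<^sub>R y))"
    using T_lattice_series[OF st l T B] by (elim exE) (rule that)
  note KT = *[THEN spec, THEN spec, THEN spec, THEN mp, OF conjI[OF dx KL]]
  show "(\<lambda>n. cx n * dual_coeff l T n) sums qdist (\<lambda>x. cnj (\<phi> x)) m T x"
    unfolding qd by (rule KT[THEN conjunct2])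
  show "summable (\<lambda>n. cmod (cx n * dual_coeff l T n))"
    by (rule summable_comparison_test'[of "\<lambda>n. KT * (L * (2 * D 0)) * wt (l *\<^sub>R x - lat n)" 0])
       (use KT[THEN conjunct1] in \<open>auto intro!: summable_mult summable_wt\<close>)
qed

text \<open>Both sides are expanded in the numbers \<open>dual_coeff l T n\<close>. The rate in the
  expansion of \<open>qdist\<close> at a fixed x depends on x, so termwise integration cannot rest
  on it; the decay of g supplies one rate, \<open>B3\<close>, for the integrated
  coefficients.\<close>

lemma pairing_qdist:
  fixes m :: int and T :: "(real^'n \<Rightarrow> complex) \<Rightarrow> complex"
  assumes st: "s \<ge> \<rho>1" "t \<ge> \<rho>2" and T: "gs_dual s t T" and g: "g \<in> GS r t" and r: "r \<ge> 0"
  shows "integrable lborel (\<lambda>x. qdist (\<lambda>x. cnj (\<phi> x)) m T x * g x)"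
    and "(\<integral>x. qdist (\<lambda>x. cnj (\<phi> x)) m T x * g x \<partial>lborel) = T (qfun \<phi> m g)"
proof -
  define l where "l = 2 powr real_of_int m"
  have l: "l > 0" by (simp add: l_def)
  define L where "L = l ^ CARD('n)"
  have L: "L > 0" using l by (simp add: L_def)
  have t0: "t \<ge> 0" using st \<rho>2 by simp
  define tc where "tc = dual_coeff l T"
  define cx where "cx x n = of_real L * cnj (\<phi> (l *\<^sub>R x - lat n))" for x n
  have sums_x: "(\<lambda>n. cx x n * tc n) sums qdist (\<lambda>x. cnj (\<phi> x)) m T x"
    and summable_x: "summable (\<lambda>n. cmod (cx x n * tc n))" for x
    using qdist_expansion[OF st T, of m x] by (simp_all add: cx_def tc_def L_def l_def)
  obtain Bg Kg where g': "smooth_fun g" "Bg \<ge> 1" "gs_decay r t Bg Kg g"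
    using GS_D[OF g r t0] .
  have mg [measurable]: "g \<in> borel_measurable borel" by (rule smooth_measurable[OF g'(1)])
  define B2 where "B2 = Bg * 2 powr t"
  have B2: "B2 \<ge> 1"
    unfolding B2_def using g'(2) t0 mult_mono[of 1 Bg 1 "2 powr t"] by (simp add: ge_one_powr_ge_zero)
  define K2 where "K2 = Kg * decay_const t Bg (CARD('n) + 2)"
  have K2: "K2 \<ge> 0"
    unfolding K2_def using gs_decay_nonneg[OF g'(3)] decay_const_pos[of Bg] g'(2) by (simp add: less_imp_le)
  have gd: "norm x ^ a * cmod (g x) \<le> K2 * (B2 ^ a * fact a powr t) * wt x" for x a
  proof -
    have "norm x ^ a * (1 + norm x) ^ (CARD('n) + 2) * cmod (pdl [] g x) \<le> Kg * decay_const t Bg (CARD('n) + 2) * gs_weight r t (Bg * 2 powr t) a (length ([] :: 'n list))"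
      by (rule gs_decay_times_power[OF g'(3)]) (use g'(2) t0 in auto)
    then have "(norm x ^ a * cmod (g x)) / wt x \<le> K2 * (B2 ^ a * fact a powr t)"
      by (simp add: wt_def K2_def B2_def gs_weight_def mult_ac)
    then show ?thesis using wt_pos[of x] by (simp add: pos_divide_le_eq)
  qed
  have g0: "cmod (g x) \<le> K2 * wt x" for x
    using gd[of x 0] by simp
  \<comment> \<open>2 l B2 covers the powers of l x, which are borne by g, and 2 A2 those borne by
    \<phi>.\<close>
  define B3 where "B3 = 2 * (l + 1) * B2 * A2"
  have B3: "B3 \<ge> 1" "2 * l * B2 \<le> B3" "2 * A2 \<le> B3"
  proof -
    have "2 * l * B2 * 1 \<le> 2 * (l + 1) * B2 * A2"
      using l B2 A2 by (intro mult_mono) auto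
    then show "2 * l * B2 \<le> B3" by (simp add: B3_def)
    have "2 * 1 * 1 * A2 \<le> 2 * (l + 1) * B2 * A2"
      using l B2 A2 by (intro mult_right_mono mult_mono) auto
    then show "2 * A2 \<le> B3" by (simp add: B3_def)
    then show "B3 \<ge> 1" using A2 by simp
  qed
  define ph where "ph n x = cmod (\<phi> (l *\<^sub>R x - lat n)) * cmod (g x)" for n x
  have mph [measurable]: "ph n \<in> borel_measurable borel" for n
    unfolding ph_def[abs_def] by measurable
  define W where "W n x = wt (l *\<^sub>R x - lat n) * wt x" for n and x :: "real^'n"
  have ph_bound: "norm (lat n :: real^'n) ^ a * ph n x \<le> 2 * D 0 * K2 * (B3 ^ a * fact a powr t) * W n x" for n a x
  proof -
    let ?w = "D 0 * wt (l *\<^sub>R x - lat n)"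
    have w: "?w \<ge> 0" using D_nonneg[of 0] wt_pos[of "l *\<^sub>R x - lat n"] by simp
    have "norm (lat n :: real^'n) ^ a * ph n x \<le> ?w * (2 ^ a * (norm (l *\<^sub>R x) ^ a + A2 ^ a * fact a powr t)) * cmod (g x)"
      unfolding ph_def mult.assoc[symmetric, of "norm (lat n) ^ a"] using lat_phi_bound[OF st(2) l] by (rule mult_right_mono) simp
    also have "\<dots> = ?w * ((2 * l) ^ a * (norm x ^ a * cmod (g x)) + (2 * A2) ^ a * fact a powr t * cmod (g x))"
      using l by (simp add: power_mult_distrib algebra_simps)
    also have "\<dots> \<le> ?w * ((2 * l) ^ a * (K2 * (B2 ^ a * fact a powr t) * wt x) + (2 * A2) ^ a * fact a powr t * (K2 * wt x))"
      using w l A2 by (intro mult_left_mono add_mono gd g0) auto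
    also have "\<dots> = ?w * (K2 * wt x * fact a powr t) * ((2 * l * B2) ^ a + (2 * A2) ^ a)"
      by (simp add: power_mult_distrib algebra_simps)
    also have "\<dots> \<le> ?w * (K2 * wt x * fact a powr t) * (B3 ^ a + B3 ^ a)"
      using D_nonneg[of 0] less_imp_le[OF wt_pos[of "l *\<^sub>R x - lat n"]] K2 wt_pos[of x] l B2 A2 B3
      by (intro mult_left_mono add_mono power_mono mult_nonneg_nonneg) auto
    finally show ?thesis by (simp add: W_def algebra_simps)
  qed
  have int_ww: "integrable lborel (W n)" for n
  proof (rule Bochner_Integration.integrable_bound[OF integrable_wt])
    show "W n \<in> borel_measurable lborel"
      unfolding W_def[abs_def] by measurable
    show "AE x in lborel. norm (W n x) \<le> norm (wt x)"
    proof (rule AE_I2)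
      fix x :: "real^'n"
      have "W n x \<le> 1 * wt x"
        unfolding W_def by (intro mult_right_mono wt_le_1 less_imp_le[OF wt_pos])
      then show "norm (W n x) \<le> norm (wt x)"
        by (simp add: W_def abs_mult abs_of_pos[OF wt_pos])
    qed
  qed
  have int_ph: "integrable lborel (ph n)" for n
  proof (rule Bochner_Integration.integrable_bound)
    show "integrable lborel (\<lambda>x. 2 * D 0 * K2 * W n x)"
      by (intro integrable_mult_right int_ww)
    show "ph n \<in> borel_measurable lborel" by measurable
    have "norm (ph n x) \<le> norm (2 * D 0 * K2 * W n x)" for x
    proof -
      have "ph n x \<le> 2 * D 0 * K2 * W n x" using ph_bound[of n 0 x] by simp
      moreover have "ph n x \<ge> 0" by (simp add: ph_def)
      ultimately show ?thesis by simp
    qed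
    then show "AE x in lborel. norm (ph n x) \<le> norm (2 * D 0 * K2 * W n x)"
      by (intro AE_I2)
  qed
  define \<omega> where "\<omega> n = integral\<^sup>L lborel (W n)" for n
  have \<omega>0: "\<omega> n \<ge> 0" for n
    unfolding \<omega>_def W_def by (intro integral_nonneg_AE AE_I2) (simp add: less_imp_le[OF wt_pos])
  \<comment> \<open>Summing over the lattice under the integral gives a bound uniform in x, and the
    weight in x keeps the integral finite.\<close>
  have s\<omega>: "summable \<omega>"
  proof (rule summableI_nonneg_bounded[OF \<omega>0])
    fix N
    have "(\<Sum>n<N. \<omega> n) = (\<integral>x. (\<Sum>n<N. W n x) \<partial>lborel)"
      unfolding \<omega>_def by (subst Bochner_Integration.integral_sum) (auto intro: int_ww)
    also have "\<dots> \<le> (\<integral>x. wt_sum TYPE('n) * wt (x :: real^'n) \<partial>lborel)"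
    proof (intro integral_mono Bochner_Integration.integrable_sum int_ww integrable_mult_right integrable_wt)
      fix x :: "real^'n"
      have "(\<Sum>n<N. wt (l *\<^sub>R x - lat n)) \<le> (\<Sum>n. wt (l *\<^sub>R x - lat n))"
        by (intro sum_le_suminf summable_wt) (auto simp: less_imp_le[OF wt_pos])
      also have "\<dots> \<le> wt_sum TYPE('n)" by (rule suminf_wt_le)
      finally show "(\<Sum>n<N. W n x) \<le> wt_sum TYPE('n) * wt x"
        unfolding W_def sum_distrib_right[symmetric] by (intro mult_right_mono) (auto simp: less_imp_le[OF wt_pos])
    qed
    finally show "(\<Sum>n<N. \<omega> n) \<le> wt_sum TYPE('n) * wt_integral TYPE('n)" by (simp add: wt_integral_def)
  qed
  \<comment> \<open>Coefficients with the absolute value inside the integral. Being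
    \<open>decaying\<close>, they make the integrals of the absolute values of \<open>h n\<close>
    summable, and they dominate the true coefficients \<open>c2\<close>.\<close>
  define ci where "ci n = complex_of_real (L * integral\<^sup>L lborel (ph n))" for n
  have ph_int0: "integral\<^sup>L lborel (ph n) \<ge> 0" for n
    by (intro integral_nonneg_AE AE_I2) (simp add: ph_def)
  have cmod_ci: "cmod (ci n) = L * integral\<^sup>L lborel (ph n)" for n
    using L ph_int0[of n] by (simp add: ci_def norm_mult)
  define K3 where "K3 = L * (2 * D 0 * K2)"
  have K3: "K3 \<ge> 0" using L D_nonneg[of 0] K2 by (simp add: K3_def)
  have di: "decaying t B3 K3 ci \<omega>"
    unfolding decaying_def
  proof (intro conjI allI s\<omega> \<omega>0)
    fix n a
    have "norm (lat n :: real^'n) ^ a * integral\<^sup>L lborel (ph n) = (\<integral>x. norm (lat n :: real^'n) ^ a * ph n x \<partial>lborel)"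
      by simp
    also have "\<dots> \<le> (\<integral>x. 2 * D 0 * K2 * (B3 ^ a * fact a powr t) * W n x \<partial>lborel)"
      by (intro integral_mono integrable_mult_right int_ph int_ww ph_bound)
    also have "\<dots> = 2 * D 0 * K2 * (B3 ^ a * fact a powr t) * \<omega> n"
      by (simp add: \<omega>_def)
    finally have "L * (norm (lat n :: real^'n) ^ a * integral\<^sup>L lborel (ph n)) \<le> L * (2 * D 0 * K2 * (B3 ^ a * fact a powr t) * \<omega> n)"
      using L by (intro mult_left_mono) auto
    then show "norm (lat n :: real^'n) ^ a * cmod (ci n) \<le> K3 * (B3 ^ a * fact a powr t) * \<omega> n"
      by (simp add: cmod_ci K3_def mult_ac)
  qed
  obtain KT where "\<forall>c \<omega> K. decaying t (B3) K c \<omega> \<and> 0 \<le> K \<longrightarrow>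
      (\<forall>n. cmod (c n * dual_coeff l T n) \<le> KT * K * \<omega> n) \<and> (\<lambda>n. c n * dual_coeff l T n) sums T (\<lambda>y. lattice_series c (l *\<^sub>R y))"
      using T_lattice_series[OF st l T B3(1)] by (elim exE) (rule that)
    then have KT: "cmod (c n * dual_coeff l T n) \<le> KT * K * \<omega> n" "(\<lambda>n. c n * dual_coeff l T n) sums T (\<lambda>y. lattice_series c (l *\<^sub>R y))"
      if "decaying t (B3) K c \<omega>" "0 \<le> K" for c \<omega> K n
      using that by simp_all
  define h where "h n x = (cx x n * tc n) * g x" for n x
  have mh [measurable]: "h n \<in> borel_measurable borel" for n
    unfolding h_def[abs_def] cx_def by measurable
  have norm_h: "norm (h n x) = L * cmod (tc n) * ph n x" for n x
    using L by (simp add: h_def cx_def ph_def norm_mult)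
  have int_h: "integrable lborel (h n)" for n
  proof (rule Bochner_Integration.integrable_bound)
    show "integrable lborel (\<lambda>x. L * cmod (tc n) * ph n x)"
      by (intro integrable_mult_right int_ph)
    show "AE x in lborel. norm (h n x) \<le> norm (L * cmod (tc n) * ph n x)"
      unfolding norm_h by (intro AE_I2) simp
  qed measurable
  have sum_h: "summable (\<lambda>n. norm (h n x))" for x
    unfolding h_def norm_mult by (intro summable_mult2) (use summable_x[of x] in \<open>simp add: norm_mult\<close>)
  have sum_int: "summable (\<lambda>n. \<integral>x. norm (h n x) \<partial>lborel)"
  proof (rule summable_comparison_test'[of "\<lambda>n. KT * K3 * \<omega> n" 0])
    show "summable (\<lambda>n. KT * K3 * \<omega> n)" by (intro summable_mult s\<omega>)
    fix n
    have "(\<integral>x. norm (h n x) \<partial>lborel) = cmod (ci n * tc n)"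
      unfolding norm_h by (simp add: norm_mult cmod_ci)
    then show "norm (\<integral>x. norm (h n x) \<partial>lborel) \<le> KT * K3 * \<omega> n"
      using KT(1)[OF di K3, of n] by (simp add: tc_def)
  qed
  have eq: "qdist (\<lambda>x. cnj (\<phi> x)) m T x * g x = (\<Sum>n. h n x)" for x
    unfolding h_def using sums_mult2[OF sums_x[of x], of "g x"] by (simp add: sums_iff)
  show "integrable lborel (\<lambda>x. qdist (\<lambda>x. cnj (\<phi> x)) m T x * g x)"
    unfolding eq by (rule integrable_suminf) (use int_h sum_h sum_int in auto)
  define c2 where "c2 n = of_real L * (\<integral>x. cnj (\<phi> (l *\<^sub>R x - lat n)) * g x \<partial>lborel)" for n
  have "decaying t B3 K3 c2 \<omega>"
  proof (rule decaying_mono[OF di])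
    fix n
    have "cmod (\<integral>x. cnj (\<phi> (l *\<^sub>R x - lat n)) * g x \<partial>lborel) \<le> (\<integral>x. cmod (cnj (\<phi> (l *\<^sub>R x - lat n)) * g x) \<partial>lborel)"
      by (rule integral_norm_bound)
    also have "\<dots> = integral\<^sup>L lborel (ph n)"
      by (simp add: ph_def[abs_def] norm_mult)
    finally show "cmod (c2 n) \<le> cmod (ci n)"
      using L by (simp add: c2_def cmod_ci norm_mult)
  qed
  then have s2: "(\<lambda>n. c2 n * tc n) sums T (\<lambda>y. lattice_series c2 (l *\<^sub>R y))"
    unfolding tc_def by (rule KT(2)) (rule K3)
  have "(\<integral>x. qdist (\<lambda>x. cnj (\<phi> x)) m T x * g x \<partial>lborel) = (\<Sum>n. integral\<^sup>L lborel (h n))"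
    unfolding eq by (rule integral_suminf) (use int_h sum_h sum_int in auto)
  also have "\<dots> = (\<Sum>n. c2 n * tc n)"
  proof (intro arg_cong[where f = suminf] ext)
    fix n
    have "h n = (\<lambda>x. (of_real L * tc n) * (cnj (\<phi> (l *\<^sub>R x - lat n)) * g x))"
      by (simp add: h_def cx_def fun_eq_iff mult_ac)
    then have "integral\<^sup>L lborel (h n) = (of_real L * tc n) * (\<integral>x. cnj (\<phi> (l *\<^sub>R x - lat n)) * g x \<partial>lborel)"
      by (simp only: integral_mult_right_zero)
    then show "integral\<^sup>L lborel (h n) = c2 n * tc n"
      by (simp add: c2_def mult_ac)
  qed
  also have "\<dots> = T (\<lambda>y. lattice_series c2 (l *\<^sub>R y))"
    using s2 by (simp add: sums_iff)
  \<comment> \<open>\<open>c2\<close> is the coefficient sequence of the dilated g: the substitution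
    by the factor l has Jacobian L.\<close>
  also have "(\<lambda>y. lattice_series c2 (l *\<^sub>R y)) = qfun \<phi> m g"
  proof
    fix y
    have pbg: "poly_bounded g" by (rule poly_bounded_gs_decay[OF g'(1,3)])
    define G where "G y = g ((1 / l) *\<^sub>R y)" for y
    have pbG: "poly_bounded G" unfolding G_def[abs_def] by (rule poly_bounded_affine[OF pbg])
    have "qfun \<phi> m g y = Q G (l *\<^sub>R y)"
      using qfun_eq[OF pbg, of m y] by (simp add: G_def[abs_def] l_def)
    also have "\<dots> = lattice_series (coeff G) (l *\<^sub>R y)"
      using pbG Q_eq_lattice_series unfolding poly_bounded_def by blast
    also have "coeff G = c2"
    proof
      fix n
      have "(\<lambda>y. G y * cnj (\<phi> (y - lat n))) \<in> borel_measurable borel"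
        unfolding G_def[abs_def] by measurable
      then have "coeff G n = l ^ CARD('n) *\<^sub>R (\<integral>x. G (0 + l *\<^sub>R x) * cnj (\<phi> (0 + l *\<^sub>R x - lat n)) \<partial>lborel)"
        unfolding coeff_def using l by (subst lborel_integral_affine[where c = l and t = 0]) auto
      then show "coeff G n = c2 n"
        using l by (simp add: c2_def G_def L_def scaleR_conv_of_real[where 'a = complex] mult.commute)
    qed
    finally show "lattice_series c2 (l *\<^sub>R y) = qfun \<phi> m g y" ..
  qed
  finally show "(\<integral>x. qdist (\<lambda>x. cnj (\<phi> x)) m T x * g x \<partial>lborel) = T (qfun \<phi> m g)" .
qed

lemma qfun_lincomb:
  assumes "poly_bounded f" "poly_bounded g"
  shows "qfun \<phi> m (\<lambda>x. a * f x + b * g x) = (\<lambda>x. a * qfun \<phi> m f x + b * qfun \<phi> m g x)"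
proof
  fix x
  have "qfun \<phi> m (\<lambda>x. a * f x + b * g x) x = (\<integral>y. a * (f y * qker \<phi> m x y) + b * (g y * qker \<phi> m x y) \<partial>lborel)"
    by (simp add: qfun_def algebra_simps)
  also have "\<dots> = a * qfun \<phi> m f x + b * qfun \<phi> m g x"
    using integrable_qfun[OF assms(1), of m x] integrable_qfun[OF assms(2), of m x] by (simp add: qfun_def)
  finally show "qfun \<phi> m (\<lambda>x. a * f x + b * g x) x = a * qfun \<phi> m f x + b * qfun \<phi> m g x" .
qed

end

section \<open>Conjugation, and the moments of a multiresolution approximation\<close>

lemma gs_kernel_cnj:
  "gs_kernel \<phi> \<rho>1 \<rho>2 A C \<Longrightarrow> gs_kernel (\<lambda>x. cnj (\<phi> x)) \<rho>1 \<rho>2 A C"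
  unfolding gs_kernel_def by (auto intro: smooth_cnj gs_decay_cnj)

lemma q0_cnj': "q0 (\<lambda>x. cnj (\<phi> x)) x y = cnj (q0 \<phi> x y)"
  by (simp add: q0_def flip: infsum_cnj)

text \<open>The moments turn out to be 0 or 1, so this carries their values unchanged over to the
  conjugate of \<phi>.\<close>

lemma moment_cnj:
  assumes "gs_kernel \<phi> \<rho>1 \<rho>2 A C"
  shows "gs_kernel.moment (\<lambda>x. cnj (\<phi> x)) js u = cnj (gs_kernel.moment \<phi> js u)"
proof -
  interpret K: gs_kernel \<phi> \<rho>1 \<rho>2 A C by (rule assms)
  interpret K': gs_kernel "\<lambda>x. cnj (\<phi> x)" \<rho>1 \<rho>2 A C by (rule gs_kernel_cnj[OF assms])
  show ?thesis
    unfolding K.moment_def K'.moment_def K.Q_def K'.Q_def q0_cnj' by (simp flip: Bochner_Integration.integral_cnj)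
qed

text \<open>The dilates of \<phi> lie in V 0, are continuous and bounded, and are approximated by
  translates, so they are reproduced pointwise; \<phi> is not the zero function because its norm is
  1.\<close>

lemma MRA_moments:
  fixes V :: "int \<Rightarrow> (real^'n::finite \<Rightarrow> complex) set"
  assumes K: "gs_kernel \<phi> \<rho>1 \<rho>2 A C" and V: "MRA V" and sf: "scaling_function V \<phi>"
  shows "gs_kernel.moment \<phi> js u = (if js = [] then 1 else 0)"
proof -
  interpret K: gs_kernel \<phi> \<rho>1 \<rho>2 A C by (rule K)
  have W: "closed_subspace_L2 (V 0)" using V by (simp add: MRA_def)
  have shift: "(\<lambda>x. \<phi> (x - n)) \<in> V 0" if "n \<in> lattice" for n
    using sf that by (simp add: scaling_function_def)
  have \<phi>V: "\<phi> \<in> V 0" using shift[OF lattice_0] by simp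
  have orth: "l2_inner (\<lambda>x. \<phi> (x - n)) (\<lambda>x. \<phi> (x - k)) = (if n = k then 1 else 0)" if "n \<in> lattice" "k \<in> lattice" for n k
    using sf that by (simp add: scaling_function_def)
  have approx: "\<exists>N c. finite N \<and> N \<subseteq> lattice \<and> l2_norm (\<lambda>x. f x - (\<Sum>n\<in>N. c n * \<phi> (x - n))) < \<epsilon>"
    if "f \<in> V 0" "\<epsilon> > 0" for f \<epsilon>
    using sf that by (simp add: scaling_function_def)
  have repro: "K.Q (\<lambda>x. \<phi> ((1 / 2 ^ m) *\<^sub>R x)) x = \<phi> ((1 / 2 ^ m) *\<^sub>R x)" for m :: nat and x
  proof (rule K.Q_reproduces[where f = "\<lambda>x. \<phi> ((1 / 2 ^ m) *\<^sub>R x)", OF orth W shift])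
    show d: "(\<lambda>x. \<phi> ((1 / 2 ^ m) *\<^sub>R x)) \<in> V 0" by (rule MRA_dilate[OF V \<phi>V])
    show "continuous_on UNIV (\<lambda>x. \<phi> ((1 / 2 ^ m) *\<^sub>R x))"
      by (rule continuous_on_compose2[OF smooth_continuous[OF K.smooth, of UNIV]]) (auto intro!: continuous_intros)
    show "cmod (\<phi> ((1 / 2 ^ m) *\<^sub>R x)) \<le> C" for x
      using gs_decayD[OF K.gs_decay, of "(1 / 2 ^ m) *\<^sub>R x" 0 "[]"] by simp
  qed (use approx MRA_dilate[OF V \<phi>V] in auto)
  have nz: "\<exists>x. \<phi> x \<noteq> 0"
  proof (rule ccontr)
    assume "\<nexists>x. \<phi> x \<noteq> 0"
    then have "l2_inner (\<lambda>x. \<phi> (x - 0)) (\<lambda>x. \<phi> (x - 0)) = 0" by (simp add: l2_inner_def)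
    then show False using orth[OF lattice_0 lattice_0] by simp
  qed
  show ?thesis by (rule K.moments[OF repro nz])
qed

theorem theorem4p1:
  fixes V :: "int \<Rightarrow> (real^'n::finite \<Rightarrow> complex) set"
    and \<phi> :: "real^'n \<Rightarrow> complex"
    and \<rho>1 \<rho>2 s t :: real
  assumes "\<rho>2 > 1" and "\<rho>1 \<ge> 0"
    and "MRA V" and "scaling_function V \<phi>" and "\<phi> \<in> GS \<rho>1 \<rho>2"
    and "s \<ge> \<rho>1 + \<rho>2 - 1" and "t \<ge> \<rho>2"
  shows "(\<forall>g \<in> GS (s - (\<rho>1 + \<rho>2 - 1)) t.
            (\<forall>m x. integrable lborel (\<lambda>y. g y * qker \<phi> m x y)) \<and>
            gs_tendsto s t (\<lambda>m. qfun \<phi> (int m) g) g)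
       \<and> (\<forall>T. gs_dual s t T \<longrightarrow>
            (\<forall>m. \<forall>g \<in> GS (s - (\<rho>1 + \<rho>2 - 1)) t.
               integrable lborel (\<lambda>x. qdist \<phi> m T x * g x)) \<and>
            gs_dual_tendsto (s - (\<rho>1 + \<rho>2 - 1)) t
              (\<lambda>m g. integral\<^sup>L lborel (\<lambda>x. qdist \<phi> (int m) T x * g x)) T)"
proof -
  define r where "r = s - (\<rho>1 + \<rho>2 - 1)"
  have r: "r \<ge> 0" "r + \<rho>1 + \<rho>2 - 1 = s" and s0: "s \<ge> 0" and t0: "t \<ge> 0" and \<rho>21: "\<rho>2 \<ge> 1"
    and s\<rho>: "\<rho>1 \<le> s" and rs: "r \<le> s"
    using assms by (auto simp: r_def)
  have sub: "GS r t \<subseteq> (GS s t :: (real^'n \<Rightarrow> complex) set)"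
    by (rule GS_mono) (use r rs t0 in auto)
  obtain A C where AC: "smooth_fun \<phi>" "A \<ge> 1" "gs_decay \<rho>1 \<rho>2 A C \<phi>"
    using GS_D[OF assms(5,2)] assms(1) by auto
  have K: "gs_kernel \<phi> \<rho>1 \<rho>2 A C"
    by unfold_locales (use AC assms in auto)
  \<comment> \<open>Pairing with \<open>qdist \<phi>\<close> is the transpose of the projection
    built from the conjugate of \<phi>, so (ii) rests on the error estimate for \<psi>.\<close>
  define \<psi> where "\<psi> = (\<lambda>x. cnj (\<phi> x))"
  interpret K: gs_kernel \<phi> \<rho>1 \<rho>2 A C by (rule K)
  interpret K': gs_kernel \<psi> \<rho>1 \<rho>2 A C unfolding \<psi>_def by (rule gs_kernel_cnj[OF K])
  have mom: "K.moment js u = (if js = [] then 1 else 0)" for js u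
    by (rule MRA_moments[OF K assms(3,4)])
  have mom': "K'.moment js u = (if js = [] then 1 else 0)" for js u
    unfolding \<psi>_def moment_cnj[OF K] mom by simp
  have poly_bounded: "poly_bounded g" if "g \<in> GS r t" for g :: "real^'n \<Rightarrow> complex"
    using GS_D[OF that r(1) t0] poly_bounded_gs_decay by metis
  have part1: "(\<forall>m x. integrable lborel (\<lambda>y. g y * qker \<phi> m x y)) \<and> gs_tendsto s t (\<lambda>m. qfun \<phi> (int m) g) g"
    if g: "g \<in> GS r t" for g
  proof (intro conjI allI)
    show "integrable lborel (\<lambda>y. g y * qker \<phi> m x y)" for m x
      by (rule K.integrable_qfun[OF poly_bounded[OF g]])
    obtain B D where g': "smooth_fun g" "B \<ge> 1" "gs_decay r t B D g"
      using GS_D[OF g r(1) t0] .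
    define Y where "Y = 4 * real CARD('n) * B * (2 * K.A2 * K.A2 * 2 powr \<rho>2 * B) * 2 powr (r + \<rho>1 + \<rho>2 - 1)"
    have Y: "Y > 0" unfolding Y_def using g'(2) K.A2 by simp
    show "gs_tendsto s t (\<lambda>m. qfun \<phi> (int m) g) g"
    proof (rule gs_tendstoI[OF _ s0 t0 Y])
      show "g \<in> GS s t" using g sub by blast
      show "smooth_fun (qfun \<phi> (int m) g)" for m
        by (rule K.qfun_error(1)[OF mom g'(1,3,2) r(1) assms(7) \<rho>21])
      show "gs_decay s t Y (D * (4 * K.moment_const * Y) / 2 ^ m) (\<lambda>x. qfun \<phi> (int m) g x - g x)" for m
        using K.qfun_error(2)[OF mom g'(1,3,2) r(1) assms(7) \<rho>21, of m] unfolding Y_def r(2) .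
      show "(\<lambda>m. D * (4 * K.moment_const * Y) / 2 ^ m) \<longlonglongrightarrow> 0" by (rule LIMSEQ_divide_power2_zero)
    qed
  qed
  have part2: "(\<forall>m. \<forall>g \<in> GS r t. integrable lborel (\<lambda>x. qdist \<phi> m T x * g x)) \<and>
      gs_dual_tendsto r t (\<lambda>m g. integral\<^sup>L lborel (\<lambda>x. qdist \<phi> (int m) T x * g x)) T"
    if T: "gs_dual s t T" for T
  proof
    have \<phi>: "\<phi> = (\<lambda>x. cnj (\<psi> x))" by (simp add: \<psi>_def)
    show "\<forall>m. \<forall>g \<in> GS r t. integrable lborel (\<lambda>x. qdist \<phi> m T x * g x)"
      using K'.pairing_qdist(1)[OF s\<rho> assms(7) T _ r(1)] unfolding \<phi>[symmetric] by blast
    define S where "S m g = integral\<^sup>L lborel (\<lambda>x. qdist \<phi> (int m) T x * g x)" for m g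
    have S: "S m g = T (qfun \<psi> (int m) g)" if "g \<in> GS r t" for m g
      using K'.pairing_qdist(2)[OF s\<rho> assms(7) T that r(1)] unfolding \<phi>[symmetric] S_def .
    note lin = gs_dual_linear[OF T]
    define R where "R m g = (\<lambda>x. qfun \<psi> (int m) g x - g x)" for m g
    \<comment> \<open>The factor 2^m uses up the whole gain in the error estimate and leaves
      functionals bounded uniformly in m.\<close>
    define L where "L m g = 2 ^ m * T (R m g)" for m g
    \<comment> \<open>Membership of \<open>R m f\<close> in \<open>GS s t\<close> is carried along
      because T is known to be linear on that space.\<close>
    have Lbound: "\<exists>KL. \<forall>m f D. smooth_fun f \<longrightarrow> gs_decay r t B D f \<longrightarrow> R m f \<in> GS s t \<and> cmod (L m f) \<le> KL * D"
      if B: "B \<ge> 1" for B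
    proof -
      define Y where "Y = 4 * real CARD('n) * B * (2 * K'.A2 * K'.A2 * 2 powr \<rho>2 * B) * 2 powr (r + \<rho>1 + \<rho>2 - 1)"
      have Y: "Y > 0" unfolding Y_def using B K'.A2 by simp
      obtain KT where KT: "KT \<ge> 0" "\<And>f C. smooth_fun f \<Longrightarrow> gs_decay s t Y C f \<Longrightarrow> cmod (T f) \<le> KT * C"
        using gs_dual_bound[OF T s0 t0 Y] by blast
      have "R m f \<in> GS s t \<and> cmod (L m f) \<le> KT * (4 * K'.moment_const * Y) * D" if f: "smooth_fun f" "gs_decay r t B D f" for m f D
      proof
        have i: "gs_decay s t Y (D * (4 * K'.moment_const * Y) / 2 ^ m) (R m f)"
          using K'.qfun_error(2)[OF mom' f B r(1) assms(7) \<rho>21, of m] unfolding Y_def r(2) R_def .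
        have sm: "smooth_fun (R m f)"
          unfolding R_def by (rule smooth_diff(1)[OF K'.qfun_error(1)[OF mom' f B r(1) assms(7) \<rho>21] f(1)])
        show "R m f \<in> GS s t" by (rule GS_I[OF sm i Y s0 t0])
        have "2 ^ m * cmod (T (R m f)) \<le> 2 ^ m * (KT * (D * (4 * K'.moment_const * Y) / 2 ^ m))"
          by (intro mult_left_mono KT(2)[OF sm i]) simp
        then show "cmod (L m f) \<le> KT * (4 * K'.moment_const * Y) * D"
          by (simp add: L_def norm_mult norm_power mult_ac)
      qed
      then show ?thesis by (intro exI[of _ "KT * (4 * K'.moment_const * Y)"] allI impI)
    qed
    have RGS: "R m g \<in> GS s t" if g: "g \<in> GS r t" for m g
    proof -
      obtain B D where g': "smooth_fun g" "B \<ge> 1" "gs_decay r t B D g"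
        using GS_D[OF g r(1) t0] .
      then show ?thesis using Lbound[OF g'(2)] by (elim exE) simp
    qed
    have Rlin: "R m (\<lambda>x. a * f x + b * g x) = (\<lambda>x. a * R m f x + b * R m g x)"
      if "f \<in> GS r t" "g \<in> GS r t" for m f g a b
      unfolding R_def K'.qfun_lincomb[OF poly_bounded[OF that(1)] poly_bounded[OF that(2)]] by (simp add: algebra_simps)
    have Llin: "gs_linear r t (L m)" for m
      unfolding gs_linear_def
    proof (intro ballI allI)
      fix f g :: "real^'n \<Rightarrow> complex" and a b :: complex
      assume fg: "f \<in> GS r t" "g \<in> GS r t"
      have "T (R m (\<lambda>x. a * f x + b * g x)) = a * T (R m f) + b * T (R m g)"
        unfolding Rlin[OF fg] by (rule gs_linearD[OF lin RGS[OF fg(1)] RGS[OF fg(2)]])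
      then show "L m (\<lambda>x. a * f x + b * g x) = a * L m f + b * L m g"
        by (simp add: L_def algebra_simps)
    qed
    \<comment> \<open>Linearity and continuity of \<open>S m\<close>, as well as the convergence,
      are read off from this splitting.\<close>
    have SL: "S m g = T g + L m g / 2 ^ m" if g: "g \<in> GS r t" for m g
    proof -
      have "qfun \<psi> (int m) g = (\<lambda>x. R m g x + g x)" by (simp add: R_def)
      then have "S m g = T (R m g) + T g"
        unfolding S[OF g] using gs_linear_add[OF lin RGS[OF g], of g] g sub by auto
      then show ?thesis by (simp add: L_def)
    qed
    have Tlin: "gs_linear r t T"
      unfolding gs_linear_def using gs_linearD[OF lin] sub by blast
    have Tbound: "\<exists>KT. \<forall>f D. smooth_fun f \<longrightarrow> gs_decay r t B D f \<longrightarrow> cmod (T f) \<le> KT * D" if B: "B \<ge> 1" for B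
    proof -
      have B0: "B > 0" using B by simp
      obtain KT where "KT \<ge> 0" and KT: "\<And>f C. smooth_fun f \<Longrightarrow> gs_decay s t B C f \<Longrightarrow> cmod (T f) \<le> KT * C"
        using gs_dual_bound[OF T s0 t0 B0] by blast
      have "cmod (T f) \<le> KT * D" if "smooth_fun f" "gs_decay r t B D f" for f D
        by (rule KT[OF that(1) gs_decay_mono[OF that(2)]]) (use B rs in auto)
      then show ?thesis by (intro exI[of _ KT] allI impI)
    qed
    have "gs_dual_tendsto r t S T"
      unfolding gs_dual_tendsto_def
    proof (intro conjI allI impI)
      show "gs_dual r t T" by (rule gs_dualI[OF Tlin r(1) t0 Tbound])
      show "gs_dual r t (S m)" for m
      proof (rule gs_dualI[OF _ r(1) t0])
        show "gs_linear r t (S m)"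
          unfolding gs_linear_def
        proof (intro ballI allI)
          fix f g :: "real^'n \<Rightarrow> complex" and a b :: complex
          assume fg: "f \<in> GS r t" "g \<in> GS r t"
          show "S m (\<lambda>x. a * f x + b * g x) = a * S m f + b * S m g"
            unfolding SL[OF fg(1)] SL[OF fg(2)] SL[OF GS_lincomb[OF fg r(1) t0]] gs_linearD[OF Tlin fg] gs_linearD[OF Llin fg]
            by (simp add: algebra_simps add_divide_distrib)
        qed
        fix B :: real assume B: "B \<ge> 1"
        obtain K1 where "\<forall>m f D. smooth_fun f \<longrightarrow> gs_decay r t B D f \<longrightarrow> R m f \<in> GS s t \<and> cmod (L m f) \<le> K1 * D"
          using Lbound[OF B] by (elim exE) (rule that)
        then have K1: "cmod (L m f) \<le> K1 * D" if "smooth_fun f" "gs_decay r t B D f" for f D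
          using that by simp
        obtain K2 where "\<forall>f D. smooth_fun f \<longrightarrow> gs_decay r t B D f \<longrightarrow> cmod (T f) \<le> K2 * D"
          using Tbound[OF B] by (elim exE) (rule that)
        then have K2: "cmod (T f) \<le> K2 * D" if "smooth_fun f" "gs_decay r t B D f" for f D
          using that by simp
        have "cmod (S m f) \<le> (K2 + K1) * D" if f: "smooth_fun f" "gs_decay r t B D f" for f D
        proof -
          have "f \<in> GS r t" by (rule GS_I[OF f _ r(1) t0]) (use B in simp)
          then have "cmod (S m f) \<le> cmod (T f) + cmod (L m f / 2 ^ m)"
            unfolding SL[OF \<open>f \<in> GS r t\<close>] by (intro norm_triangle_ineq)
          also have "cmod (L m f / 2 ^ m) \<le> cmod (L m f)"
            by (simp add: norm_divide norm_power divide_le_eq mult_left_le_one_le mult_le_cancel_left1)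
          finally show ?thesis using K1[OF f] K2[OF f] by (simp add: algebra_simps)
        qed
        then show "\<exists>K. \<forall>f C. smooth_fun f \<longrightarrow> gs_decay r t B C f \<longrightarrow> cmod (S m f) \<le> K * C"
          by (intro exI[of _ "K2 + K1"] allI impI)
      qed
      fix B :: "(real^'n \<Rightarrow> complex) set" and \<epsilon> :: real
      assume B: "gs_bounded r t B" and \<epsilon>: "\<epsilon> > 0"
      have "gs_nbhd0 r t {f \<in> GS r t. \<forall>m. cmod (L m f) \<le> 1}"
      proof (rule gs_nbhd0_polar[OF Llin r(1) t0])
        show "\<exists>K. \<forall>m f C. smooth_fun f \<longrightarrow> gs_decay r t A C f \<longrightarrow> cmod (L m f) \<le> K * C" if "A \<ge> 1" for A
          using Lbound[OF that] by (elim exE, rule_tac x = KL in exI) simp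
      qed simp
      then obtain c where c: "c > 0" "\<And>g. g \<in> B \<Longrightarrow> (\<lambda>x. g x / complex_of_real c) \<in> {f \<in> GS r t. \<forall>m. cmod (L m f) \<le> 1}"
        using B unfolding gs_bounded_def by blast
      have BG: "B \<subseteq> GS r t" using B by (simp add: gs_bounded_def)
      have bd: "cmod (S m g - T g) \<le> c / 2 ^ m" if g: "g \<in> B" for m g
      proof -
        have gG: "g \<in> GS r t" using g BG by blast
        have "L m (\<lambda>x. (1 / of_real c) * g x) = (1 / of_real c) * L m g"
          by (rule gs_linear_mult[OF Llin gG])
        then have eq: "L m (\<lambda>x. g x / of_real c) = L m g / of_real c" by simp
        have "cmod (L m (\<lambda>x. g x / of_real c)) \<le> 1"
          using c(2)[OF g] by blast
        then have "cmod (L m g) / c \<le> 1"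
          unfolding eq using c(1) by (simp add: norm_divide)
        then have "cmod (L m g) \<le> c" using c(1) by simp
        then show ?thesis
          unfolding SL[OF gG] by (simp add: norm_divide norm_power divide_right_mono)
      qed
      have "\<forall>\<^sub>F m in sequentially. c / 2 ^ m < \<epsilon>"
        using LIMSEQ_divide_power2_zero[of c] \<epsilon> by (rule order_tendstoD)
      then show "\<forall>\<^sub>F m in sequentially. \<forall>g\<in>B. cmod (S m g - T g) < \<epsilon>"
        by eventually_elim (use bd in \<open>auto intro: le_less_trans\<close>)
    qed
    then show "gs_dual_tendsto r t (\<lambda>m g. integral\<^sup>L lborel (\<lambda>x. qdist \<phi> (int m) T x * g x)) T"
      by (simp add: S_def[abs_def])
  qed
  show ?thesis
    using part1 part2 unfolding r_def by blast
qed

end
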